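(* For every $\lambda\in[0,1]$, $\alpha\in(0,1]$ and $\Gamma\in(0,1)$, the asymptotic optimal competition complexity of the supply-limiting VCG auction with supply-to-demand ratio $\alpha$, over the class $\mathcal F_{(\lambda\text{-Reg})}$ of $\lambda$-regular distributions, with target approximation ratio $\Gamma$, satisfies $$\mathrm{CC}^{\mathrm{SL}}_{(\infty)}(\alpha,\mathcal F_{(\lambda\text{-Reg})},\Gamma)=\left(\alpha\,\Gamma\left(\frac{\lambda}{\alpha}(1-\lambda)^{\frac{1-\lambda}{\lambda}}+1\right)^{\frac1\lambda}-1\right)^{+}\cdot\mathbf 1\left\{\alpha\ge(1-\lambda)^{\frac1\lambda}\right\},$$ and this value is achieved by setting the supply $s=\lceil\Gamma\cdot\lceil\alpha n\rceil\rceil$; that is, with $s_n=\lceil\Gamma\lceil\alpha n\rceil\rceil$, the limit $\lim_{n\to\infty}\frac1n\mathrm{CC}^{\mathrm{SL}}(s_n,\lceil\alpha n\rceil,n,\mathcal F_{(\lambda\text{-Reg})},\Gamma)$ for this fixed supply equals the same value. In the special cases $\lambda=0$ (MHR distributions, $\mathcal F_{\mathrm{MHR}}$) and $\lambda=1$ (regular distributions, $\mathcal F_{\mathrm{Reg}}$) the formula reads $$\mathrm{CC}^{\mathrm{SL}}_{(\infty)}(\alpha,\mathcal F_{\mathrm{MHR}},\Gamma)=\left(\alpha\,\Gamma\, e^{\frac{1}{e\alpha}}-1\right)^{+}\cdot\mathbf 1\left\{\alpha\ge\tfrac1e\right\},\qquad \mathrm{CC}^{\mathrm{SL}}_{(\infty)}(\alpha,\mathcal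 F_{\mathrm{Reg}},\Gamma)=(\alpha\,\Gamma+\Gamma-1)^{+}.$$
   Context: Notation: $(x)^+=\max\{x,0\}$. Expressions at $\lambda=0$ or $\lambda=1$ are read as limits (e.g. at $\lambda=0$: $(1-\lambda)^{1/\lambda}=1/e$ and the general formula becomes the displayed MHR formula; at $\lambda=1$: $(1-\lambda)^{(1-\lambda)/\lambda}=1$ and $(1-\lambda)^{1/\lambda}=0$). Distributions. A valuation distribution $F$ is a probability distribution on $[0,\infty)$; $F$ also denotes its CDF with the convention $F(v)=\Pr_{x\sim F}[x<v]$. Its support is an interval on which it has a density $f$, except that an atom at the right endpoint of the support is allowed (in particular point masses are allowed). It is assumed that some price $p\in\mathrm{supp}(F)$ maximizes $p\,(1-F(p))$ over $p\ge0$; such a maximizer is called a monopoly reserve $r^*$. For $\lambda\in[0,1]$, $F$ is $\lambda$-regular if $\lambda v-\frac{1-F(v)}{f(v)}$ is non-decreasing in $v$ on the support (excluding the possible atom at its right endpoint); $\lambda=1$ is regularity and $\lambda=0$ is the monotone hazard rate (MHR) condition. $\mathcal F_{(\lambda\text{-Reg})}$ is the class of $\lambda$-regular distributions. Mechanisms. In an $m$-unit, $N$-buyer market ($m\le N$) the buyers have unit demand and values drawn i.i.d. from $F$; all bid truthfully. The VCG auction selling $s\le N$ units gives one unit to each of the $s$ highest-valued buyers (ties broken arbitrarily) and each winner pays the $(s+1)$-th highest value (taken to be $0$ if $N=s$). $\mathrm{RevVCG}_{s:N}(F)$ is its expected total payment. The supply-limiting VCG auction with supply $s\in\{1,\dots,m\}$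 runs the VCG auction to sell only $s$ of the $m$ units. The Bayesian-optimal mechanism with monopoly reserve $r^*$ gives one unit to each of the $m$ highest-valued buyers whose value is at least $r^*$; each winner pays the maximum of $r^*$ and the $(m+1)$-th highest value ($0$ if $N=m$). $\mathrm{RevOPT}_{m:N}(F)$ is its expected total payment. Competition complexity of the supply-limiting VCG auction. For a fixed supply $s\in\{1,\dots,m\}$, $\mathrm{CC}^{\mathrm{SL}}(s,m,n,\mathcal F,\Gamma)=\min\{k\in\mathbb Z_{\ge0}:\ \forall F\in\mathcal F,\ \mathrm{RevVCG}_{s:n+k}(F)\ge\Gamma\cdot\mathrm{RevOPT}_{m:n}(F)\}$. With optimally chosen supply, $$\mathrm{CC}^{\mathrm{SL}}(m,n,\mathcal F,\Gamma)=\min\{k\in\mathbb Z_{\ge0}:\ \exists s\in\{1,\dots,m\}\ \forall F\in\mathcal F,\ \mathrm{RevVCG}_{s:n+k}(F)\ge\Gamma\cdot\mathrm{RevOPT}_{m:n}(F)\}$$ (each is $\infty$ if no such $k$ exists). Finally $$\mathrm{CC}^{\mathrm{SL}}_{(\infty)}(\alpha,\mathcal F,\Gamma)=\lim_{n\to\infty}\frac{\mathrm{CC}^{\mathrm{SL}}(\lceil\alpha n\rceil,n,\mathcal F,\Gamma)}{n}.$$ *)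

theory Defs
  imports "HOL-Probability.Probability" "HOL-Real_Asymp.Real_Asymp"
begin

text \<open>Valuation distributions are Borel probability measures \<open>D\<close> on the reals.\<close>

text \<open>Note the strict inequality, in contrast to \<^const>\<open>cdf\<close>: the probability of
  a sale at price \<open>v\<close> is \<open>1 - strict_cdf D v\<close>, atom at \<open>v\<close> included.\<close>

definition strict_cdf :: "real measure \<Rightarrow> real \<Rightarrow> real" where
  "strict_cdf D v = measure D {..<v}"

definition supp :: "real measure \<Rightarrow> real set" where
  "supp D = {x. \<forall>e>0. measure D (ball x e) > 0}"

definition nonatoms :: "real measure \<Rightarrow> real set" where
  "nonatoms D = {v \<in> supp D. measure D {v} = 0}"

definition is_density_of :: "(real \<Rightarrow> real) \<Rightarrow> real measure \<Rightarrow> bool" where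
  "is_density_of f D \<longleftrightarrow>
     f \<in> borel_measurable borel \<and> (\<forall>x. 0 \<le> f x) \<and>
     (\<forall>A \<in> sets borel. A \<subseteq> nonatoms D \<longrightarrow>
        emeasure D A = (\<integral>\<^sup>+ x \<in> A. ennreal (f x) \<partial>lborel))"

definition is_monopoly_reserve :: "real measure \<Rightarrow> real \<Rightarrow> bool" where
  "is_monopoly_reserve D r \<longleftrightarrow>
     r \<in> supp D \<and>
     (\<forall>p\<ge>0. p * (1 - strict_cdf D p) \<le> r * (1 - strict_cdf D r))"

text \<open>The only possible atom is the right endpoint of the support.\<close>

definition valuation_distribution :: "real measure \<Rightarrow> bool" where
  "valuation_distribution D \<longleftrightarrow>
     prob_space D \<and> sets D = sets borel \<and> measure D {..<0} = 0 \<and>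
     is_interval (supp D) \<and>
     (\<forall>v. measure D {v} > 0 \<longrightarrow> (\<forall>w \<in> supp D. w \<le> v)) \<and>
     (\<exists>f. is_density_of f D) \<and>
     (\<exists>r. is_monopoly_reserve D r)"

text \<open>The quotient is taken in \<^typ>\<open>ereal\<close>, so that it is \<open>\<infinity>\<close> where the density vanishes
  but \<open>F v < 1\<close>. This can only happen at the left endpoint of the support, as for
  \<open>F v = v\<^sup>2\<close> on the unit interval. A density is determined only up to null sets;
  regularity asks for a version with monotone virtual value.\<close>

definition lambda_virtual_value ::
    "real \<Rightarrow> real measure \<Rightarrow> (real \<Rightarrow> real) \<Rightarrow> real \<Rightarrow> ereal" where
  "lambda_virtual_value l D f v =
     ereal (l * v) - ereal (1 - strict_cdf D v) / ereal (f v)"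

definition lambda_regular :: "real \<Rightarrow> real measure set" where
  "lambda_regular l = {D. valuation_distribution D \<and>
     (\<exists>f. is_density_of f D \<and> mono_on (nonatoms D) (lambda_virtual_value l D f))}"

abbreviation regular :: "real measure set" where
  "regular \<equiv> lambda_regular 1"

abbreviation mhr :: "real measure set" where
  "mhr \<equiv> lambda_regular 0"


text \<open>The \<open>j\<close>-th highest (counting from 1) of the values \<open>v 0, \<dots>, v (N - 1)\<close>.\<close>

definition kth_highest :: "nat \<Rightarrow> (nat \<Rightarrow> real) \<Rightarrow> nat \<Rightarrow> real" where
  "kth_highest N v j =
     (if 1 \<le> j \<and> j \<le> N then rev (sort (map v [0..<N])) ! (j - 1) else 0)"

definition vcg_payment :: "nat \<Rightarrow> nat \<Rightarrow> (nat \<Rightarrow> real) \<Rightarrow> real" where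
  "vcg_payment s N v = real s * kth_highest N v (s + 1)"

definition reserve_payment :: "real \<Rightarrow> nat \<Rightarrow> nat \<Rightarrow> (nat \<Rightarrow> real) \<Rightarrow> real" where
  "reserve_payment r m N v =
     real (card {j \<in> {1..m}. r \<le> kth_highest N v j}) * max r (kth_highest N v (m + 1))"

definition rev_vcg :: "nat \<Rightarrow> nat \<Rightarrow> real measure \<Rightarrow> ennreal" where
  "rev_vcg s N D = (\<integral>\<^sup>+ v. ennreal (vcg_payment s N v) \<partial>(\<Pi>\<^sub>M i\<in>{..<N}. D))"

text \<open>If there are several monopoly reserves, an arbitrary one is used; for
  regular distributions the revenue does not depend on this choice.\<close>

definition rev_opt :: "nat \<Rightarrow> nat \<Rightarrow> real measure \<Rightarrow> ennreal" where
  "rev_opt m N D =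
     (\<integral>\<^sup>+ v. ennreal (reserve_payment (SOME r. is_monopoly_reserve D r) m N v)
        \<partial>(\<Pi>\<^sub>M i\<in>{..<N}. D))"

text \<open>Competition complexity; recall that the infimum of the empty set is \<open>\<infinity>\<close> in \<^typ>\<open>enat\<close>.\<close>

definition CC_SL_fixed ::
    "nat \<Rightarrow> nat \<Rightarrow> nat \<Rightarrow> real measure set \<Rightarrow> real \<Rightarrow> enat" where
  "CC_SL_fixed s m n \<F> \<Gamma> =
     Inf (enat ` {k. \<forall>D\<in>\<F>. rev_vcg s (n + k) D \<ge> ennreal \<Gamma> * rev_opt m n D})"

definition CC_SL :: "nat \<Rightarrow> nat \<Rightarrow> real measure set \<Rightarrow> real \<Rightarrow> enat" where
  "CC_SL m n \<F> \<Gamma> =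
     Inf (enat ` {k. \<exists>s\<in>{1..m}. \<forall>D\<in>\<F>. rev_vcg s (n + k) D \<ge> ennreal \<Gamma> * rev_opt m n D})"


text \<open>The expressions \<open>(1 - l)\<^bsup>1/l\<^esup>\<close> and
  \<open>((l / a) (1 - l)\<^bsup>(1 - l)/l\<^esup> + 1)\<^bsup>1/l\<^esup>\<close>, at \<open>l = 0\<close> and \<open>l = 1\<close> read as limits.
  The case \<open>l = 1\<close> of the latter must be separated because \<^term>\<open>0 powr 0 = (0::real)\<close>.\<close>

definition supply_threshold :: "real \<Rightarrow> real" where
  "supply_threshold l = (if l = 0 then 1 / exp 1 else (1 - l) powr (1 / l))"

definition growth_factor :: "real \<Rightarrow> real \<Rightarrow> real" where
  "growth_factor l a =
     (if l = 0 then exp (1 / (exp 1 * a))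
      else if l = 1 then 1 / a + 1
      else (l / a * (1 - l) powr ((1 - l) / l) + 1) powr (1 / l))"

lemma supply_threshold_limits:
  "((\<lambda>l. (1 - l) powr (1 / l)) \<longlongrightarrow> supply_threshold 0) (at_right 0)"
  "((\<lambda>l. (1 - l) powr (1 / l)) \<longlongrightarrow> supply_threshold 1) (at_left 1)"
proof -
  have "((\<lambda>l::real. (1 - l) powr (1 / l)) \<longlongrightarrow> exp (-1)) (at_right 0)"
    by real_asymp
  then show "((\<lambda>l. (1 - l) powr (1 / l)) \<longlongrightarrow> supply_threshold 0) (at_right 0)"
    by (simp add: supply_threshold_def exp_minus inverse_eq_divide)
  have "((\<lambda>l::real. (1 - l) powr (1 / l)) \<longlongrightarrow> 0) (at_left 1)"
    by real_asymp
  then show "((\<lambda>l. (1 - l) powr (1 / l)) \<longlongrightarrow> supply_threshold 1) (at_left 1)"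
    by (simp add: supply_threshold_def)
qed

lemma growth_factor_limits:
  fixes a :: real
  assumes "a > 0"
  shows "((\<lambda>l. (l / a * (1 - l) powr ((1 - l) / l) + 1) powr (1 / l))
           \<longlongrightarrow> growth_factor 0 a) (at_right 0)"
    and "((\<lambda>l. (l / a * (1 - l) powr ((1 - l) / l) + 1) powr (1 / l))
           \<longlongrightarrow> growth_factor 1 a) (at_left 1)"
proof -
  have "((\<lambda>l::real. (l / a * (1 - l) powr ((1 - l) / l) + 1) powr (1 / l))
           \<longlongrightarrow> exp (inverse a * exp (-1))) (at_right 0)"
    using assms by real_asymp
  then show "((\<lambda>l. (l / a * (1 - l) powr ((1 - l) / l) + 1) powr (1 / l))
           \<longlongrightarrow> growth_factor 0 a) (at_right 0)"
    by (simp add: growth_factor_def exp_minus field_simps)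
  have "((\<lambda>l::real. (1 - l) powr ((1 - l) / l)) \<longlongrightarrow> 1) (at_left 1)"
    by real_asymp
  moreover have "((\<lambda>l::real. l) \<longlongrightarrow> 1) (at_left 1)" by (simp add: tendsto_ident_at)
  ultimately have "((\<lambda>l::real. (l / a * (1 - l) powr ((1 - l) / l) + 1) powr (1 / l))
           \<longlongrightarrow> (1 / a * 1 + 1) powr (1 / 1)) (at_left 1)"
    using assms by (intro tendsto_intros) (auto simp: add_pos_pos add_nonneg_eq_0_iff)
  then show "((\<lambda>l. (l / a * (1 - l) powr ((1 - l) / l) + 1) powr (1 / l))
           \<longlongrightarrow> growth_factor 1 a) (at_left 1)"
    using assms by (simp add: growth_factor_def)
qed

end

theory Submission
  imports Defs
begin

text \<open>
  Write \<open>S t\<close> for the probability of a value of at least \<open>t\<close>. By the layer cake formula both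
  revenues are integrals of binomial tail probabilities with success probability \<open>S t\<close>.

  Let \<open>r\<close> be the monopoly reserve. If its sale probability \<open>S r\<close> exceeds the supply ratio
  \<open>\<Gamma> * \<alpha>\<close> by a constant factor, the two integrals are compared termwise, for arbitrary
  distributions: the additional buyers make the event that at most \<open>s\<close> buyers reach the reserve
  exponentially less likely. Otherwise there is slack in the ex-ante bound \<open>n * r * S r\<close> on the
  optimal revenue; here \<open>\<lambda>\<close>-regularity enters through the fact that the generalised Pareto tail
  with value \<open>1\<close> at \<open>0\<close> and \<open>S r\<close> at \<open>r\<close> is a lower bound for \<open>S\<close> on \<open>[0, r]\<close>, so that
  concentration reduces the claim to the revenue curve \<open>t * G t\<close> of the generalised Pareto
  tail \<open>G t = (1 + \<lambda> * t) powr (- 1 / \<lambda>)\<close>, whose supremum \<open>(1 - \<lambda>) powr ((1 - \<lambda>) / \<lambda>)\<close> appears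
  in the growth factor.

  Conversely, a point mass rules out every supply below \<open>\<Gamma> * m\<close>, and a generalised Pareto
  distribution truncated near the peak of its revenue curve rules out all larger supplies.
\<close>

section \<open>Binomial tails\<close>

text \<open>Origin of the formula: with (1 + \<kappa>) n buyers of tail \<open>G\<close> and
  \<alpha> \<Gamma> n units, the VCG price concentrates at the t with (1 + \<kappa>) G t = \<alpha>
  \<Gamma>, and the ex-ante optimum per buyer is at most the supremum P of \<open>t * G t\<close>.
  The revenue \<alpha> \<Gamma> t reaches \<Gamma> P once t \<ge> P / \<alpha>, which leads to 1 +
  \<kappa> = \<alpha> \<Gamma> / G (P / \<alpha>). Origin of the indicator: the ex-ante bound is
  invoked only for sale probabilities below a level between \<alpha> \<Gamma> and \<alpha>. The tail
  at the peak of \<open>t * G t\<close> equals the threshold; if that exceeds \<alpha>, all relevant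
  prices lie beyond the peak, where the curve decreases, and every \<kappa> > 0 suffices. Two
  obstacles shape the proof. The bound on n must be uniform over the class, so the error terms are
  Chebyshev bounds and geometric decay with constants in \<lambda>, \<alpha>, \<Gamma> and \<kappa>
  alone. A density is determined only up to null sets and \<open>S\<close> is not known to be
  differentiable, so hazard rate inequalities are used as inequalities between finite
  differences.\<close>

definition bin_tail :: "nat \<Rightarrow> nat \<Rightarrow> real \<Rightarrow> real" where
  "bin_tail n k q = (\<Sum>j=k..n. Bernstein n j q)"

lemma Bernstein_eq_0: "n < k \<Longrightarrow> Bernstein n k q = 0"
  by (simp add: Bernstein_def)

lemma bin_tail_eq_0: "n < k \<Longrightarrow> bin_tail n k q = 0"
  by (simp add: bin_tail_def)

lemma bin_tail_0: "bin_tail n 0 q = 1"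
  by (simp add: bin_tail_def atLeast0AtMost sum_Bernstein)

lemma bin_tail_Suc: "bin_tail n k q = Bernstein n k q + bin_tail n (Suc k) q"
  by (cases "k \<le> n") (simp_all add: bin_tail_def Bernstein_eq_0 sum.atLeast_Suc_atMost)

lemma one_minus_bin_tail: "1 - bin_tail n (Suc s) q = (\<Sum>j\<le>s. Bernstein n j q)"
proof (induction s)
  case 0
  show ?case using bin_tail_0[of n q] bin_tail_Suc[of n 0 q] by simp
next
  case (Suc s)
  then show ?case using bin_tail_Suc[of n "Suc s" q] by simp
qed

lemma bin_tail_nonneg: "0 \<le> q \<Longrightarrow> q \<le> 1 \<Longrightarrow> 0 \<le> bin_tail n k q"
  unfolding bin_tail_def by (intro sum_nonneg Bernstein_nonneg)

lemma bin_tail_antimono: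
  assumes "0 \<le> q" "q \<le> 1" "k \<le> l"
  shows "bin_tail n l q \<le> bin_tail n k q"
  unfolding bin_tail_def using assms
  by (intro sum_mono2) (auto intro: Bernstein_nonneg)

lemma bin_tail_le_1: "0 \<le> q \<Longrightarrow> q \<le> 1 \<Longrightarrow> bin_tail n k q \<le> 1"
  using bin_tail_antimono[of q 0 k n] by (simp add: bin_tail_0)

lemma Bernstein_Suc_Suc:
  "Bernstein (Suc n) (Suc k) q = q * Bernstein n k q + (1 - q) * Bernstein n (Suc k) q"
proof (cases "k < n")
  case True
  then have "n - k = Suc (n - Suc k)" by simp
  then show ?thesis by (simp add: Bernstein_def algebra_simps)
next
  case False
  then show ?thesis by (cases "k = n") (simp_all add: Bernstein_def binomial_eq_0)
qed

lemma bin_tail_Suc_Suc: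
  "bin_tail (Suc n) (Suc k) q = q * bin_tail n k q + (1 - q) * bin_tail n (Suc k) q"
proof -
  have "bin_tail (Suc n) (Suc k) q = (\<Sum>j=k..n. Bernstein (Suc n) (Suc j) q)"
    unfolding bin_tail_def by (simp only: sum.shift_bounds_cl_Suc_ivl)
  also have "\<dots> = q * bin_tail n k q + (1 - q) * (\<Sum>j=k..n. Bernstein n (Suc j) q)"
    unfolding bin_tail_def by (simp add: Bernstein_Suc_Suc sum.distrib sum_distrib_left)
  also have "(\<Sum>j=k..n. Bernstein n (Suc j) q) = (\<Sum>j=Suc k..Suc n. Bernstein n j q)"
    by (simp only: sum.shift_bounds_cl_Suc_ivl)
  also have "\<dots> = bin_tail n (Suc k) q"
    unfolding bin_tail_def
    by (intro sum.mono_neutral_right) (auto simp: Bernstein_eq_0)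
  finally show ?thesis .
qed

lemma bin_tail_mono_trials:
  assumes "0 \<le> q" "q \<le> 1" "n \<le> N"
  shows "bin_tail n k q \<le> bin_tail N k q"
  using assms(3)
proof (induction N rule: dec_induct)
  case (step N)
  have "bin_tail N k q \<le> bin_tail (Suc N) k q"
  proof (cases k)
    case (Suc l)
    have "bin_tail N (Suc l) q = q * bin_tail N (Suc l) q + (1 - q) * bin_tail N (Suc l) q"
      by (simp add: algebra_simps)
    also have "\<dots> \<le> bin_tail (Suc N) (Suc l) q"
      unfolding bin_tail_Suc_Suc using assms by (intro add_mono mult_left_mono bin_tail_antimono) auto
    finally show ?thesis using Suc by simp
  qed (simp add: bin_tail_0)
  with step show ?case by simp
qed simp

lemma bin_tail_mono_prob:
  assumes "0 \<le> p" "p \<le> q" "q \<le> 1"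
  shows "bin_tail n k p \<le> bin_tail n k q"
proof (induction n arbitrary: k)
  case 0
  show ?case by (cases k) (simp_all add: bin_tail_0 bin_tail_eq_0)
next
  case (Suc n)
  show ?case
  proof (cases k)
    case (Suc l)
    have "bin_tail (Suc n) (Suc l) p =
        bin_tail n (Suc l) p + p * (bin_tail n l p - bin_tail n (Suc l) p)"
      by (simp add: bin_tail_Suc_Suc algebra_simps)
    also have "\<dots> \<le> bin_tail n (Suc l) p + q * (bin_tail n l p - bin_tail n (Suc l) p)"
      using assms bin_tail_antimono[of p l "Suc l" n] by (intro add_left_mono mult_right_mono) auto
    also have "\<dots> = q * bin_tail n l p + (1 - q) * bin_tail n (Suc l) p"
      by (simp add: algebra_simps)
    also have "\<dots> \<le> bin_tail (Suc n) (Suc l) q"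
      unfolding bin_tail_Suc_Suc using assms by (intro add_mono mult_left_mono Suc.IH) auto
    finally show ?thesis using Suc by simp
  qed (simp add: bin_tail_0)
qed

lemma Bernstein_Suc_Suc_deriv:
  "(Bernstein (Suc n) (Suc j) has_real_derivative
     real (Suc n) * (Bernstein n j q - Bernstein n (Suc j) q)) (at q)"
proof -
  have 1: "real (Suc n choose Suc j) * real (Suc j) = real (Suc n) * real (n choose j)"
    by (metis Suc_times_binomial_eq mult.commute of_nat_mult)
  have 2: "real (Suc n choose Suc j) * real (n - j) = real (Suc n) * real (n choose Suc j)"
    by (metis binomial_absorb_comp diff_Suc_Suc diff_Suc_1 mult.commute of_nat_mult)
  have "((\<lambda>q. real (Suc n choose Suc j) * q ^ Suc j * (1 - q) ^ (n - j)) has_real_derivative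
      (real (Suc n choose Suc j) * real (Suc j)) * (q ^ j * (1 - q) ^ (n - j))
      - (real (Suc n choose Suc j) * real (n - j)) * (q ^ Suc j * (1 - q) ^ (n - Suc j))) (at q)"
    by (auto intro!: derivative_eq_intros simp: algebra_simps simp del: power_Suc binomial_Suc_Suc)
  then show ?thesis
    unfolding 1 2 by (simp add: Bernstein_def[abs_def] algebra_simps del: power_Suc binomial_Suc_Suc)
qed

text \<open>The derivatives of the summands telescope. The derivative stays existential and is
  scaled by \<open>q\<close>, so that only \<open>Bernstein n k q\<close> appears, without indices n
  - 1 and k - 1; \<open>nn_integral_equal_revenue\<close> uses it in this form.\<close>

lemma bin_tail_deriv:
  assumes "1 \<le> k"
  shows "\<exists>d. (bin_tail n k has_real_derivative d) (at q) \<and> q * d = real k * Bernstein n k q"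
proof (cases n)
  case 0
  then have "bin_tail n k = (\<lambda>_. 0)" using assms by (auto simp: bin_tail_eq_0)
  then show ?thesis using 0 assms by (intro exI[of _ 0]) (simp add: Bernstein_eq_0)
next
  case (Suc n')
  obtain l where l: "k = Suc l" using assms by (cases k) auto
  have eq: "bin_tail (Suc n') (Suc l) = (\<lambda>q. \<Sum>j=l..n'. Bernstein (Suc n') (Suc j) q)"
    unfolding bin_tail_def by (auto simp only: sum.shift_bounds_cl_Suc_ivl)
  have "(\<Sum>j=l..n'. Bernstein n' j q - Bernstein n' (Suc j) q) = Bernstein n' l q"
    using sum_natinterval_diff[of "\<lambda>j. Bernstein n' j q" l n'] by (simp add: Bernstein_eq_0)
  then have "(\<Sum>j=l..n'. real (Suc n') * (Bernstein n' j q - Bernstein n' (Suc j) q))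
      = real (Suc n') * Bernstein n' l q"
    by (simp only: sum_distrib_left[symmetric])
  moreover have "((\<lambda>q. \<Sum>j=l..n'. Bernstein (Suc n') (Suc j) q) has_real_derivative
      (\<Sum>j=l..n'. real (Suc n') * (Bernstein n' j q - Bernstein n' (Suc j) q))) (at q)"
    by (intro DERIV_sum Bernstein_Suc_Suc_deriv)
  moreover have "q * (real (Suc n') * Bernstein n' l q) = real k * Bernstein n k q"
  proof -
    have "real (Suc n') * real (n' choose l) = real (Suc l) * real (Suc n' choose Suc l)"
      by (metis Suc_times_binomial_eq mult.commute of_nat_mult)
    then have "q * (real (Suc n') * Bernstein n' l q) =
       (real (Suc l) * real (Suc n' choose Suc l)) * (q * q ^ l * (1 - q) ^ (n' - l))"
      by (simp add: Bernstein_def mult_ac)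
    then show ?thesis by (simp add: Bernstein_def Suc l mult_ac)
  qed
  ultimately show ?thesis unfolding Suc l eq by auto
qed

text \<open>Both sides are the mean of min(X, m) for a binomial X: on the left by summing tails, on
  the right by splitting off the event X > m.\<close>

lemma sum_bin_tail:
  "(\<Sum>k=1..m. bin_tail n k q) =
     (\<Sum>k=1..m. real k * Bernstein n k q) + real m * bin_tail n (Suc m) q"
proof (induction m)
  case (Suc m)
  then show ?case using bin_tail_Suc[of n "Suc m" q] by (simp add: algebra_simps)
qed simp

lemma sum_k_Bernstein_split:
  assumes "m \<le> n"
  shows "real n * q = (\<Sum>k=1..m. real k * Bernstein n k q) + (\<Sum>k=Suc m..n. real k * Bernstein n k q)"
proof -
  have "real n * q = (\<Sum>k\<le>n. real k * Bernstein n k q)" by (simp add: sum_k_Bernstein)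
  also have "{..n} = insert 0 ({1..m} \<union> {Suc m..n})" using assms by auto
  also have "(\<Sum>k\<in>\<dots>. real k * Bernstein n k q) = (\<Sum>k\<in>{1..m} \<union> {Suc m..n}. real k * Bernstein n k q)"
    by (subst sum.insert) auto
  also have "\<dots> = (\<Sum>k=1..m. real k * Bernstein n k q) + (\<Sum>k=Suc m..n. real k * Bernstein n k q)"
    by (intro sum.union_disjoint) auto
  finally show ?thesis .
qed

text \<open>The mean of min(X, m) is at most the mean of X: the terms with k > m are weighted by m
  instead of k.\<close>

lemma sum_bin_tail_le:
  assumes "0 \<le> q" "q \<le> 1" "m \<le> n"
  shows "(\<Sum>k=1..m. bin_tail n k q) \<le> real n * q"
proof -
  have "real m * bin_tail n (Suc m) q \<le> (\<Sum>k=Suc m..n. real k * Bernstein n k q)"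
    unfolding bin_tail_def sum_distrib_left using assms
    by (intro sum_mono mult_right_mono Bernstein_nonneg) auto
  then show ?thesis unfolding sum_bin_tail sum_k_Bernstein_split[OF assms(3)] by simp
qed

text \<open>Capping X at m costs at most n on the event X > m. This bounds from below what the
  optimal mechanism earns at its reserve price.\<close>

lemma sum_bin_tail_ge:
  assumes "0 \<le> q" "q \<le> 1" "m \<le> n"
  shows "real n * q - real n * bin_tail n (Suc m) q \<le> (\<Sum>k=1..m. bin_tail n k q)"
proof -
  have "(\<Sum>k=Suc m..n. real k * Bernstein n k q) \<le> real n * bin_tail n (Suc m) q"
    unfolding bin_tail_def sum_distrib_left using assms
    by (intro sum_mono mult_right_mono Bernstein_nonneg) auto
  moreover have "0 \<le> real m * bin_tail n (Suc m) q"
    using assms by (simp add: bin_tail_nonneg)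
  ultimately show ?thesis unfolding sum_bin_tail sum_k_Bernstein_split[OF assms(3)] by simp
qed

section \<open>Concentration and decay of binomial tails\<close>

lemma Bernstein_variance: "(\<Sum>k\<le>n. (real k - real n * q)\<^sup>2 * Bernstein n k q) = real n * q * (1 - q)"
proof -
  have "(\<Sum>k\<le>n. (real k - real n * q)\<^sup>2 * Bernstein n k q) =
     (\<Sum>k\<le>n. real k * (real k - 1) * Bernstein n k q)
      + (1 - 2 * real n * q) * (\<Sum>k\<le>n. real k * Bernstein n k q)
      + (real n * q)\<^sup>2 * (\<Sum>k\<le>n. Bernstein n k q)"
    unfolding sum_distrib_left sum.distrib[symmetric]
    by (intro sum.cong refl) (simp add: algebra_simps power2_eq_square)
  also have "\<dots> = real n * q * (1 - q)"
    unfolding sum_kk_Bernstein sum_k_Bernstein sum_Bernstein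
    by (simp add: algebra_simps power2_eq_square)
  finally show ?thesis .
qed

lemma Bernstein_chebyshev:
  assumes "0 \<le> q" "q \<le> 1" "J \<subseteq> {..n}" "0 < d" "\<And>j. j \<in> J \<Longrightarrow> d \<le> \<bar>real j - real n * q\<bar>"
  shows "(\<Sum>j\<in>J. Bernstein n j q) \<le> real n / d\<^sup>2"
proof -
  have "(\<Sum>j\<in>J. Bernstein n j q) * d\<^sup>2 \<le> (\<Sum>j\<in>J. (real j - real n * q)\<^sup>2 * Bernstein n j q)"
    unfolding sum_distrib_right
  proof (intro sum_mono)
    fix j assume "j \<in> J"
    then have "d\<^sup>2 \<le> (real j - real n * q)\<^sup>2"
      using assms(4,5) by (metis abs_le_square_iff abs_of_pos)
    then show "Bernstein n j q * d\<^sup>2 \<le> (real j - real n * q)\<^sup>2 * Bernstein n j q"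
      using Bernstein_nonneg[OF assms(1,2)] by (simp add: mult.commute mult_left_mono)
  qed
  also have "\<dots> \<le> (\<Sum>j\<le>n. (real j - real n * q)\<^sup>2 * Bernstein n j q)"
    using assms by (intro sum_mono2) (auto intro: Bernstein_nonneg mult_nonneg_nonneg)
  also have "\<dots> \<le> real n * 1 * 1"
    unfolding Bernstein_variance using assms by (intro mult_mono) auto
  finally show ?thesis using assms(4) by (simp add: pos_le_divide_eq)
qed

lemma bin_tail_le_chebyshev:
  assumes "0 \<le> q" "q \<le> 1" "0 < d" "real n * q + d \<le> real k"
  shows "bin_tail n k q \<le> real n / d\<^sup>2"
  unfolding bin_tail_def using assms by (intro Bernstein_chebyshev) auto

lemma bin_tail_ge_chebyshev:
  assumes "0 \<le> q" "q \<le> 1" "0 < d" "real s + d \<le> real n * q"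
  shows "1 - bin_tail n (Suc s) q \<le> real n / d\<^sup>2"
proof -
  have "real n * q \<le> real n * 1" using assms by (intro mult_left_mono) auto
  then have "s \<le> n" using assms by simp
  then show ?thesis
    unfolding one_minus_bin_tail using assms by (intro Bernstein_chebyshev) auto
qed

text \<open>Termwise, \<open>Bernstein (Suc n) j q\<close> arises from
  \<open>Bernstein n j q\<close> by the factor (n + 1) (1 - q) / (n + 1 - j), which is largest at j
  = s.\<close>

lemma bin_lower_tail_ratio:
  assumes "0 \<le> q" "q \<le> 1" "s \<le> n"
  shows "(real (Suc n) - real s) * (1 - bin_tail (Suc n) (Suc s) q)
           \<le> real (Suc n) * (1 - q) * (1 - bin_tail n (Suc s) q)"
  unfolding one_minus_bin_tail sum_distrib_left
proof (rule sum_mono)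
  fix j assume "j \<in> {..s}"
  then have j: "j \<le> s" "j \<le> n" using assms by auto
  have b: "(real (Suc n) - real j) * real (Suc n choose j) = real (Suc n) * real (n choose j)"
    using binomial_absorb_comp[of "Suc n" j] j
    by (metis Suc_leI diff_Suc_1 le_SucI of_nat_diff of_nat_mult)
  have "(real (Suc n) - real s) * Bernstein (Suc n) j q \<le> (real (Suc n) - real j) * Bernstein (Suc n) j q"
    using j Bernstein_nonneg[OF assms(1,2)] by (intro mult_right_mono) auto
  also have "\<dots> = ((real (Suc n) - real j) * real (Suc n choose j)) * (q ^ j * (1 - q) ^ (Suc n - j))"
    by (simp add: Bernstein_def)
  also have "\<dots> = real (Suc n) * (1 - q) * Bernstein n j q"
    unfolding b using j by (simp add: Bernstein_def Suc_diff_le)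
  finally show "(real (Suc n) - real s) * Bernstein (Suc n) j q \<le> real (Suc n) * (1 - q) * Bernstein n j q" .
qed

text \<open>One more trial multiplies the lower tail by at most (1 - q) / (1 - \<theta>), because
  the bound on s persists as the number of trials grows. For q > \<theta> this factor is below 1:
  the gain from additional buyers is exponential.\<close>

lemma bin_lower_tail_decay:
  assumes "0 \<le> q" "q \<le> 1" "0 \<le> \<theta>" "\<theta> < 1" "real s \<le> \<theta> * real n" "n \<le> N"
  shows "1 - bin_tail N (Suc s) q \<le> ((1 - q) / (1 - \<theta>)) ^ (N - n) * (1 - bin_tail n (Suc s) q)"
  using assms(6)
proof (induction N rule: dec_induct)
  case (step N)
  let ?L = "\<lambda>n. 1 - bin_tail n (Suc s) q"
  have L: "0 \<le> ?L M" for M using assms by (simp add: bin_tail_le_1)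
  have "\<theta> * real n \<le> \<theta> * real N" using step assms by (intro mult_left_mono) auto
  moreover have "\<theta> * real N \<le> 1 * real N" using assms by (intro mult_right_mono) auto
  ultimately have s: "real s \<le> \<theta> * real N" "s \<le> N" using assms by linarith+
  have "real (Suc N) * ((1 - \<theta>) * ?L (Suc N)) = (real (Suc N) - \<theta> * real (Suc N)) * ?L (Suc N)"
    by (simp add: algebra_simps)
  also have "\<dots> \<le> (real (Suc N) - real s) * ?L (Suc N)"
    using s assms L by (intro mult_right_mono) (auto simp: algebra_simps)
  also have "\<dots> \<le> real (Suc N) * (1 - q) * ?L N"
    using s assms by (intro bin_lower_tail_ratio) auto
  finally have "(1 - \<theta>) * ?L (Suc N) \<le> (1 - q) * ?L N"
    by (subst (asm) mult.assoc) (erule mult_left_le_imp_le, simp)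
  then have "?L (Suc N) \<le> (1 - q) / (1 - \<theta>) * ?L N"
    using assms by (simp add: field_simps)
  also have "\<dots> \<le> (1 - q) / (1 - \<theta>) * (((1 - q) / (1 - \<theta>)) ^ (N - n) * ?L n)"
    using step assms by (intro mult_left_mono) auto
  finally show ?case using step by (simp add: Suc_diff_le)
qed simp

section \<open>Revenue in terms of binomial tails\<close>

text \<open>Reduces order statistics to counts of values in a half-line, which are binomial for
  independent samples. In the descending list the positions with value at least t form an initial
  segment.\<close>

lemma kth_highest_ge_iff:
  assumes "1 \<le> j" "j \<le> N"
  shows "t \<le> kth_highest N v j \<longleftrightarrow> j \<le> card {i \<in> {..<N}. t \<le> v i}"
proof -
  define xs where "xs = rev (sort (map v [0..<N]))"
  have len: "length xs = N" by (simp add: xs_def)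
  have desc: "xs ! b \<le> xs ! a" if "a \<le> b" "b < N" for a b
  proof -
    have "sorted (rev xs)" by (simp add: xs_def)
    then show ?thesis using that len by (simp add: sorted_rev_iff_nth_mono)
  qed
  have "{i \<in> {..<N}. t \<le> v i} = {i. i < length (map v [0..<N]) \<and> t \<le> map v [0..<N] ! i}"
    by auto
  then have "card {i \<in> {..<N}. t \<le> v i} = length (filter ((\<le>) t) (map v [0..<N]))"
    by (simp only: length_filter_conv_card)
  also have "\<dots> = length (filter ((\<le>) t) xs)"
    unfolding xs_def by (simp add: rev_filter[symmetric] filter_sort)
  also have "\<dots> = card {i. i < N \<and> t \<le> xs ! i}"
    by (simp add: length_filter_conv_card len)
  finally have card: "card {i \<in> {..<N}. t \<le> v i} = card {i. i < N \<and> t \<le> xs ! i}" .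
  have kth: "kth_highest N v j = xs ! (j - 1)"
    using assms by (simp add: kth_highest_def xs_def)
  show ?thesis
  proof (cases "t \<le> xs ! (j - 1)")
    case True
    have "{..<j} \<subseteq> {i. i < N \<and> t \<le> xs ! i}"
    proof
      fix i assume "i \<in> {..<j}"
      then show "i \<in> {i. i < N \<and> t \<le> xs ! i}"

        using assms True order_trans[OF True desc[of i "j - 1"]] by auto
    qed
    then have "card {..<j} \<le> card {i. i < N \<and> t \<le> xs ! i}" by (intro card_mono) auto
    then show ?thesis using True kth card by simp
  next
    case False
    have "{i. i < N \<and> t \<le> xs ! i} \<subseteq> {..<j - 1}"
    proof
      fix i assume "i \<in> {i. i < N \<and> t \<le> xs ! i}"
      then show "i \<in> {..<j - 1}"
        using False desc[of "j - 1" i] order_trans[of t "xs ! i" "xs ! (j - 1)"]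
        by (cases "j - 1 \<le> i") auto
    qed
    then have "card {i. i < N \<and> t \<le> xs ! i} \<le> card {..<j - 1}" by (intro card_mono) auto
    then show ?thesis using False kth card assms by simp
  qed
qed

text \<open>Separates the payments at the reserve price, a sum of indicators, from the excess of the
  (m + 1)-st value over the reserve, so that each part has an expectation in terms of binomial
  tails.\<close>

lemma reserve_payment_eq:
  assumes "0 \<le> r" "m \<le> n"
  shows "reserve_payment r m n v =
     r * (\<Sum>k=1..m. of_bool (k \<le> card {i \<in> {..<n}. r \<le> v i}))
       + real m * max 0 (kth_highest n v (Suc m) - r)"
proof -
  let ?X = "card {i \<in> {..<n}. r \<le> v i}" and ?K = "kth_highest n v (Suc m)"
  have "{j \<in> {1..m}. r \<le> kth_highest n v j} = {j \<in> {1..m}. j \<le> ?X}"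
    using assms(2) kth_highest_ge_iff by auto
  then have c: "real (card {j \<in> {1..m}. r \<le> kth_highest n v j}) = (\<Sum>k=1..m. of_bool (k \<le> ?X))"
    by (simp add: Int_def)
  show ?thesis
  proof (cases "r < ?K")
    case True
    \<comment> \<open>For m = n, \<open>kth_highest\<close> takes its default value 0, which cannot
      exceed r \<ge> 0.\<close>
    with assms have "m < n" by (cases "m = n") (auto simp: kth_highest_def)
    then have "Suc m \<le> ?X" using kth_highest_ge_iff[of "Suc m" n r v] True by auto
    then have "(\<Sum>k=1..m. of_bool (k \<le> ?X) :: real) = (\<Sum>k=1..m. 1)"
      by (intro sum.cong) auto
    then show ?thesis using True c by (simp add: reserve_payment_def algebra_simps)
  next
    case False
    then show ?thesis using c by (simp add: reserve_payment_def)
  qed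
qed

section \<open>Binomial law of counts and layer cake formula for order statistics\<close>

locale real_prob = prob_space D for D :: "real measure" +
  assumes sets_D [measurable_cong]: "sets D = sets borel"
begin

lemma space_D [simp]: "space D = UNIV"
  using sets_eq_imp_space_eq[OF sets_D] by simp

lemma one_minus_strict_cdf: "1 - strict_cdf D t = prob {t..}"
proof -
  have "prob (space D - {..<t}) = 1 - prob {..<t}"
    by (rule prob_compl) (simp add: sets_D)
  moreover have "space D - {..<t} = {t..}" by auto
  ultimately show ?thesis by (simp add: strict_cdf_def)
qed

lemma prob_atLeast_antimono: "s \<le> t \<Longrightarrow> prob {t..} \<le> prob {s..}"
  by (intro finite_measure_mono) (auto simp: sets_D)

lemma borel_measurable_prob_atLeast [measurable]: "(\<lambda>t. prob {t..}) \<in> borel_measurable borel"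
proof -
  have "mono (\<lambda>t. - prob {t..})" by (intro monoI) (simp add: prob_atLeast_antimono)
  then have "(\<lambda>t. - (- prob {t..})) \<in> borel_measurable borel"
    by (intro borel_measurable_uminus borel_measurable_mono)
  then show ?thesis by simp
qed

abbreviation sample :: "nat \<Rightarrow> (nat \<Rightarrow> real) measure" where
  "sample N \<equiv> \<Pi>\<^sub>M i\<in>{..<N}. D"

lemma prob_space_sample: "prob_space (sample N)"
  by (intro prob_space_PiM prob_space_axioms)

text \<open>The sample space splits into product sets \<open>E J\<close> on which exactly the
  coordinates in \<open>J\<close> fall into \<open>A\<close>; grouping the \<open>J\<close> by
  cardinality yields the Bernstein weights.\<close>

lemma emeasure_sample_count:
  assumes [measurable]: "A \<in> sets borel"
  shows "{v \<in> space (sample N). k \<le> card {i \<in> {..<N}. v i \<in> A}} \<in> sets (sample N)"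
    and "emeasure (sample N) {v \<in> space (sample N). k \<le> card {i \<in> {..<N}. v i \<in> A}}
           = ennreal (bin_tail N k (prob A))"
proof -
  interpret P: finite_product_prob_space "\<lambda>_. D" "{..<N}"
    by unfold_locales auto
  define E where "E J = (\<Pi>\<^sub>E i\<in>{..<N}. if i \<in> J then A else - A)" for J
  define Js where "Js = {J. J \<subseteq> {..<N} \<and> k \<le> card J}"
  have fin: "finite Js" unfolding Js_def by (rule finite_subset[of _ "Pow {..<N}"]) auto
  have E_sets: "E J \<in> sets (sample N)" for J
    unfolding E_def by (intro sets_PiM_I_finite) (auto simp: sets_D)
  have E_iff: "v \<in> E J \<longleftrightarrow> v \<in> space (sample N) \<and> {i \<in> {..<N}. v i \<in> A} = J" if "J \<subseteq> {..<N}" for v J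
    using that unfolding E_def space_PiM by (auto simp: PiE_iff split: if_splits)
  have eq: "{v \<in> space (sample N). k \<le> card {i \<in> {..<N}. v i \<in> A}} = (\<Union>J\<in>Js. E J)"
  proof (intro set_eqI iffI)
    fix v assume "v \<in> {v \<in> space (sample N). k \<le> card {i \<in> {..<N}. v i \<in> A}}"
    then show "v \<in> (\<Union>J\<in>Js. E J)"
      using E_iff[of "{i \<in> {..<N}. v i \<in> A}" v]
      by (intro UN_I[of "{i \<in> {..<N}. v i \<in> A}"]) (auto simp: Js_def)
  next
    fix v assume "v \<in> (\<Union>J\<in>Js. E J)"
    then show "v \<in> {v \<in> space (sample N). k \<le> card {i \<in> {..<N}. v i \<in> A}}"
      using E_iff by (auto simp: Js_def)
  qed
  have disj: "disjoint_family_on E Js"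
    unfolding disjoint_family_on_def
  proof (intro ballI impI)
    fix J J' assume "J \<in> Js" "J' \<in> Js" "J \<noteq> J'"
    then show "E J \<inter> E J' = {}" using E_iff by (auto simp: Js_def)
  qed
  have prob_E: "P.prob (E J) = prob A ^ card J * (1 - prob A) ^ (N - card J)" if "J \<subseteq> {..<N}" for J
  proof -
    have "P.prob (E J) = (\<Prod>i<N. prob (if i \<in> J then A else - A))"
      unfolding E_def by (intro P.prob_times) (auto simp: sets_D)
    also have "\<dots> = (\<Prod>i<N. if i \<in> J then prob A else 1 - prob A)"
      using prob_compl[of A] by (intro prod.cong) (auto simp: sets_D Compl_eq_Diff_UNIV)
    also have "\<dots> = prob A ^ card ({..<N} \<inter> J) * (1 - prob A) ^ card ({..<N} \<inter> - J)"
      by (simp add: prod.If_cases)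
    also have "{..<N} \<inter> J = J" using that by auto
    also have "{..<N} \<inter> - J = {..<N} - J" by auto
    also have "card ({..<N} - J) = N - card J"
      using that by (simp add: card_Diff_subset finite_subset)
    finally show ?thesis .
  qed
  show "{v \<in> space (sample N). k \<le> card {i \<in> {..<N}. v i \<in> A}} \<in> sets (sample N)"
    unfolding eq using fin E_sets by auto
  have "P.prob (\<Union>J\<in>Js. E J) = (\<Sum>J\<in>Js. P.prob (E J))"
    using fin E_sets disj by (intro P.finite_measure_finite_Union) auto
  also have "\<dots> = (\<Sum>J\<in>Js. prob A ^ card J * (1 - prob A) ^ (N - card J))"
    by (intro sum.cong refl prob_E) (auto simp: Js_def)
  also have "\<dots> = (\<Sum>j=k..N. \<Sum>J\<in>{J \<in> Js. card J = j}. prob A ^ card J * (1 - prob A) ^ (N - card J))"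
    by (intro sum.group[symmetric] fin) (auto simp: Js_def subset_eq_atLeast0_lessThan_card atLeast0LessThan)
  also have "\<dots> = bin_tail N k (prob A)"
    unfolding bin_tail_def
  proof (intro sum.cong refl)
    fix j assume j: "j \<in> {k..N}"
    then have "{J \<in> Js. card J = j} = {J. J \<subseteq> {..<N} \<and> card J = j}" by (auto simp: Js_def)
    then have "card {J \<in> Js. card J = j} = N choose j" by (simp add: n_subsets)
    then show "(\<Sum>J\<in>{J \<in> Js. card J = j}. prob A ^ card J * (1 - prob A) ^ (N - card J)) = Bernstein N j (prob A)"
      by (simp add: Bernstein_def)
  qed
  finally show "emeasure (sample N) {v \<in> space (sample N). k \<le> card {i \<in> {..<N}. v i \<in> A}}
           = ennreal (bin_tail N k (prob A))"
    unfolding eq P.emeasure_eq_measure by simp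
qed

lemma borel_measurable_kth_highest [measurable]:
  "(\<lambda>v. kth_highest N v j) \<in> borel_measurable (sample N)"
proof (cases "1 \<le> j \<and> j \<le> N")
  case True
  have "{v \<in> space (sample N). t \<le> kth_highest N v j} \<in> sets (sample N)" for t

    using emeasure_sample_count(1)[where A="{t..}" and k=j and N=N] True
    by (simp add: kth_highest_ge_iff)
  then show ?thesis by (intro borel_measurable_iff_ge[THEN iffD2]) auto
next
  case False
  then have "(\<lambda>v. kth_highest N v j) = (\<lambda>_. 0)" by (auto simp: kth_highest_def)
  then show ?thesis by simp
qed

text \<open>\<open>ennreal\<close> maps negative reals to 0, so the left side is the positive part
  of x - r.\<close>

lemma ennreal_diff_layer_cake:
  "ennreal (x - r) = (\<integral>\<^sup>+ t. indicator {r<..} t * indicator {t. t \<le> x} t \<partial>lborel)"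
proof -
  have "(\<integral>\<^sup>+ t. indicator {r<..} t * indicator {t. t \<le> x} t \<partial>lborel) = (\<integral>\<^sup>+ t. indicator {r<..x} t \<partial>lborel)"
    by (intro nn_integral_cong) (auto simp: indicator_def)
  also have "\<dots> = ennreal (x - r)"
    by (cases "r \<le> x") (auto simp: ennreal_neg)
  finally show ?thesis ..
qed

lemma nn_integral_kth_highest_excess:
  assumes "0 \<le> r" "1 \<le> j"
  shows "(\<integral>\<^sup>+ v. ennreal (kth_highest N v j - r) \<partial>sample N) =
     (\<integral>\<^sup>+ t\<in>{r<..}. ennreal (bin_tail N j (prob {t..})) \<partial>lborel)"
proof -
  interpret S: prob_space "sample N" by (rule prob_space_sample)
  interpret pair_sigma_finite "sample N" lborel ..
  have meas: "(\<lambda>(v, t). indicator {r<..} t * indicator {t. t \<le> kth_highest N v j} t :: ennreal)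
      \<in> borel_measurable (sample N \<Otimes>\<^sub>M lborel)"
    by measurable
  have "(\<integral>\<^sup>+ v. ennreal (kth_highest N v j - r) \<partial>sample N)
      = (\<integral>\<^sup>+ v. \<integral>\<^sup>+ t. indicator {r<..} t * indicator {t. t \<le> kth_highest N v j} t \<partial>lborel \<partial>sample N)"
    by (simp only: ennreal_diff_layer_cake)
  also have "\<dots> = (\<integral>\<^sup>+ t. \<integral>\<^sup>+ v. indicator {r<..} t * indicator {t. t \<le> kth_highest N v j} t \<partial>sample N \<partial>lborel)"
    by (rule Fubini'[symmetric, OF meas])
  also have "\<dots> = (\<integral>\<^sup>+ t\<in>{r<..}. ennreal (bin_tail N j (prob {t..})) \<partial>lborel)"
  proof (intro nn_integral_cong)
    fix t :: real
    show "(\<integral>\<^sup>+ v. indicator {r<..} t * indicator {t. t \<le> kth_highest N v j} t \<partial>sample N)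
        = ennreal (bin_tail N j (prob {t..})) * indicator {r<..} t"
    proof (cases "r < t")
      case True
      have iff: "t \<le> kth_highest N v j \<longleftrightarrow> j \<le> card {i \<in> {..<N}. v i \<in> {t..}}" for v
      proof (cases "j \<le> N")
        case True
        then show ?thesis using kth_highest_ge_iff[of j N t v] assms by simp
      next
        \<comment> \<open>Here \<open>kth_highest\<close> is its default 0 < t, and at most N < j
          values can be counted: both sides are false.\<close>
        case False
        have "card {i \<in> {..<N}. v i \<in> {t..}} \<le> card {..<N}" by (intro card_mono) auto
        then show ?thesis using False \<open>r < t\<close> assms by (simp add: kth_highest_def)
      qed
      have "(\<integral>\<^sup>+ v. indicator {r<..} t * indicator {t. t \<le> kth_highest N v j} t \<partial>sample N)
          = (\<integral>\<^sup>+ v. indicator {v \<in> space (sample N). j \<le> card {i \<in> {..<N}. v i \<in> {t..}}} v \<partial>sample N)"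
        using True by (intro nn_integral_cong) (simp add: indicator_def iff)
      also have "\<dots> = ennreal (bin_tail N j (prob {t..}))"
        using emeasure_sample_count(2)[where A="{t..}" and k=j and N=N] by simp
      finally show ?thesis using True by simp
    qed simp
  qed
  finally show ?thesis .
qed

lemma ennreal_real_mult: "ennreal (real n * x) = of_nat n * ennreal x"
  by (simp only: ennreal_mult'[OF of_nat_0_le_iff] ennreal_of_nat_eq_real_of_nat)

lemma rev_vcg_eq:
  "rev_vcg s N D = of_nat s * (\<integral>\<^sup>+ t\<in>{0<..}. ennreal (bin_tail N (Suc s) (prob {t..})) \<partial>lborel)"
proof -
  have "rev_vcg s N D = (\<integral>\<^sup>+ v. of_nat s * ennreal (kth_highest N v (Suc s) - 0) \<partial>sample N)"
    unfolding rev_vcg_def vcg_payment_def by (simp add: ennreal_real_mult)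
  also have "\<dots> = of_nat s * (\<integral>\<^sup>+ v. ennreal (kth_highest N v (Suc s) - 0) \<partial>sample N)"
    by (intro nn_integral_cmult) measurable
  also have "\<dots> = of_nat s * (\<integral>\<^sup>+ t\<in>{0<..}. ennreal (bin_tail N (Suc s) (prob {t..})) \<partial>lborel)"
    by (subst nn_integral_kth_highest_excess) auto
  finally show ?thesis .
qed

lemma nn_integral_reserve_payment:
  assumes "0 \<le> r" "m \<le> n"
  shows "(\<integral>\<^sup>+ v. ennreal (reserve_payment r m n v) \<partial>sample n) =
     ennreal (r * (\<Sum>k=1..m. bin_tail n k (prob {r..})))
      + of_nat m * (\<integral>\<^sup>+ t\<in>{r<..}. ennreal (bin_tail n (Suc m) (prob {t..})) \<partial>lborel)"
proof -
  let ?C = "\<lambda>k. {v \<in> space (sample n). k \<le> card {i \<in> {..<n}. v i \<in> {r..}}}"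
  have C [measurable]: "?C k \<in> sets (sample n)" for k
    by (rule emeasure_sample_count) simp
  have "ennreal (reserve_payment r m n v) =
     ennreal r * (\<Sum>k=1..m. indicator (?C k) v)
      + of_nat m * ennreal (kth_highest n v (Suc m) - r)" if "v \<in> space (sample n)" for v
  proof -
    have "ennreal (\<Sum>k=1..m. of_bool (k \<le> card {i \<in> {..<n}. r \<le> v i}))
        = (\<Sum>k=1..m. ennreal (of_bool (k \<le> card {i \<in> {..<n}. r \<le> v i})))"
      by (rule sum_ennreal[symmetric]) simp
    also have "\<dots> = (\<Sum>k=1..m. indicator (?C k) v)"
      using that by (intro sum.cong refl) (simp add: indicator_def)
    finally have *: "ennreal (\<Sum>k=1..m. of_bool (k \<le> card {i \<in> {..<n}. r \<le> v i}))
        = (\<Sum>k=1..m. indicator (?C k) v)" .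
    have max: "ennreal (max 0 x) = ennreal x" for x
      by (cases "0 \<le> x") (auto simp: ennreal_neg)
    have split: "ennreal (r * a + real m * max 0 x) = ennreal r * ennreal a + of_nat m * ennreal (max 0 x)"
      if "0 \<le> a" for a x :: real
      using that assms by (simp add: ennreal_mult ennreal_real_mult)
    have "0 \<le> (\<Sum>k=1..m. of_bool (k \<le> card {i \<in> {..<n}. r \<le> v i}) :: real)"
      by (intro sum_nonneg) simp
    from split[OF this] show ?thesis
      unfolding reserve_payment_eq[OF assms] by (simp only: * max)
  qed
  then have "(\<integral>\<^sup>+ v. ennreal (reserve_payment r m n v) \<partial>sample n) =
      (\<integral>\<^sup>+ v. ennreal r * (\<Sum>k=1..m. indicator (?C k) v)
      + of_nat m * ennreal (kth_highest n v (Suc m) - r) \<partial>sample n)"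
    by (intro nn_integral_cong)
  also have "\<dots> = (\<integral>\<^sup>+ v. ennreal r * (\<Sum>k=1..m. indicator (?C k) v) \<partial>sample n)
      + (\<integral>\<^sup>+ v. of_nat m * ennreal (kth_highest n v (Suc m) - r) \<partial>sample n)"
    by (intro nn_integral_add) measurable
  also have "(\<integral>\<^sup>+ v. ennreal r * (\<Sum>k=1..m. indicator (?C k) v) \<partial>sample n)
      = ennreal r * (\<integral>\<^sup>+ v. (\<Sum>k=1..m. indicator (?C k) v) \<partial>sample n)"
    by (intro nn_integral_cmult) measurable
  also have "(\<integral>\<^sup>+ v. (\<Sum>k=1..m. indicator (?C k) v) \<partial>sample n) = (\<Sum>k=1..m. emeasure (sample n) (?C k))"
    by (subst nn_integral_sum) (use C in \<open>auto intro: sum.cong nn_integral_indicator\<close>)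
  also have "(\<integral>\<^sup>+ v. of_nat m * ennreal (kth_highest n v (Suc m) - r) \<partial>sample n)
      = of_nat m * (\<integral>\<^sup>+ v. ennreal (kth_highest n v (Suc m) - r) \<partial>sample n)"
    by (intro nn_integral_cmult) measurable
  also have "(\<Sum>k=1..m. emeasure (sample n) (?C k)) = ennreal (\<Sum>k=1..m. bin_tail n k (prob {r..}))"
    unfolding emeasure_sample_count(2)[OF borel_closed[OF closed_atLeast]]
    by (intro sum_ennreal bin_tail_nonneg) auto
  finally show ?thesis using assms
    by (simp only: nn_integral_kth_highest_excess ennreal_mult' Suc_le_mono One_nat_def zero_le)
qed

end

section \<open>Generalised Pareto tails\<close>

text \<open>The hazard rate is 1 / (1 + l * t), so the \<lambda>-virtual value is constantly -1:
  these tails are the boundary case of \<lambda>-regularity. The exponential is the limit at l =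
  0.\<close>

definition gp_tail :: "real \<Rightarrow> real \<Rightarrow> real" where
  "gp_tail l t = (if l = 0 then exp (- t) else (1 + l * t) powr (- 1 / l))"

definition gp_quantile :: "real \<Rightarrow> real \<Rightarrow> real" where
  "gp_quantile l q = (if l = 0 then - ln q else (q powr (- l) - 1) / l)"

lemma gp_tail_0 [simp]: "gp_tail l 0 = 1"
  by (simp add: gp_tail_def)

lemma gp_tail_pos: "0 \<le> l \<Longrightarrow> 0 \<le> t \<Longrightarrow> 0 < gp_tail l t"
  using add_pos_nonneg[of 1 "l * t"] by (auto simp: gp_tail_def)

lemma gp_tail_strict_antimono:
  assumes "0 \<le> l" "0 \<le> s" "s < t"
  shows "gp_tail l t < gp_tail l s"
  using assms by (auto simp: gp_tail_def add_pos_nonneg intro!: powr_less_mono2_neg)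

lemma gp_tail_antimono: "0 \<le> l \<Longrightarrow> 0 \<le> s \<Longrightarrow> s \<le> t \<Longrightarrow> gp_tail l t \<le> gp_tail l s"
  using gp_tail_strict_antimono[of l s t] by (cases "s = t") auto

lemma gp_tail_le_1: "0 \<le> l \<Longrightarrow> 0 \<le> t \<Longrightarrow> gp_tail l t \<le> 1"
  using gp_tail_antimono[of l 0 t] by simp

lemma gp_tail_quantile:
  assumes "0 \<le> l" "0 < q"
  shows "gp_tail l (gp_quantile l q) = q"
  using assms by (auto simp: gp_tail_def gp_quantile_def powr_powr)

lemma gp_quantile_nonneg: "0 \<le> l \<Longrightarrow> 0 < q \<Longrightarrow> q \<le> 1 \<Longrightarrow> 0 \<le> gp_quantile l q"
  using powr_mono2'[of "- l" q 1] by (auto simp: gp_quantile_def)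

text \<open>Replaces the sign of a derivative for functions that are not known to be differentiable:
  over n + 1 equal steps the errors add up to C (b - a)^2 / (n + 1), which vanishes in the
  limit.\<close>

lemma le_of_quadratic_error:
  fixes \<theta> :: "real \<Rightarrow> real"
  assumes step: "\<And>x y. a \<le> x \<Longrightarrow> x < y \<Longrightarrow> y \<le> b \<Longrightarrow> \<theta> x - C * (y - x)\<^sup>2 \<le> \<theta> y"
    and "a \<le> b"
  shows "\<theta> a \<le> \<theta> b"
proof (cases "a = b")
  case False
  with assms have ab: "a < b" by simp
  have "\<theta> a - C * (b - a)\<^sup>2 * inverse (real (Suc n)) \<le> \<theta> b" for n
  proof -
    define h where "h = (b - a) / real (Suc n)"
    have h: "h > 0" "real (Suc n) * h = b - a" using ab by (auto simp: h_def)
    have "\<theta> a - real i * (C * h\<^sup>2) \<le> \<theta> (a + real i * h)" if "i \<le> Suc n" for i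
      using that
    proof (induction i)
      case (Suc i)
      have "real (Suc i) * h \<le> real (Suc n) * h" using Suc h by (intro mult_right_mono) auto
      then have "\<theta> (a + real i * h) - C * ((a + real (Suc i) * h) - (a + real i * h))\<^sup>2 \<le> \<theta> (a + real (Suc i) * h)"
        using h by (intro step) (auto simp: algebra_simps)
      then show ?case using Suc by (simp add: algebra_simps)
    qed simp
    from this[of "Suc n"] have "\<theta> a - real (Suc n) * (C * h\<^sup>2) \<le> \<theta> b" using h by simp
    moreover have "real (Suc n) * (C * h\<^sup>2) = C * (b - a)\<^sup>2 * inverse (real (Suc n))"
    proof -
      have "real (Suc n) * (C * h\<^sup>2) = C * (real (Suc n) * h) * h"
        by (simp only: power2_eq_square mult_ac)
      then show ?thesis unfolding h(2) by (simp add: h_def power2_eq_square divide_inverse)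
    qed
    ultimately show ?thesis by (simp only:)
  qed
  moreover have "(\<lambda>n. \<theta> a - C * (b - a)\<^sup>2 * inverse (real (Suc n))) \<longlonglongrightarrow> \<theta> a - C * (b - a)\<^sup>2 * 0"
    by (intro tendsto_intros LIMSEQ_inverse_real_of_nat)
  ultimately have "\<theta> a - C * (b - a)\<^sup>2 * 0 \<le> \<theta> b"
    by (intro LIMSEQ_le_const2) auto
  then show ?thesis by simp
qed simp

text \<open>\<open>affine_log l g\<close> is an antiderivative of \<open>x \<mapsto> 1 / (g + l * x)\<close>.\<close>

definition affine_log :: "real \<Rightarrow> real \<Rightarrow> real \<Rightarrow> real" where
  "affine_log l g x = (if l = 0 then x / g else ln (g + l * x) / l)"

lemma affine_log_bounds:
  assumes "0 \<le> l" "0 < g + l * x" "x \<le> y"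
  shows "affine_log l g y - affine_log l g x \<le> (y - x) / (g + l * x)"
    and "(y - x) / (g + l * y) \<le> affine_log l g y - affine_log l g x"
proof -
  let ?L = "\<lambda>x. g + l * x"
  have Ly: "0 < ?L y" using assms mult_left_mono[of x y l] by linarith
  have "affine_log l g y - affine_log l g x \<le> (y - x) / ?L x \<and> (y - x) / ?L y \<le> affine_log l g y - affine_log l g x"
  proof (cases "l = 0")
    case False
    then have l: "l > 0" using assms by simp
    have eq: "affine_log l g y - affine_log l g x = ln (?L y / ?L x) / l"
      using l assms Ly by (simp add: affine_log_def ln_div diff_divide_distrib)
    have "ln (?L y / ?L x) \<le> ?L y / ?L x - 1" using assms Ly by (intro ln_le_minus_one) simp
    also have "\<dots> = l * ((y - x) / ?L x)" using assms by (simp add: field_simps)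
    finally have 1: "ln (?L y / ?L x) / l \<le> (y - x) / ?L x" using l by (simp add: field_simps)
    have "- ln (?L y / ?L x) = ln (?L x / ?L y)" using assms Ly by (simp add: ln_div)
    also have "\<dots> \<le> ?L x / ?L y - 1" using assms Ly by (intro ln_le_minus_one) simp
    also have "\<dots> = - (l * ((y - x) / ?L y))" using Ly by (simp add: field_simps)
    finally have "(y - x) / ?L y \<le> ln (?L y / ?L x) / l" using l by (simp add: pos_le_divide_eq mult.commute)
    with 1 show ?thesis unfolding eq by simp
  qed (simp add: affine_log_def diff_divide_distrib)
  then show "affine_log l g y - affine_log l g x \<le> (y - x) / ?L x"
    "(y - x) / ?L y \<le> affine_log l g y - affine_log l g x" by auto
qed

lemma ln_one_plus_lower: "0 \<le> u \<Longrightarrow> u - u\<^sup>2 \<le> ln (1 + u)" for u :: real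
proof (cases "u \<le> 1")
  case False
  then have "u - u\<^sup>2 \<le> 0" by (simp add: power2_eq_square)
  moreover have "0 \<le> ln (1 + u)" using False by simp
  ultimately show ?thesis by linarith
qed (rule ln_one_plus_pos_lower_bound)

text \<open>The hypothesis \<open>drop\<close> is the finite-difference form of a hazard rate of at
  least 1 / (g + l x); the claim is its integral. The function \<open>\<theta>\<close> increases up
  to a quadratic error.\<close>

lemma affine_log_le_neg_ln:
  fixes S :: "real \<Rightarrow> real"
  assumes "0 \<le> l" "0 < g + l * a" "a \<le> b"
    and pos: "\<And>x. a \<le> x \<Longrightarrow> x \<le> b \<Longrightarrow> 0 < S x"
    and drop: "\<And>x y. a \<le> x \<Longrightarrow> x < y \<Longrightarrow> y \<le> b \<Longrightarrow> (y - x) * S y / (g + l * y) \<le> S x - S y"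
  shows "affine_log l g b - affine_log l g a \<le> ln (S a) - ln (S b)"
proof -
  define \<theta> where "\<theta> x = - ln (S x) - affine_log l g x" for x
  let ?L = "\<lambda>x. g + l * x"
  have "\<theta> a \<le> \<theta> b"
  proof (rule le_of_quadratic_error[where \<theta> = \<theta> and a = a and b = b and C = "(1 + l) / (?L a)\<^sup>2"])
    fix x y assume xy: "a \<le> x" "x < y" "y \<le> b"
    have Lx: "?L a \<le> ?L x" and Ly: "?L a \<le> ?L y" using xy assms by (auto intro: mult_left_mono)
    have L: "0 < ?L x" "0 < ?L y" using assms Lx Ly by linarith+
    define u where "u = (y - x) / ?L y"
    have u: "0 \<le> u" using xy L by (simp add: u_def)
    have S: "0 < S x" "0 < S y" using pos xy by auto
    have "S y * (1 + u) \<le> S x" using drop[OF xy] by (simp add: u_def algebra_simps)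
    then have "1 + u \<le> S x / S y" using S by (simp add: field_simps)
    then have "ln (1 + u) \<le> ln (S x / S y)" using u S by simp
    then have "u - u\<^sup>2 \<le> ln (S x) - ln (S y)"
      using ln_one_plus_lower[OF u] S by (simp add: ln_div)
    moreover have "affine_log l g y - affine_log l g x \<le> (y - x) / ?L x"
      using affine_log_bounds(1)[of l g x y] assms L xy by simp
    moreover have "(y - x) / ?L x - u \<le> l / (?L a)\<^sup>2 * (y - x)\<^sup>2"
    proof -
      have "(y - x) / ?L x - u = l * (y - x)\<^sup>2 / (?L x * ?L y)"
        using L by (simp add: u_def field_simps power2_eq_square)
      also have "\<dots> \<le> l * (y - x)\<^sup>2 / (?L a)\<^sup>2"
        unfolding power2_eq_square[of "?L a"] using assms L Lx Ly
        by (intro divide_left_mono mult_mono) auto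
      finally show ?thesis by simp
    qed
    moreover have "u\<^sup>2 \<le> 1 / (?L a)\<^sup>2 * (y - x)\<^sup>2"
    proof -
      have "u \<le> (y - x) / ?L a" unfolding u_def using xy L Ly assms by (intro divide_left_mono) auto
      then have "u\<^sup>2 \<le> ((y - x) / ?L a)\<^sup>2" using u by (intro power_mono)
      then show ?thesis by (simp add: power_divide)
    qed
    ultimately show "\<theta> x - (1 + l) / (?L a)\<^sup>2 * (y - x)\<^sup>2 \<le> \<theta> y"
      unfolding \<theta>_def by (simp add: add_divide_distrib distrib_right)
  qed (use assms in auto)
  then show ?thesis by (simp add: \<theta>_def)
qed

text \<open>The reverse comparison, for a hazard rate of at most 1 / (g + l x). The lower bound
  \<open>c\<close> makes the quadratic error uniform, through S x / S y \<le> 1 / c.\<close>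

lemma neg_ln_le_affine_log:
  fixes S :: "real \<Rightarrow> real"
  assumes "0 \<le> l" "0 < g + l * a" "a \<le> b"
    and pos: "0 < c" "\<And>x. a \<le> x \<Longrightarrow> x \<le> b \<Longrightarrow> c \<le> S x \<and> S x \<le> 1"
    and drop: "\<And>x y. a \<le> x \<Longrightarrow> x < y \<Longrightarrow> y \<le> b \<Longrightarrow> S x - S y \<le> (y - x) * S x / (g + l * x)"
  shows "ln (S a) - ln (S b) \<le> affine_log l g b - affine_log l g a"
proof -
  define \<theta> where "\<theta> x = affine_log l g x + ln (S x)" for x
  let ?L = "\<lambda>x. g + l * x"
  have "\<theta> a \<le> \<theta> b"
  proof (rule le_of_quadratic_error[where \<theta> = \<theta> and a = a and b = b and C = "(1 / c + l) / (?L a)\<^sup>2"])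
    fix x y assume xy: "a \<le> x" "x < y" "y \<le> b"
    have Lx: "?L a \<le> ?L x" and Ly: "?L a \<le> ?L y" using xy assms by (auto intro: mult_left_mono)
    have L: "0 < ?L x" "0 < ?L y" using assms Lx Ly by linarith+
    have S: "0 < S x" "0 < S y" "c \<le> S y" "S x \<le> 1"
      using pos(1) pos(2)[of x] pos(2)[of y] xy by auto
    define u where "u = (y - x) / ?L x"
    have u: "0 \<le> u" "u \<le> (y - x) / ?L a"
      unfolding u_def using xy L Lx assms by (auto intro!: divide_left_mono)
    have d: "S x - S y \<le> u * S x" using drop[OF xy] by (simp add: u_def)
    have "S x / S y \<le> 1 / c" using S pos(1) by (intro frac_le) auto
    then have "u * (u * (S x / S y)) \<le> u * (u * (1 / c))" using u by (intro mult_left_mono)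
    moreover have "S x / S y - 1 \<le> u * (S x / S y)"
      using divide_right_mono[OF d, of "S y"] S by (simp add: diff_divide_distrib)
    then have "u * (S x / S y - 1) \<le> u * (u * (S x / S y))" using u by (intro mult_left_mono)
    moreover have "ln (S x / S y) \<le> S x / S y - 1" using S by (intro ln_le_minus_one) simp
    moreover have "u * (S x / S y) = u + u * (S x / S y - 1)" by (simp add: algebra_simps)
    ultimately have "ln (S x) - ln (S y) \<le> u + u\<^sup>2 / c"
      using \<open>S x / S y - 1 \<le> u * (S x / S y)\<close> S by (simp add: ln_div power2_eq_square)
    moreover have "u\<^sup>2 / c \<le> (1 / c) / (?L a)\<^sup>2 * (y - x)\<^sup>2"
    proof -
      have "u\<^sup>2 \<le> ((y - x) / ?L a)\<^sup>2" using u by (intro power_mono)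
      then have "u\<^sup>2 / c \<le> ((y - x) / ?L a)\<^sup>2 / c" using pos(1) by (intro divide_right_mono) auto
      then show ?thesis by (simp add: power_divide mult.commute)
    qed
    moreover have "(y - x) / ?L y \<le> affine_log l g y - affine_log l g x"
      using affine_log_bounds(2)[of l g x y] assms L xy by simp
    moreover have "u - (y - x) / ?L y \<le> l / (?L a)\<^sup>2 * (y - x)\<^sup>2"
    proof -
      have "u - (y - x) / ?L y = l * (y - x)\<^sup>2 / (?L x * ?L y)"
        using L by (simp add: u_def field_simps power2_eq_square)
      also have "\<dots> \<le> l * (y - x)\<^sup>2 / (?L a)\<^sup>2"
        unfolding power2_eq_square[of "?L a"] using assms L Lx Ly
        by (intro divide_left_mono mult_mono) auto
      finally show ?thesis by simp
    qed
    ultimately show "\<theta> x - (1 / c + l) / (?L a)\<^sup>2 * (y - x)\<^sup>2 \<le> \<theta> y"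
      unfolding \<theta>_def by (simp add: add_divide_distrib distrib_right)
  qed (use assms in auto)
  then show ?thesis by (simp add: \<theta>_def)
qed

text \<open>The hypotheses say that the tail \<open>S\<close> lies below the generalised Pareto tail that touches
  it at \<open>t\<close>, once at \<open>r\<close> and once at \<open>0\<close>.\<close>

lemma gp_tail_interpolation:
  fixes S :: "real \<Rightarrow> real"
  assumes l: "0 \<le> l" and tr: "0 \<le> t" "t \<le> r" "0 < r" and g: "0 < g + l * t"
    and S: "0 < S t" "0 < S r" "S r \<le> 1"
    and right: "affine_log l g r - affine_log l g t \<le> ln (S t) - ln (S r)"
    and left: "0 < g \<Longrightarrow> - ln (S t) \<le> affine_log l g t - affine_log l g 0"
  shows "gp_tail l (gp_quantile l (S r) * t / r) \<le> S t"
proof (cases "l = 0")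
  case True
  have "- ln (S t) \<le> t / g" "(r - t) / g \<le> ln (S t) - ln (S r)"
    using left right g True by (simp_all add: affine_log_def diff_divide_distrib)
  then have "- ln (S t) * g \<le> t" "r - t \<le> (ln (S t) - ln (S r)) * g"
    using g True by (simp_all add: pos_le_divide_eq pos_divide_le_eq)
  \<comment> \<open>With the weights r - t and t the terms t (r - t) agree, so the two inequalities
    chain and the common factor g drops out.\<close>
  then have "(r - t) * (- ln (S t) * g) \<le> (r - t) * t" "t * (r - t) \<le> t * ((ln (S t) - ln (S r)) * g)"
    using tr by (intro mult_left_mono; simp)+
  then have "g * (- ln (S t) * r) \<le> g * (- ln (S r) * t)" by (simp add: algebra_simps)
  then have "- ln (S t) * r \<le> - ln (S r) * t" using g True by simp
  then have "ln (S r) * t / r \<le> ln (S t)" using tr by (simp add: pos_divide_le_eq)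
  then have "exp (- (- ln (S r) * t / r)) \<le> exp (ln (S t))" by simp
  then show ?thesis using True S by (simp add: gp_tail_def gp_quantile_def)
next
  case False
  then have l: "0 < l" using l by simp
  let ?L = "\<lambda>x. g + l * x"
  \<comment> \<open>Generalised Pareto tails are those for which this power is affine, so the claim
    becomes that \<open>U\<close> at t lies below the chord from the value 1 at 0 to
    \<open>U r\<close> at r.\<close>
  define U where "U x = S x powr (- l)" for x
  have U: "0 < U t" "0 < U r" "1 \<le> U r"
    using S l powr_mono2'[of "- l" "S r" 1] by (auto simp: U_def)
  have lnU: "ln (U t) = - l * ln (S t)" "ln (U r) = - l * ln (S r)"
    using S by (auto simp: U_def ln_powr)
  have Lr: "0 < ?L r" using g mult_left_mono[of t r l] tr l by linarith
  \<comment> \<open>For g \<le> 0 the touching tail does not extend back to 0 and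
    \<open>left\<close> says nothing, but then this left side is not positive.\<close>
  have "U t * ?L 0 \<le> ?L t"
  proof (cases "0 < g")
    case True
    have "- ln (S t) \<le> (ln (?L t) - ln (?L 0)) / l"
      using left[OF True] l by (simp add: affine_log_def diff_divide_distrib)
    then have "ln (U t) \<le> ln (?L t) - ln (?L 0)"
      using l unfolding lnU by (simp add: pos_le_divide_eq algebra_simps)
    then have "ln (U t * ?L 0) \<le> ln (?L t)" using U True by (simp add: ln_mult)
    then show ?thesis using U g True by simp
  next
    case False
    then have "U t * ?L 0 \<le> 0" using U by (simp add: mult_nonneg_nonpos)
    then show ?thesis using g by linarith
  qed
  then have 1: "(r - t) * (U t * ?L 0) \<le> (r - t) * ?L t" using tr by (intro mult_left_mono) auto
  have "(ln (?L r) - ln (?L t)) / l \<le> ln (S t) - ln (S r)"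
    using right l by (simp add: affine_log_def diff_divide_distrib)
  from mult_left_mono[OF this, of l] have "ln (?L r) - ln (?L t) \<le> ln (U r) - ln (U t)"
    using l unfolding lnU by (simp add: right_diff_distrib[symmetric])
  then have "ln (U t * ?L r) \<le> ln (U r * ?L t)" using U g Lr by (simp add: ln_mult)
  then have "U t * ?L r \<le> U r * ?L t" using U g Lr by simp
  then have "t * (U t * ?L r) \<le> t * (U r * ?L t)" using tr by (intro mult_left_mono) auto
  then have "?L t * (U t * r) \<le> ?L t * (r - t + t * U r)" using 1 by (simp add: algebra_simps)
  then have "U t * r \<le> r - t + t * U r" using g by simp
  then have "U t \<le> 1 + (U r - 1) * t / r" using tr by (simp add: field_simps)
  also have "(U r - 1) * t / r = l * (gp_quantile l (S r) * t / r)"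
    using l by (simp add: gp_quantile_def U_def)
  finally have "U t \<le> 1 + l * (gp_quantile l (S r) * t / r)" .
  then have "(1 + l * (gp_quantile l (S r) * t / r)) powr (- 1 / l) \<le> U t powr (- 1 / l)"
    using U l by (intro powr_mono2') auto
  also have "\<dots> = S t" using S l by (simp add: U_def powr_powr)
  finally show ?thesis using l by (simp add: gp_tail_def)
qed

section \<open>Lower bound for the tail of a lambda-regular distribution\<close>

lemma nn_integral_const_Ico:
  assumes "x \<le> y" "0 \<le> c"
  shows "(\<integral>\<^sup>+ z \<in> {x..<y}. ennreal c \<partial>lborel) = ennreal ((y - x) * c)"
  by (subst nn_integral_cmult_indicator) (use assms in \<open>auto simp: ennreal_mult' mult.commute\<close>)

context real_prob
begin

lemma closed_supp: "closed (supp D)"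
proof -
  have "open (- supp D)"
    unfolding open_contains_ball
  proof
    fix x assume "x \<in> - supp D"
    then obtain e where e: "0 < e" "prob (ball x e) = 0"
      by (auto simp: supp_def zero_less_measure_iff)
    have "ball x e \<subseteq> - supp D"
    proof
      fix y assume "y \<in> ball x e"
      then obtain d where d: "0 < d" "ball y d \<subseteq> ball x e"
        by (rule openE[OF open_ball])
      then have "prob (ball y d) \<le> prob (ball x e)"
        by (intro finite_measure_mono) (auto simp: sets_D)
      then show "y \<in> - supp D" using d e by (auto simp: supp_def not_less)
    qed
    then show "\<exists>e>0. ball x e \<subseteq> - supp D" using e by auto
  qed
  then show ?thesis by (simp add: closed_def)
qed

text \<open>By Lindelof, countably many null balls cover the complement. This lets events be cut
  down to the support, the only place where a density describes \<open>D\<close>.\<close>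

lemma null_Compl_supp: "- supp D \<in> null_sets D"
proof -
  define \<F> where "\<F> = {ball x e | x e. 0 < e \<and> prob (ball x e) = 0}"
  have "\<And>B. B \<in> \<F> \<Longrightarrow> open B" by (auto simp: \<F>_def)
  then obtain \<F>' where F: "\<F>' \<subseteq> \<F>" "countable \<F>'" "\<Union>\<F>' = \<Union>\<F>" by (rule Lindelof) auto
  have "(\<Union>B\<in>\<F>'. B) \<in> null_sets D"
  proof (intro null_sets_UN' F)
    fix B assume "B \<in> \<F>'"
    then show "B \<in> null_sets D" using F by (auto simp: \<F>_def null_sets_def sets_D emeasure_eq_measure)
  qed
  moreover have "- supp D \<subseteq> \<Union>\<F>"
  proof
    fix x assume "x \<in> - supp D"
    then obtain e where "0 < e" "prob (ball x e) = 0" by (auto simp: supp_def zero_less_measure_iff)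
    then show "x \<in> \<Union>\<F>" by (intro UnionI[of "ball x e"]) (auto simp: \<F>_def)
  qed
  ultimately show ?thesis using F(3) closed_supp
    by (intro null_sets_subset[of "\<Union>\<F>" D "- supp D"]) (auto simp: sets_D)
qed

lemma prob_atLeast_diff: "x \<le> y \<Longrightarrow> prob {x..} - prob {y..} = prob {x..<y}"
proof -
  assume "x \<le> y"
  then have "{x..<y} = {x..} - {y..}" by auto
  then show ?thesis using finite_measure_Diff[of "{x..}" "{y..}"] \<open>x \<le> y\<close> by (auto simp: sets_D)
qed

end

locale regular_prob = real_prob +
  fixes l r :: real and f :: "real \<Rightarrow> real"
  assumes l: "0 \<le> l" "l \<le> 1"
    and density: "is_density_of f D"
    and vv_mono: "mono_on (nonatoms D) (lambda_virtual_value l D f)"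
    and nonneg: "prob {..<0} = 0"
    and interval: "is_interval (supp D)"
    and atoms: "\<And>v w. 0 < prob {v} \<Longrightarrow> w \<in> supp D \<Longrightarrow> w \<le> v"
    and r: "r \<in> supp D" "0 < r" "0 < prob {r..}"
begin

lemma f_nonneg: "0 \<le> f x" and f_measurable [measurable]: "f \<in> borel_measurable borel"
  using density by (auto simp: is_density_of_def)

lemma supp_borel [measurable]: "supp D \<in> sets borel"
  using closed_supp by auto

lemma nonatomsI: "v \<in> supp D \<Longrightarrow> v < r \<Longrightarrow> v \<in> nonatoms D"
  using atoms[of v r] r by (force simp: nonatoms_def zero_less_measure_iff)

text \<open>An atom can only be the right endpoint of the support, and r lies in the support, so no
  point below r is an atom and the density applies.\<close>

lemma emeasure_below_r:
  assumes [measurable]: "A \<in> sets borel" and "A \<subseteq> {..<r}"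
  shows "emeasure D A = (\<integral>\<^sup>+ x \<in> A \<inter> supp D. ennreal (f x) \<partial>lborel)"
proof -
  have "emeasure D A = emeasure D (A \<inter> supp D)"
    using emeasure_Diff_null_set[OF null_Compl_supp, of A]
    by (simp add: sets_D Diff_Compl)
  also have "\<dots> = (\<integral>\<^sup>+ x \<in> A \<inter> supp D. ennreal (f x) \<partial>lborel)"
    using density assms nonatomsI by (intro is_density_of_def[THEN iffD1, THEN conjunct2, THEN conjunct2, rule_format]) auto
  finally show ?thesis .
qed

lemma prob_atLeast_0: "prob {0..} = 1"
  using one_minus_strict_cdf[of 0] nonneg by (simp add: strict_cdf_def)

lemma prob_atLeast_pos: "x \<le> r \<Longrightarrow> 0 < prob {x..}"
  using prob_atLeast_antimono[of x r] r by linarith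

lemma virtual_value_eq:
  assumes "x < r"
  shows "lambda_virtual_value l D f x =
    (if f x = 0 then - \<infinity> else ereal (l * x - prob {x..} / f x))"
  using prob_atLeast_pos[of x] assms
  by (auto simp: lambda_virtual_value_def one_minus_strict_cdf divide_ereal_def divide_inverse)

text \<open>If f t = 0, the virtual value is -\<infinity> at t, hence by monotonicity at every
  support point below t, so f vanishes there too. This contradicts the mass below t.\<close>

lemma density_pos:
  assumes "t < r" "prob {t..} < 1"
  shows "t \<in> supp D" "0 < f t"
proof -
  have "prob {..<t} = 1 - prob {t..}"
    using one_minus_strict_cdf[of t] by (simp add: strict_cdf_def)
  then have "emeasure D {..<t} \<noteq> 0" using assms by (simp add: emeasure_eq_measure)
  then have nz: "(\<integral>\<^sup>+ x \<in> {..<t} \<inter> supp D. ennreal (f x) \<partial>lborel) \<noteq> 0"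
    using assms emeasure_below_r[of "{..<t}"] by auto
  show t: "t \<in> supp D"
  proof (rule ccontr)
    assume "t \<notin> supp D"
    then have "{..<t} \<inter> supp D = {}"
      using interval r assms(1) unfolding is_interval_1 by (metis (no_types, lifting) disjoint_iff lessThan_iff less_imp_le)
    then show False using nz by simp
  qed
  show "0 < f t"
  proof (rule ccontr)
    assume "\<not> 0 < f t"
    then have "f t = 0" using f_nonneg[of t] by simp
    have "f x = 0" if "x \<in> {..<t} \<inter> supp D" for x
    proof -
      have "lambda_virtual_value l D f x \<le> lambda_virtual_value l D f t"
        using that assms t by (intro mono_onD[OF vv_mono] nonatomsI) auto
      then show ?thesis using that assms \<open>f t = 0\<close> by (auto simp: virtual_value_eq split: if_splits)
    qed
    then have "(\<integral>\<^sup>+ x \<in> {..<t} \<inter> supp D. ennreal (f x) \<partial>lborel) = (\<integral>\<^sup>+ x. 0 \<partial>(lborel :: real measure))"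
      by (intro nn_integral_cong) (auto simp: indicator_def)
    then show False using nz by simp
  qed
qed

text \<open>Monotonicity of the virtual value from t to z bounds the inverse hazard rate at z by
  \<open>L z\<close>, whose constant term gives equality at t. The density on [x, y) is then bounded
  below by the worst values, those at y.\<close>

lemma tail_drop_ge:
  assumes "t < r" "prob {t..} < 1" "t \<le> x" "x < y" "y \<le> r"
  defines "L \<equiv> \<lambda>x. (prob {t..} / f t - l * t) + l * x"
  shows "(y - x) * prob {y..} / L y \<le> prob {x..} - prob {y..}"
proof -
  note t = density_pos[OF assms(1,2)]
  have L_mono: "L a \<le> L b" if "a \<le> b" for a b using that l by (auto simp: L_def intro: mult_left_mono)
  have "0 < L t" using t prob_atLeast_pos[of t] assms by (simp add: L_def)
  have dens: "prob {y..} / L y \<le> f z" "z \<in> supp D" if z: "z \<in> {x..<y}" for z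
  proof -
    show zs: "z \<in> supp D"
      using interval t(1) r(1) z assms unfolding is_interval_1
      by (meson atLeastLessThan_iff less_imp_le order_trans)
    have zr: "z < r" "t \<le> z" using z assms by auto
    have "lambda_virtual_value l D f t \<le> lambda_virtual_value l D f z"
      using zs zr t assms by (intro mono_onD[OF vv_mono] nonatomsI) auto
    then have "f z \<noteq> 0" "l * t - prob {t..} / f t \<le> l * z - prob {z..} / f z"
      using t zr assms by (auto simp: virtual_value_eq split: if_splits)
    then have fz: "0 < f z" "prob {z..} / f z \<le> L z"
      using f_nonneg[of z] by (auto simp: L_def)
    then have "prob {z..} \<le> L z * f z" by (simp add: pos_divide_le_eq)
    then have "prob {z..} / L z \<le> f z"
      using \<open>0 < L t\<close> L_mono[of t z] zr by (simp add: pos_divide_le_eq mult.commute)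
    moreover have "prob {y..} / L y \<le> prob {z..} / L z"
      using \<open>0 < L t\<close> L_mono[of t z] L_mono[of z y] zr z by (intro frac_le prob_atLeast_antimono) auto
    ultimately show "prob {y..} / L y \<le> f z" by simp
  qed
  have Ly: "0 < L y" using \<open>0 < L t\<close> L_mono[of t y] assms by linarith
  have "ennreal ((y - x) * prob {y..} / L y) = (\<integral>\<^sup>+ z \<in> {x..<y}. ennreal (prob {y..} / L y) \<partial>lborel)"
    using Ly assms(4) by (subst nn_integral_const_Ico) auto
  also have "\<dots> \<le> (\<integral>\<^sup>+ z \<in> {x..<y} \<inter> supp D. ennreal (f z) \<partial>lborel)"
    using dens by (intro nn_integral_mono) (auto simp: indicator_def intro: ennreal_leI)
  also have "\<dots> = emeasure D {x..<y}" using assms by (intro emeasure_below_r[symmetric]) auto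
  also have "\<dots> = ennreal (prob {x..} - prob {y..})"
    using assms by (simp add: emeasure_eq_measure prob_atLeast_diff)
  finally show ?thesis
    using prob_atLeast_antimono[of x y] assms by (simp add: ennreal_le_iff)
qed

text \<open>The mirror image of \<open>tail_drop_ge\<close> to the left of t: the inverse hazard
  rate is now bounded from below, and the worst values are those at x. To the left of t the line
  \<open>L\<close> may become nonpositive, hence the assumption on \<open>L x\<close>.\<close>

lemma tail_drop_le:
  assumes "t < r" "prob {t..} < 1" "x < y" "y \<le> t"
  defines "L \<equiv> \<lambda>x. (prob {t..} / f t - l * t) + l * x"
  assumes Lx: "0 < L x"
  shows "prob {x..} - prob {y..} \<le> (y - x) * prob {x..} / L x"
proof -
  note t = density_pos[OF assms(1,2)]
  have L_mono: "L a \<le> L b" if "a \<le> b" for a b using that l by (auto simp: L_def intro: mult_left_mono)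
  have dens: "f z \<le> prob {x..} / L x" if z: "z \<in> {x..<y}" "z \<in> supp D" for z
  proof (cases "f z = 0")
    case False
    have zr: "z < r" "z \<le> t" using z assms by auto
    have "lambda_virtual_value l D f z \<le> lambda_virtual_value l D f t"
      using z zr t assms by (intro mono_onD[OF vv_mono] nonatomsI) auto
    then have "l * z - prob {z..} / f z \<le> l * t - prob {t..} / f t"
      using t zr assms False by (auto simp: virtual_value_eq)
    then have fz: "0 < f z" "L z \<le> prob {z..} / f z"
      using f_nonneg[of z] False by (auto simp: L_def less_le)
    then have "L z * f z \<le> prob {z..}" by (simp add: pos_le_divide_eq)
    then have "f z \<le> prob {z..} / L z"
      using Lx L_mono[of x z] z by (simp add: pos_le_divide_eq mult.commute)
    also have "\<dots> \<le> prob {x..} / L x"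
      using Lx L_mono[of x z] z by (intro frac_le prob_atLeast_antimono) auto
    finally show ?thesis .
  qed (use Lx in simp)
  have "ennreal (prob {x..} - prob {y..}) = emeasure D {x..<y}"
    using assms by (simp add: emeasure_eq_measure prob_atLeast_diff)
  also have "\<dots> = (\<integral>\<^sup>+ z \<in> {x..<y} \<inter> supp D. ennreal (f z) \<partial>lborel)"
    using assms by (intro emeasure_below_r) auto
  also have "\<dots> \<le> (\<integral>\<^sup>+ z \<in> {x..<y}. ennreal (prob {x..} / L x) \<partial>lborel)"
    using dens by (intro nn_integral_mono) (auto simp: indicator_def intro: ennreal_leI)
  also have "\<dots> = ennreal ((y - x) * prob {x..} / L x)"
    using Lx assms(3) by (subst nn_integral_const_Ico) auto
  finally show ?thesis using Lx assms by (subst (asm) ennreal_le_iff) auto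
qed

lemma tail_ge_gp_tail:
  assumes "0 \<le> t" "t \<le> r"
  shows "gp_tail l (gp_quantile l (prob {r..}) * t / r) \<le> prob {t..}"
proof (cases "t = r \<or> prob {t..} = 1")
  case True
  then show ?thesis
  proof
    assume "t = r"
    then show ?thesis using r l by (simp add: gp_tail_quantile)
  next
    assume "prob {t..} = 1"
    then show ?thesis using assms r l
      by (auto intro!: gp_tail_le_1 gp_quantile_nonneg divide_nonneg_pos mult_nonneg_nonneg)
  qed
next
  case False
  then have t: "t < r" "prob {t..} < 1" using assms prob_le_1[of "{t..}"] by (auto simp: less_le)
  \<comment> \<open>With this choice g + l t is the inverse hazard rate at t, so the comparison tail
    touches there.\<close>
  define g where "g = prob {t..} / f t - l * t"
  have gt: "0 < g + l * t" using density_pos[OF t] prob_atLeast_pos[of t] t by (simp add: g_def)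
  show ?thesis
  proof (rule gp_tail_interpolation[where g = g])
    show "affine_log l g r - affine_log l g t \<le> ln (prob {t..}) - ln (prob {r..})"
      using l gt t tail_drop_ge[OF t] prob_atLeast_pos unfolding g_def
      by (intro affine_log_le_neg_ln) auto
    assume "0 < g"
    have "ln (prob {0..}) - ln (prob {t..}) \<le> affine_log l g t - affine_log l g 0"
    proof (rule neg_ln_le_affine_log[where c = "prob {t..}"])
      show "prob {x..} - prob {y..} \<le> (y - x) * prob {x..} / (g + l * x)"
        if "0 \<le> x" "x < y" "y \<le> t" for x y
        using that t l \<open>0 < g\<close> tail_drop_le[OF t that(2,3)] unfolding g_def
        by (auto simp: add_pos_nonneg)
    qed (use l assms t \<open>0 < g\<close> prob_atLeast_pos prob_atLeast_antimono in auto)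
    then show "- ln (prob {t..}) \<le> affine_log l g t - affine_log l g 0"
      by (simp add: prob_atLeast_0)
  qed (use l r assms t gt prob_atLeast_pos in auto)
qed

end

section \<open>Sufficiency of the supply\<close>

lemma borel_measurable_bin_tail [measurable]: "bin_tail n k \<in> borel_measurable borel"
  unfolding bin_tail_def[abs_def] Bernstein_def by measurable

text \<open>\<open>t * (\<Sum>k=1..m. bin_tail n k (c / t))\<close> is an antiderivative of the integrand and tends to
  at most \<open>n * c\<close>: the tail \<open>c / t\<close>, for which every price yields the same revenue \<open>c\<close>, is the
  extremal case of the ex-ante bound.\<close>

lemma nn_integral_equal_revenue:
  assumes c: "0 < c" "c \<le> r" and mn: "m \<le> n"
  shows "(\<integral>\<^sup>+ t\<in>{r<..}. ennreal (real m * bin_tail n (Suc m) (c / t)) \<partial>lborel)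
          \<le> ennreal (real n * c - r * (\<Sum>k=1..m. bin_tail n k (c / r)))"
proof -
  define W where "W t = (\<Sum>k=1..m. t * bin_tail n k (c / t))" for t
  have r: "0 < r" using c by simp
  have deriv: "(W has_real_derivative real m * bin_tail n (Suc m) (c / t)) (at t)" if t: "r \<le> t" for t
  proof -
    have "((\<lambda>t. t * bin_tail n k (c / t)) has_real_derivative
        bin_tail n k (c / t) - real k * Bernstein n k (c / t)) (at t)" if k: "k \<in> {1..m}" for k
    proof -
      obtain d where d: "(bin_tail n k has_real_derivative d) (at (c / t))"
          "c / t * d = real k * Bernstein n k (c / t)"
        using bin_tail_deriv[of k n "c / t"] k by auto
      have "((\<lambda>t. c / t) has_real_derivative - c / t\<^sup>2) (at t)"
        using r t by (auto intro!: derivative_eq_intros simp: power2_eq_square)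
      from DERIV_chain2[OF d(1) this]
      have "((\<lambda>t. bin_tail n k (c / t)) has_real_derivative d * (- c / t\<^sup>2)) (at t)" .
      from DERIV_mult[OF DERIV_ident this]
      have "((\<lambda>t. t * bin_tail n k (c / t)) has_real_derivative
          1 * bin_tail n k (c / t) + d * (- c / t\<^sup>2) * t) (at t)" by simp
      moreover have "d * (- c / t\<^sup>2) * t = - (c / t * d)"
        using r t by (simp add: power2_eq_square)
      ultimately show ?thesis using d(2) by simp
    qed
    then have "(W has_real_derivative (\<Sum>k=1..m. bin_tail n k (c / t) - real k * Bernstein n k (c / t))) (at t)"
      unfolding W_def by (intro DERIV_sum)
    then show ?thesis unfolding sum_subtractf sum_bin_tail by simp
  qed
  have le: "W t \<le> real n * c" if "r \<le> t" for t
  proof -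
    have "W t = t * (\<Sum>k=1..m. bin_tail n k (c / t))" by (simp add: W_def sum_distrib_left)
    also have "\<dots> \<le> t * (real n * (c / t))"
      using that c r mn by (intro mult_left_mono sum_bin_tail_le) auto
    finally show ?thesis using that r by simp
  qed
  \<comment> \<open>The fundamental theorem on [r, \<infinity>) asks for a limit, but its value
    matters only through the bound n c. It exists because \<open>bin_tail n k\<close> vanishes at 0
    for k \<ge> 1, which makes the expression c times a difference quotient at 0.\<close>
  have "\<exists>d. ((\<lambda>t. t * bin_tail n k (c / t)) \<longlongrightarrow> c * d) at_top" if k: "k \<in> {1..m}" for k
  proof -
    obtain d where d: "(bin_tail n k has_real_derivative d) (at 0)"
      using bin_tail_deriv[of k n 0] k by auto
    have z: "bin_tail n k 0 = 0" using k by (simp add: bin_tail_def Bernstein_def)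
    have "((\<lambda>h. bin_tail n k h / h) \<longlongrightarrow> d) (at 0)"
      using d z by (simp add: DERIV_def)
    moreover have "filterlim (\<lambda>t. c / t) (at 0) at_top"
      using c by real_asymp
    ultimately have "((\<lambda>t. bin_tail n k (c / t) / (c / t)) \<longlongrightarrow> d) at_top"
      by (rule filterlim_compose)
    from tendsto_mult[OF tendsto_const[of c] this]
    have "((\<lambda>t. t * bin_tail n k (c / t)) \<longlongrightarrow> c * d) at_top"
      using c by (simp add: mult.commute)
    then show ?thesis by blast
  qed
  then obtain d where "\<And>k. k \<in> {1..m} \<Longrightarrow> ((\<lambda>t. t * bin_tail n k (c / t)) \<longlongrightarrow> c * d k) at_top"
    by metis
  then have lim: "(W \<longlongrightarrow> (\<Sum>k=1..m. c * d k)) at_top"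
    unfolding W_def by (intro tendsto_sum)
  have L: "(\<Sum>k=1..m. c * d k) \<le> real n * c"
    using le by (intro tendsto_upperbound[OF lim]) (auto intro: eventually_mono[OF eventually_ge_at_top[of r]])
  have "(\<integral>\<^sup>+ t\<in>{r<..}. ennreal (real m * bin_tail n (Suc m) (c / t)) \<partial>lborel)
      \<le> (\<integral>\<^sup>+ t. ennreal (real m * bin_tail n (Suc m) (c / t)) * indicator {r..} t \<partial>lborel)"
    by (intro nn_integral_mono) (auto simp: indicator_def)
  also have "\<dots> = ennreal ((\<Sum>k=1..m. c * d k) - W r)"
    using lim deriv c r by (intro nn_integral_FTC_atLeast) (auto intro!: mult_nonneg_nonneg bin_tail_nonneg)
  also have "\<dots> \<le> ennreal (real n * c - r * (\<Sum>k=1..m. bin_tail n k (c / r)))"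
    using L by (intro ennreal_leI) (simp add: W_def sum_distrib_left)
  finally show ?thesis .
qed

context real_prob
begin

text \<open>Optimality of r gives S t \<le> c / t with c = r S r. Beyond r the integrand is thus at
  most that of the equal-revenue tail, whose integral is bounded by what the payments at the reserve
  leave of n c.\<close>

lemma reserve_revenue_le_ex_ante:
  assumes r: "0 < r" "\<And>p. 0 \<le> p \<Longrightarrow> p * prob {p..} \<le> r * prob {r..}" and mn: "m \<le> n"
  shows "(\<integral>\<^sup>+ v. ennreal (reserve_payment r m n v) \<partial>sample n) \<le> ennreal (real n * (r * prob {r..}))"
proof -
  let ?q = "prob {r..}"
  let ?A = "r * (\<Sum>k=1..m. bin_tail n k ?q)"
  have A0: "0 \<le> ?A" using r by (intro mult_nonneg_nonneg sum_nonneg bin_tail_nonneg) auto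
  have "?A \<le> r * (real n * ?q)" using r mn by (intro mult_left_mono sum_bin_tail_le) auto
  then have A: "?A \<le> real n * (r * ?q)" by (simp add: mult_ac)
  have "of_nat m * (\<integral>\<^sup>+ t\<in>{r<..}. ennreal (bin_tail n (Suc m) (prob {t..})) \<partial>lborel)
      = (\<integral>\<^sup>+ t\<in>{r<..}. ennreal (real m * bin_tail n (Suc m) (prob {t..})) \<partial>lborel)"
    by (simp add: nn_integral_cmult[symmetric] ennreal_real_mult mult.assoc)
  also have "\<dots> \<le> ennreal (real n * (r * ?q) - ?A)"
  proof (cases "?q = 0")
    case True
    have "bin_tail n (Suc m) (prob {t..}) = 0" if "r < t" for t
    proof -
      have "prob {t..} = 0"
        using prob_atLeast_antimono[of r t] that True measure_nonneg[of D "{t..}"] by linarith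
      then show ?thesis by (simp add: bin_tail_def Bernstein_def)
    qed
    then have "(\<integral>\<^sup>+ t\<in>{r<..}. ennreal (real m * bin_tail n (Suc m) (prob {t..})) \<partial>lborel) = (\<integral>\<^sup>+ t. 0 \<partial>(lborel :: real measure))"
      by (intro nn_integral_cong) (auto simp: indicator_def)
    then show ?thesis by simp
  next
    case False
    define c where "c = r * ?q"
    have c: "0 < c" "c \<le> r" using False r by (auto simp: c_def less_le mult_le_cancel_left1)
    have "(\<integral>\<^sup>+ t\<in>{r<..}. ennreal (real m * bin_tail n (Suc m) (prob {t..})) \<partial>lborel)
        \<le> (\<integral>\<^sup>+ t\<in>{r<..}. ennreal (real m * bin_tail n (Suc m) (c / t)) \<partial>lborel)"
    proof (intro nn_integral_mono)
      fix t :: real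
      show "ennreal (real m * bin_tail n (Suc m) (prob {t..})) * indicator {r<..} t
          \<le> ennreal (real m * bin_tail n (Suc m) (c / t)) * indicator {r<..} t"
      proof (cases "r < t")
        case True
        have "prob {t..} \<le> c / t" using r(2)[of t] True r(1) by (simp add: c_def pos_le_divide_eq mult.commute)
        then show ?thesis using True c r
          by (auto intro!: ennreal_leI mult_left_mono bin_tail_mono_prob)
      qed simp
    qed
    also have "\<dots> \<le> ennreal (real n * c - r * (\<Sum>k=1..m. bin_tail n k (c / r)))"
      using c mn by (intro nn_integral_equal_revenue)
    finally show ?thesis using r by (simp add: c_def)
  qed
  finally have "(\<integral>\<^sup>+ v. ennreal (reserve_payment r m n v) \<partial>sample n) \<le> ennreal ?A + ennreal (real n * (r * ?q) - ?A)"
    using r mn by (simp add: nn_integral_reserve_payment add_left_mono)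
  also have "\<dots> = ennreal (real n * (r * ?q))"
    using A0 A by (simp add: ennreal_plus[symmetric] del: ennreal_plus)
  finally show ?thesis .
qed

lemma rev_vcg_ge_const:
  assumes "0 \<le> b" "0 \<le> p" "p \<le> 1" "\<And>t. 0 < t \<Longrightarrow> t \<le> b \<Longrightarrow> p \<le> prob {t..}"
  shows "ennreal (real s * (b * bin_tail N (Suc s) p)) \<le> rev_vcg s N D"
proof -
  have "ennreal (b * bin_tail N (Suc s) p) = (\<integral>\<^sup>+ t\<in>{0<..b}. ennreal (bin_tail N (Suc s) p) \<partial>lborel)"
    by (subst nn_integral_cmult_indicator)
      (use assms in \<open>auto simp: ennreal_mult' mult.commute bin_tail_nonneg\<close>)
  also have "\<dots> \<le> (\<integral>\<^sup>+ t\<in>{0<..}. ennreal (bin_tail N (Suc s) (prob {t..})) \<partial>lborel)"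
    using assms by (intro nn_integral_mono) (auto simp: indicator_def intro!: ennreal_leI bin_tail_mono_prob)
  finally show ?thesis unfolding rev_vcg_eq ennreal_real_mult by (intro mult_left_mono) auto
qed

text \<open>Beyond r the integrands compare pointwise, as s \<le> m, n \<le> N and \<Gamma> m \<le>
  s. Below r the VCG integrand is at least its value at r, while the sum of tails is at most m - (m
  - s) P(X \<le> s), where X counts the n buyers reaching r; \<open>tails\<close> bounds this by m
  times the VCG tail.\<close>

lemma reserve_revenue_le_vcg:
  assumes r: "0 \<le> r" and sm: "s \<le> m" "m \<le> n" "n \<le> N" and \<Gamma>: "0 \<le> \<Gamma>" "\<Gamma> * real m \<le> real s"
    and tails: "real m * (1 - bin_tail N (Suc s) (prob {r..})) \<le>
      (real m - real s) * (1 - bin_tail n (Suc s) (prob {r..}))"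
  shows "ennreal \<Gamma> * (\<integral>\<^sup>+ v. ennreal (reserve_payment r m n v) \<partial>sample n) \<le> rev_vcg s N D"
proof -
  let ?q = "prob {r..}"
  let ?I = "\<integral>\<^sup>+ t\<in>{r<..}. ennreal (bin_tail n (Suc m) (prob {t..})) \<partial>lborel"
  have split: "{1..m} = {1..s} \<union> {Suc s..m}" "{1..s} \<inter> {Suc s..m} = {}" using sm by auto
  have "(\<Sum>k=1..m. bin_tail n k ?q) = (\<Sum>k=1..s. bin_tail n k ?q) + (\<Sum>k=Suc s..m. bin_tail n k ?q)"
    unfolding split(1) by (intro sum.union_disjoint split(2)) auto
  also have "\<dots> \<le> (\<Sum>k=1..s. 1) + (\<Sum>k=Suc s..m. bin_tail n (Suc s) ?q)"
    by (intro add_mono sum_mono bin_tail_le_1 bin_tail_antimono) auto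
  also have "\<dots> = real m - (real m - real s) * (1 - bin_tail n (Suc s) ?q)"
    using sm by (simp add: algebra_simps of_nat_diff)
  also have "\<dots> \<le> real m * bin_tail N (Suc s) ?q"
    using tails by (simp add: algebra_simps)
  finally have "\<Gamma> * r * (\<Sum>k=1..m. bin_tail n k ?q) \<le> \<Gamma> * r * (real m * bin_tail N (Suc s) ?q)"
    using r \<Gamma> by (intro mult_left_mono) auto
  also have "\<dots> = (\<Gamma> * real m) * (r * bin_tail N (Suc s) ?q)" by (simp add: mult_ac)
  also have "\<dots> \<le> real s * (r * bin_tail N (Suc s) ?q)"
    using r \<Gamma> by (intro mult_right_mono) (auto simp: bin_tail_nonneg)
  finally have 1: "ennreal \<Gamma> * ennreal (r * (\<Sum>k=1..m. bin_tail n k ?q)) \<le> of_nat s * ennreal (r * bin_tail N (Suc s) ?q)"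
    using \<Gamma> by (simp add: ennreal_mult'[symmetric] ennreal_real_mult[symmetric] mult.assoc ennreal_leI)
  have "ennreal \<Gamma> * of_nat m \<le> of_nat s"
    unfolding ennreal_of_nat_eq_real_of_nat ennreal_mult'[OF \<Gamma>(1), symmetric] using \<Gamma>(2) by (rule ennreal_leI)
  then have 2: "ennreal \<Gamma> * (of_nat m * ?I) \<le> of_nat s * ?I"
    unfolding mult.assoc[symmetric] by (rule mult_right_mono) simp
  have "ennreal \<Gamma> * (\<integral>\<^sup>+ v. ennreal (reserve_payment r m n v) \<partial>sample n)
      \<le> of_nat s * (ennreal (r * bin_tail N (Suc s) ?q) + ?I)"
    unfolding nn_integral_reserve_payment[OF r sm(2)] distrib_left using 1 2 by (rule add_mono)
  also have "ennreal (r * bin_tail N (Suc s) ?q) + ?I =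
      (\<integral>\<^sup>+ t. ennreal (bin_tail N (Suc s) ?q) * indicator {0<..r} t \<partial>lborel) + ?I"
    by (subst nn_integral_cmult_indicator) (use r in \<open>auto simp: ennreal_mult' mult.commute bin_tail_nonneg\<close>)
  also have "\<dots> = (\<integral>\<^sup>+ t. ennreal (bin_tail N (Suc s) ?q) * indicator {0<..r} t
      + ennreal (bin_tail n (Suc m) (prob {t..})) * indicator {r<..} t \<partial>lborel)"
    by (intro nn_integral_add[symmetric]) measurable
  also have "\<dots> \<le> (\<integral>\<^sup>+ t\<in>{0<..}. ennreal (bin_tail N (Suc s) (prob {t..})) \<partial>lborel)"
  proof (intro nn_integral_mono)
    fix t :: real
    show "ennreal (bin_tail N (Suc s) ?q) * indicator {0<..r} t
      + ennreal (bin_tail n (Suc m) (prob {t..})) * indicator {r<..} t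
      \<le> ennreal (bin_tail N (Suc s) (prob {t..})) * indicator {0<..} t"
    proof (cases "t \<le> r")
      case True
      then show ?thesis
        by (auto simp: indicator_def intro!: ennreal_leI bin_tail_mono_prob prob_atLeast_antimono)
    next
      case False
      have "bin_tail n (Suc m) (prob {t..}) \<le> bin_tail n (Suc s) (prob {t..})"
        using sm by (intro bin_tail_antimono) auto
      also have "\<dots> \<le> bin_tail N (Suc s) (prob {t..})"
        using sm by (intro bin_tail_mono_trials) auto
      finally show ?thesis using False r by (auto simp: indicator_def intro: ennreal_leI)
    qed
  qed
  finally show ?thesis unfolding rev_vcg_eq by (simp add: mult_left_mono)
qed

end

text \<open>Prices are measured on the scale of the generalised Pareto tail: the reserve becomes the
  quantile of its sale probability, and \<open>tb\<close> is a price that VCG reaches with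
  probability at least 1 - \<eta>. The assumption \<open>gp\<close> settles reserves above
  \<open>tb\<close>, and \<open>q\<close> those up to \<open>tb\<close>.\<close>

lemma (in regular_prob) reserve_revenue_le_vcg_small_quantile:
  assumes opt: "\<And>p. 0 \<le> p \<Longrightarrow> p * prob {p..} \<le> r * prob {r..}"
    and mn: "m \<le> n" and \<Gamma>: "0 \<le> \<Gamma>" "\<Gamma> * real m \<le> real s"
    and tb: "0 < tb" and \<eta>: "\<eta> \<le> 1" and conc: "1 - bin_tail N (Suc s) (gp_tail l tb) \<le> \<eta>"
    and q: "real n * prob {r..} \<le> (1 - \<eta>) * real m"
    and gp: "\<And>\<tau>. tb \<le> \<tau> \<Longrightarrow> real n * (\<tau> * gp_tail l \<tau>) \<le> real m * (1 - \<eta>) * tb"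
  shows "ennreal \<Gamma> * (\<integral>\<^sup>+ v. ennreal (reserve_payment r m n v) \<partial>sample n) \<le> rev_vcg s N D"
proof -
  let ?q = "prob {r..}"
  define \<tau> where "\<tau> = gp_quantile l ?q"
  have \<tau>0: "0 \<le> \<tau>" using l r by (simp add: \<tau>_def gp_quantile_nonneg)
  \<comment> \<open>On the original scale \<open>\<rho> * r\<close> is the image of
    \<open>tb\<close>, capped at r because the tail comparison stops there.\<close>
  define \<rho> where "\<rho> = (if \<tau> \<le> tb then 1 else tb / \<tau>)"
  have \<rho>: "0 < \<rho>" "\<rho> \<le> 1" using tb by (auto simp: \<rho>_def)
  have "real n * ?q \<le> (1 - \<eta>) * real m * \<rho>"
  proof (cases "\<tau> \<le> tb")
    case True
    then show ?thesis using q by (simp add: \<rho>_def)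
  next
    case False
    then have "real n * (\<tau> * ?q) \<le> real m * (1 - \<eta>) * tb"
      using gp[of \<tau>] l r by (simp add: \<tau>_def gp_tail_quantile)
    then show ?thesis using False tb by (simp add: \<rho>_def field_simps)
  qed
  then have "\<Gamma> * r * (real n * ?q) \<le> \<Gamma> * r * ((1 - \<eta>) * real m * \<rho>)"
    using r \<Gamma> by (intro mult_left_mono) auto
  also have "\<dots> = (\<Gamma> * real m) * ((1 - \<eta>) * (\<rho> * r))" by (simp add: mult_ac)
  also have "\<dots> \<le> real s * ((1 - \<eta>) * (\<rho> * r))"
    using r \<rho> \<Gamma> \<eta> by (intro mult_right_mono) auto
  also have "\<dots> \<le> real s * (bin_tail N (Suc s) (gp_tail l tb) * (\<rho> * r))"
    using r \<rho> conc by (intro mult_left_mono mult_right_mono) auto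
  finally have le: "\<Gamma> * (real n * (r * ?q)) \<le> real s * (\<rho> * r * bin_tail N (Suc s) (gp_tail l tb))"
    by (simp add: mult_ac)
  have tail: "gp_tail l tb \<le> prob {t..}" if t: "0 < t" "t \<le> \<rho> * r" for t
  proof -
    have tr: "t \<le> r" using t \<rho> r by (meson mult_left_le_one_le less_imp_le order_trans)
    have "\<tau> * t / r \<le> tb"
    proof (cases "\<tau> \<le> tb")
      case True
      then have "\<tau> * t \<le> tb * r" using tr t \<tau>0 tb by (intro mult_mono) auto
      then show ?thesis using r by (simp add: pos_divide_le_eq)
    next
      case False
      then have "\<tau> * t \<le> tb * r" using t tb by (simp add: \<rho>_def field_simps)
      then show ?thesis using r by (simp add: pos_divide_le_eq)
    qed
    then have "gp_tail l tb \<le> gp_tail l (\<tau> * t / r)"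
      using l \<tau>0 t r by (intro gp_tail_antimono) auto
    also have "\<dots> \<le> prob {t..}" unfolding \<tau>_def using t tr by (intro tail_ge_gp_tail) auto
    finally show ?thesis .
  qed
  have "ennreal \<Gamma> * (\<integral>\<^sup>+ v. ennreal (reserve_payment r m n v) \<partial>sample n)
      \<le> ennreal \<Gamma> * ennreal (real n * (r * ?q))"
    using r opt mn by (intro mult_left_mono reserve_revenue_le_ex_ante) auto
  also have "\<dots> \<le> ennreal (real s * (\<rho> * r * bin_tail N (Suc s) (gp_tail l tb)))"
    using le \<Gamma> by (simp add: ennreal_mult'[symmetric] ennreal_leI)
  also have "\<dots> \<le> rev_vcg s N D"
    using tail \<rho> r l tb by (intro rev_vcg_ge_const) (auto simp: gp_tail_le_1 gp_tail_pos less_imp_le)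
  finally show ?thesis .
qed

lemma lambda_regular_rev_opt_le:
  assumes D: "D \<in> lambda_regular l" and l: "0 \<le> l" "l \<le> 1"
    and sm: "s \<le> m" "m \<le> n" "n \<le> N" and \<Gamma>: "0 \<le> \<Gamma>" "\<Gamma> * real m \<le> real s"
    and tb: "0 < tb" and \<eta>: "\<eta> \<le> 1" and conc: "1 - bin_tail N (Suc s) (gp_tail l tb) \<le> \<eta>"
    and gp: "\<And>\<tau>. tb \<le> \<tau> \<Longrightarrow> real n * (\<tau> * gp_tail l \<tau>) \<le> real m * (1 - \<eta>) * tb"
    and q1: "q1 \<le> 1" "real n * q1 \<le> (1 - \<eta>) * real m"
    and large: "\<And>q. q1 \<le> q \<Longrightarrow> q \<le> 1 \<Longrightarrow>
      real m * (1 - bin_tail N (Suc s) q) \<le> (real m - real s) * (1 - bin_tail n (Suc s) q)"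
  shows "ennreal \<Gamma> * rev_opt m n D \<le> rev_vcg s N D"
proof -
  obtain f where val: "valuation_distribution D"
    and f: "is_density_of f D" "mono_on (nonatoms D) (lambda_virtual_value l D f)"
    using D by (auto simp: lambda_regular_def)
  have vd: "prob_space D" "sets D = sets borel" "measure D {..<0} = 0" "is_interval (supp D)"
      "\<And>v w. 0 < measure D {v} \<Longrightarrow> w \<in> supp D \<Longrightarrow> w \<le> v" "\<exists>r. is_monopoly_reserve D r"
    using val unfolding valuation_distribution_def by blast+
  interpret real_prob D
    by (rule real_prob.intro[OF vd(1)]) (rule real_prob_axioms.intro[OF vd(2)])
  define r where "r = (SOME r. is_monopoly_reserve D r)"
  have "is_monopoly_reserve D r"
    unfolding r_def using vd(6) by (rule someI_ex)
  then have rsupp: "r \<in> supp D" and opt: "\<And>p. 0 \<le> p \<Longrightarrow> p * prob {p..} \<le> r * prob {r..}"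
    by (auto simp: is_monopoly_reserve_def one_minus_strict_cdf)
  have r0: "0 \<le> r"
  proof (rule ccontr)
    assume "\<not> 0 \<le> r"
    then have "0 < prob (ball r (- r))" using rsupp by (auto simp: supp_def)
    also have "\<dots> \<le> prob {..<0}"
      using \<open>\<not> 0 \<le> r\<close> by (intro finite_measure_mono) (auto simp: sets_D dist_real_def)
    finally show False using vd(3) by simp
  qed
  have rev: "rev_opt m n D = (\<integral>\<^sup>+ v. ennreal (reserve_payment r m n v) \<partial>sample n)"
    unfolding rev_opt_def r_def ..
  show ?thesis
  proof (cases "q1 \<le> prob {r..}")
    case True
    then show ?thesis unfolding rev using r0 sm \<Gamma> large by (intro reserve_revenue_le_vcg) auto
  next
    case False
    \<comment> \<open>At r = 0 the sale probability is 1, which belongs to the other case since q1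
      \<le> 1.\<close>
    have "r \<noteq> 0"
      using False q1 one_minus_strict_cdf[of 0] vd(3) by (auto simp: strict_cdf_def)
    with r0 have r0: "0 < r" by simp
    show ?thesis
    proof (cases "prob {r..} = 0")
      case True
      have "rev_opt m n D \<le> ennreal (real n * (r * prob {r..}))"
        unfolding rev using r0 opt sm by (intro reserve_revenue_le_ex_ante) auto
      then show ?thesis using True by simp
    next
      case q0: False
      interpret regular_prob D l r f
      proof
        show "0 < prob {r..}" using q0 by (simp add: less_le)
      qed (fact l f vd rsupp r0)+
      have "real n * prob {r..} \<le> real n * q1" using False by (intro mult_left_mono) auto
      then show ?thesis unfolding rev using opt sm \<Gamma> tb \<eta> conc gp q1
        by (intro reserve_revenue_le_vcg_small_quantile) auto
    qed
  qed
qed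

section \<open>Uniform sufficiency in large markets\<close>

lemma nat_ceiling_bounds:
  assumes "0 \<le> x"
  shows "x \<le> real (nat \<lceil>x\<rceil>)" "real (nat \<lceil>x\<rceil>) \<le> x + 1"
  using assms by linarith+

lemma filterlim_nat_ceiling_mult: "0 < \<kappa> \<Longrightarrow> filterlim (\<lambda>n. nat \<lceil>\<kappa> * real n\<rceil>) at_top sequentially"
  by real_asymp

lemma eventually_mult_real_ge: "0 < c \<Longrightarrow> \<forall>\<^sub>F n in sequentially. C \<le> c * real n"
  by real_asymp

text \<open>The numerical conditions of \<open>lambda_regular_rev_opt_le\<close> do not mention
  \<open>D\<close>, so one bound on n serves the whole class and only limits in n remain.\<close>

lemma eventually_rev_opt_le:
  fixes l \<alpha> \<Gamma> \<kappa> tb \<eta>\<^sub>0 :: real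
  assumes l: "0 \<le> l" "l \<le> 1" and \<alpha>: "0 < \<alpha>" "\<alpha> \<le> 1" and \<Gamma>: "0 < \<Gamma>" "\<Gamma> < 1"
    and \<kappa>: "0 < \<kappa>" and tb: "0 < tb" and \<eta>\<^sub>0: "0 < \<eta>\<^sub>0"
    and lt: "\<alpha> * \<Gamma> < (1 + \<kappa>) * gp_tail l tb"
    and gp: "\<And>\<tau>. tb \<le> \<tau> \<Longrightarrow> \<tau> * gp_tail l \<tau> \<le> \<alpha> * (1 - \<eta>\<^sub>0) * tb"
  shows "\<forall>\<^sub>F n in sequentially. \<forall>D\<in>lambda_regular l.
    ennreal \<Gamma> * rev_opt (nat \<lceil>\<alpha> * real n\<rceil>) n D
      \<le> rev_vcg (nat \<lceil>\<Gamma> * real (nat \<lceil>\<alpha> * real n\<rceil>)\<rceil>) (n + nat \<lceil>\<kappa> * real n\<rceil>) D"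
proof -
  \<comment> \<open>\<open>q1\<close> lies strictly between \<alpha> \<Gamma> and \<alpha>, and
    \<open>\<theta>\<close> halfway between \<alpha> \<Gamma> and \<open>q1\<close>. Hence s \<le>
    \<theta> n eventually and the decay rate \<open>\<rho>\<close> is below 1, while \<eta> \<le> (1
    - \<Gamma>) / 2 leaves n q1 \<le> (1 - \<eta>) m. \<open>\<delta>\<close> is half the excess of
    demand over supply at price \<open>tb\<close>, relative to n.\<close>
  define \<eta> where "\<eta> = min \<eta>\<^sub>0 ((1 - \<Gamma>) / 2)"
  define q1 where "q1 = \<alpha> * ((1 + \<Gamma>) / 2)"
  define \<theta> where "\<theta> = (\<alpha> * \<Gamma> + q1) / 2"
  define \<rho> where "\<rho> = (1 - q1) / (1 - \<theta>)"
  define p where "p = gp_tail l tb"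
  define \<delta> where "\<delta> = ((1 + \<kappa>) * p - \<alpha> * \<Gamma>) / 2"
  have "\<eta> \<le> (1 - \<Gamma>) / 2" unfolding \<eta>_def by (rule min.cobounded2)
  then have \<eta>: "0 < \<eta>" "\<eta> \<le> \<eta>\<^sub>0" "\<eta> \<le> (1 - \<Gamma>) / 2" "\<eta> \<le> 1"
    using \<Gamma> \<eta>\<^sub>0 by (simp_all add: \<eta>_def)
  have "\<alpha> * \<Gamma> < \<alpha> * ((1 + \<Gamma>) / 2)" using \<alpha> \<Gamma> by (intro mult_strict_left_mono) auto
  moreover have "\<alpha> * ((1 + \<Gamma>) / 2) < \<alpha> * 1" using \<alpha> \<Gamma> by (intro mult_strict_left_mono) auto
  ultimately have "\<alpha> * \<Gamma> < q1" "q1 < \<alpha>" by (simp_all only: q1_def mult_1_right)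
  then have q1: "\<alpha> * \<Gamma> < q1" "q1 < 1" using \<alpha> by simp_all
  then have "\<alpha> * \<Gamma> < \<theta> \<and> \<theta> < q1 \<and> 0 \<le> \<theta> \<and> \<theta> < 1"
    using mult_pos_pos[OF \<alpha>(1) \<Gamma>(1)] unfolding \<theta>_def by (intro conjI; argo)
  then have \<theta>: "\<alpha> * \<Gamma> < \<theta>" "\<theta> < q1" "0 \<le> \<theta>" "\<theta> < 1" by auto
  then have \<rho>: "0 \<le> \<rho>" "\<rho> < 1" using q1 by (auto simp: \<rho>_def)
  have p: "0 < p" "p \<le> 1" using l tb by (auto simp: p_def gp_tail_pos gp_tail_le_1)
  have \<delta>: "0 < \<delta>" using lt by (simp add: \<delta>_def p_def)
  have "(\<lambda>n. \<rho> ^ nat \<lceil>\<kappa> * real n\<rceil>) \<longlonglongrightarrow> 0"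
    using filterlim_compose[OF LIMSEQ_power_zero[of \<rho>] filterlim_nat_ceiling_mult[OF \<kappa>]] \<rho> by simp
  then have ev_\<rho>: "\<forall>\<^sub>F n in sequentially. \<rho> ^ nat \<lceil>\<kappa> * real n\<rceil> < (1 - \<Gamma>) / 2"
    by (rule order_tendstoD) (use \<Gamma> in simp)
  have "(\<lambda>n. ((1 + \<kappa>) * real n + 1) / (\<delta> * real n)\<^sup>2) \<longlonglongrightarrow> 0"
    using \<delta> \<kappa> by real_asymp
  then have ev_conc: "\<forall>\<^sub>F n in sequentially. ((1 + \<kappa>) * real n + 1) / (\<delta> * real n)\<^sup>2 < \<eta>"
    by (rule order_tendstoD) (use \<eta> in simp)
  have ev1: "\<forall>\<^sub>F n in sequentially. 2 \<le> (\<theta> - \<alpha> * \<Gamma>) * real n"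
    and ev2: "\<forall>\<^sub>F n in sequentially. 2 \<le> ((1 - \<Gamma>) * \<alpha>) * real n"
    and ev3: "\<forall>\<^sub>F n in sequentially. 2 \<le> \<delta> * real n"
    using \<theta> \<alpha> \<Gamma> \<delta> by (intro eventually_mult_real_ge; simp)+
  show ?thesis
    using ev_\<rho> ev_conc ev1 ev2 ev3
  proof eventually_elim
    case (elim n)
    define m where "m = nat \<lceil>\<alpha> * real n\<rceil>"
    define s where "s = nat \<lceil>\<Gamma> * real m\<rceil>"
    define N where "N = n + nat \<lceil>\<kappa> * real n\<rceil>"
    have m: "\<alpha> * real n \<le> real m" "real m \<le> \<alpha> * real n + 1"
      using \<alpha> unfolding m_def by (intro nat_ceiling_bounds; simp)+
    have s: "\<Gamma> * real m \<le> real s" "real s \<le> \<Gamma> * real m + 1"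
      using \<Gamma> unfolding s_def by (intro nat_ceiling_bounds; simp)+
    have N: "(1 + \<kappa>) * real n \<le> real N" "real N \<le> (1 + \<kappa>) * real n + 1" "n \<le> N"
      using \<kappa> nat_ceiling_bounds[of "\<kappa> * real n"] by (auto simp: N_def algebra_simps)
    have mn: "m \<le> n"
      using \<alpha> mult_right_mono[of \<alpha> 1 "real n"] unfolding m_def by (simp add: nat_le_iff ceiling_le_iff)
    have sm: "s \<le> m"
      using \<Gamma> mult_right_mono[of \<Gamma> 1 "real m"] unfolding s_def by (simp add: nat_le_iff ceiling_le_iff)
    have "\<Gamma> * real m \<le> \<Gamma> * (\<alpha> * real n + 1)" using m \<Gamma> by (intro mult_left_mono) auto
    then have s_le: "real s \<le> \<alpha> * \<Gamma> * real n + 2" using s \<Gamma> by (simp add: algebra_simps)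
    show ?case
      unfolding m_def[symmetric] s_def[symmetric] N_def[symmetric]
    proof
      fix D assume D: "D \<in> lambda_regular l"
      show "ennreal \<Gamma> * rev_opt m n D \<le> rev_vcg s N D"
      proof (rule lambda_regular_rev_opt_le[OF D l sm mn N(3) _ s(1) tb \<eta>(4)])
        have "2 * (\<delta> * real n) = ((1 + \<kappa>) * p) * real n - \<alpha> * \<Gamma> * real n"
          by (simp add: \<delta>_def left_diff_distrib)
        then have "\<delta> * real n + real s \<le> ((1 + \<kappa>) * p) * real n"
          using s_le elim(5) by linarith
        also have "\<dots> = ((1 + \<kappa>) * real n) * p" by (simp add: mult_ac)
        also have "\<dots> \<le> real N * p" using N p by (intro mult_right_mono) auto
        finally have "1 - bin_tail N (Suc s) p \<le> real N / (\<delta> * real n)\<^sup>2"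
          using p elim(5) by (intro bin_tail_ge_chebyshev) auto
        also have "\<dots> \<le> ((1 + \<kappa>) * real n + 1) / (\<delta> * real n)\<^sup>2"
          using N by (intro divide_right_mono) auto
        finally show "1 - bin_tail N (Suc s) (gp_tail l tb) \<le> \<eta>" using elim(2) by (simp add: p_def)
      next
        fix \<tau> assume "tb \<le> \<tau>"
        then have "real n * (\<tau> * gp_tail l \<tau>) \<le> real n * (\<alpha> * (1 - \<eta>\<^sub>0) * tb)"
          by (intro mult_left_mono gp) auto
        also have "\<dots> \<le> real n * (\<alpha> * (1 - \<eta>) * tb)"
          using \<eta> \<alpha> tb by (intro mult_left_mono mult_right_mono) auto
        also have "\<dots> = (\<alpha> * real n) * ((1 - \<eta>) * tb)" by (simp add: mult_ac)
        also have "\<dots> \<le> real m * ((1 - \<eta>) * tb)" using m \<eta> tb by (intro mult_right_mono) auto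
        finally show "real n * (\<tau> * gp_tail l \<tau>) \<le> real m * (1 - \<eta>) * tb" by (simp add: mult.assoc)
      next
        have "real n * q1 = ((1 + \<Gamma>) / 2) * (\<alpha> * real n)" by (simp add: q1_def)
        also have "\<dots> \<le> (1 - \<eta>) * real m" using \<eta> m \<alpha> \<Gamma> by (intro mult_mono) (auto simp: field_simps)
        finally show "real n * q1 \<le> (1 - \<eta>) * real m" .
      next
        fix q assume q: "q1 \<le> q" "q \<le> 1"
        let ?L = "1 - bin_tail n (Suc s) q"
        have q0: "0 \<le> q" using q \<theta> by linarith
        have L: "0 \<le> ?L" using q q0 by (simp add: bin_tail_le_1)
        have "real s \<le> \<theta> * real n" using s_le elim(3) by (simp add: algebra_simps)
        then have "1 - bin_tail N (Suc s) q \<le> ((1 - q) / (1 - \<theta>)) ^ (N - n) * ?L"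
          using q q0 \<theta> N by (intro bin_lower_tail_decay) auto
        also have "\<dots> \<le> \<rho> ^ (N - n) * ?L"
          unfolding \<rho>_def using q \<theta> L by (intro mult_right_mono power_mono divide_right_mono) auto
        also have "\<dots> \<le> (1 - \<Gamma>) / 2 * ?L"
          using elim(1) L by (intro mult_right_mono) (auto simp: N_def)
        finally have "real m * (1 - bin_tail N (Suc s) q) \<le> real m * ((1 - \<Gamma>) / 2 * ?L)"
          by (intro mult_left_mono) auto
        also have "\<dots> = (1 - \<Gamma>) * real m / 2 * ?L" by simp
        \<comment> \<open>Without rounding, m - s would be (1 - \<Gamma>) m; the factor 1/2 absorbs
          the ceiling in s.\<close>
        also have "\<dots> \<le> (real m - real s) * ?L"
        proof (intro mult_right_mono L)
          have "2 \<le> (1 - \<Gamma>) * (\<alpha> * real n)" using elim(4) by (simp add: mult.assoc)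
          also have "\<dots> \<le> (1 - \<Gamma>) * real m" using m(1) \<Gamma> by (intro mult_left_mono) auto
          finally have "2 \<le> (1 - \<Gamma>) * real m" .
          then show "(1 - \<Gamma>) * real m / 2 \<le> real m - real s"
            using s(2) left_diff_distrib[of 1 \<Gamma> "real m"] by linarith
        qed
        finally show "real m * (1 - bin_tail N (Suc s) q) \<le> (real m - real s) * ?L" .
      qed (use \<Gamma> q1 in auto)
    qed
  qed
qed

section \<open>Revenue curve of the generalised Pareto tail\<close>

definition gp_density :: "real \<Rightarrow> real \<Rightarrow> real" where
  "gp_density l t = (if l = 0 then exp (- t) else (1 + l * t) powr (- 1 / l - 1))"

lemma gp_density_pos: "0 \<le> l \<Longrightarrow> 0 \<le> t \<Longrightarrow> 0 < gp_density l t"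
  using add_pos_nonneg[of 1 "l * t"] by (auto simp: gp_density_def)

lemma gp_tail_eq_density: "0 \<le> l \<Longrightarrow> 0 \<le> t \<Longrightarrow> gp_tail l t = (1 + l * t) * gp_density l t"
  using add_pos_nonneg[of 1 "l * t"] by (auto simp: gp_density_def gp_tail_def powr_diff)

lemma gp_tail_deriv:
  assumes "0 \<le> l" "0 \<le> t"
  shows "(gp_tail l has_real_derivative - gp_density l t) (at t)"
proof (cases "l = 0")
  case True
  have "((\<lambda>t. exp (- t)) has_real_derivative - exp (- t)) (at t)"
    by (auto intro!: derivative_eq_intros)
  then show ?thesis using True by (simp add: gp_tail_def[abs_def] gp_density_def)
next
  case False
  have "0 < 1 + l * t" using assms by (intro add_pos_nonneg) auto
  then have "((\<lambda>t. (1 + l * t) powr (- 1 / l)) has_real_derivative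
      (- 1 / l) * (1 + l * t) powr (- 1 / l - 1) * l) (at t)"
    by (auto intro!: derivative_eq_intros)
  then show ?thesis using False by (simp add: gp_tail_def[abs_def] gp_density_def)
qed

text \<open>The sign is that of 1 - (1 - l) t: the curve peaks at 1 / (1 - l), and for l = 1 it
  increases forever.\<close>

lemma gp_revenue_deriv:
  assumes "0 \<le> l" "0 \<le> t"
  shows "((\<lambda>t. t * gp_tail l t) has_real_derivative (1 - (1 - l) * t) * gp_density l t) (at t)"
  using DERIV_mult[OF DERIV_ident gp_tail_deriv[OF assms]] gp_tail_eq_density[OF assms]
  by (simp add: algebra_simps)

lemma gp_revenue_strict_mono:
  assumes "0 \<le> l" "0 \<le> s" "s < t" "(1 - l) * t \<le> 1"
  shows "s * gp_tail l s < t * gp_tail l t"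
proof (rule DERIV_pos_imp_increasing_open[OF assms(3)])
  fix x assume x: "s < x" "x < t"
  have "(1 - l) * x < 1"
  proof (cases "l < 1")
    case True
    then have "(1 - l) * x < (1 - l) * t" using x by simp
    then show ?thesis using assms by simp
  next
    case False
    then have "(1 - l) * x \<le> 0" using x assms by (intro mult_nonpos_nonneg) auto
    then show ?thesis by simp
  qed
  show "\<exists>y. ((\<lambda>t. t * gp_tail l t) has_real_derivative y) (at x) \<and> 0 < y"
  proof (intro exI conjI)
    show "((\<lambda>t. t * gp_tail l t) has_real_derivative (1 - (1 - l) * x) * gp_density l x) (at x)"
      using x(1) assms(1,2) by (intro gp_revenue_deriv; linarith)
    show "0 < (1 - (1 - l) * x) * gp_density l x"
    proof (rule mult_pos_pos)
      show "0 < 1 - (1 - l) * x" using \<open>(1 - l) * x < 1\<close> by linarith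
      show "0 < gp_density l x" using x(1) assms(1,2) by (intro gp_density_pos; linarith)
    qed
  qed
next
  show "continuous_on {s..t} (\<lambda>t. t * gp_tail l t)"
    using assms(1,2) by (intro continuous_at_imp_continuous_on ballI DERIV_isCont[OF gp_revenue_deriv]) auto
qed

lemma gp_revenue_antimono:
  assumes "0 \<le> l" "0 \<le> s" "s \<le> t" "1 \<le> (1 - l) * s"
  shows "t * gp_tail l t \<le> s * gp_tail l s"
proof (rule DERIV_nonpos_imp_nonincreasing[OF assms(3)])
  fix x assume x: "s \<le> x" "x \<le> t"
  have "0 < 1 - l" using assms by (metis less_eq_real_def mult_nonpos_nonneg not_le not_one_le_zero order_trans)
  then have "1 \<le> (1 - l) * x"
    using assms(4) mult_left_mono[OF x(1), of "1 - l"] by linarith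
  show "\<exists>y. ((\<lambda>t. t * gp_tail l t) has_real_derivative y) (at x) \<and> y \<le> 0"
  proof (intro exI conjI)
    show "((\<lambda>t. t * gp_tail l t) has_real_derivative (1 - (1 - l) * x) * gp_density l x) (at x)"
      using x(1) assms(1,2) by (intro gp_revenue_deriv; linarith)
    show "(1 - (1 - l) * x) * gp_density l x \<le> 0"
    proof (rule mult_nonpos_nonneg)
      show "1 - (1 - l) * x \<le> 0" using \<open>1 \<le> (1 - l) * x\<close> by linarith
      show "0 \<le> gp_density l x"
        using x(1) assms(1,2) by (intro less_imp_le[OF gp_density_pos]; linarith)
    qed
  qed
qed

text \<open>The supremum of \<open>t * gp_tail l t\<close> over t \<ge> 0, attained for l < 1 and
  only approached at infinity for l = 1. The latter case is separate because \<open>0 powr 0\<close>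
  is 0.\<close>

definition gp_peak :: "real \<Rightarrow> real" where
  "gp_peak l = (if l = 0 then 1 / exp 1 else if l = 1 then 1 else (1 - l) powr ((1 - l) / l))"

lemma gp_peak_pos: "l \<le> 1 \<Longrightarrow> 0 < gp_peak l"
  by (auto simp: gp_peak_def)

text \<open>Identifies the threshold of the indicator as the sale probability at the peak of the
  revenue curve.\<close>

lemma gp_tail_supply_threshold:
  assumes "0 \<le> l" "l < 1"
  shows "gp_tail l (1 / (1 - l)) = supply_threshold l"
proof (cases "l = 0")
  case False
  have "1 + l * (1 / (1 - l)) = (1 - l) powr (- 1)"
    using assms by (simp add: powr_minus field_simps)
  then have "gp_tail l (1 / (1 - l)) = ((1 - l) powr (- 1)) powr (- 1 / l)"
    using False by (simp only: gp_tail_def if_False)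
  then show ?thesis using False by (simp only: powr_powr supply_threshold_def if_False) simp
qed (simp add: gp_tail_def supply_threshold_def exp_minus inverse_eq_divide)

lemma gp_peak_eq:
  assumes "0 \<le> l" "l < 1"
  shows "gp_peak l = 1 / (1 - l) * supply_threshold l"
proof (cases "l = 0")
  case False
  have "(1 - l) powr ((1 - l) / l) = (1 - l) powr (1 / l - 1)"
    using False by (simp add: diff_divide_distrib)
  then show ?thesis using False assms by (simp add: gp_peak_def supply_threshold_def powr_diff)
qed (simp add: gp_peak_def supply_threshold_def)

lemma gp_revenue_le_peak:
  assumes "0 \<le> l" "l \<le> 1" "0 \<le> t"
  shows "t * gp_tail l t \<le> gp_peak l"
proof (cases "l = 1")
  case True
  then show ?thesis using assms by (simp add: gp_tail_def gp_peak_def powr_minus field_simps)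
next
  case False
  then have l: "l < 1" using assms by simp
  define t0 where "t0 = 1 / (1 - l)"
  have "t * gp_tail l t \<le> t0 * gp_tail l t0"
    using l assms gp_revenue_antimono[of l t0 t] gp_revenue_strict_mono[of l t t0]
    by (cases t t0 rule: linorder_cases) (auto simp: t0_def)
  then show ?thesis using l assms by (simp add: t0_def gp_tail_supply_threshold gp_peak_eq)
qed

text \<open>Reveals the meaning of the closed form: at the price \<open>gp_peak l / a\<close>,
  selling a n units earns n times the peak revenue.\<close>

lemma growth_factor_eq:
  assumes "0 \<le> l" "l \<le> 1" "0 < a"
  shows "growth_factor l a = 1 / gp_tail l (gp_peak l / a)"
proof -
  have "0 < 1 + l * (gp_peak l / a)" using assms gp_peak_pos[of l] by (intro add_pos_nonneg) auto
  then show ?thesis using assms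
    by (auto simp: growth_factor_def gp_tail_def gp_peak_def exp_minus powr_minus_divide field_simps)
qed

lemma isCont_gp_tail: "0 \<le> l \<Longrightarrow> 0 \<le> t \<Longrightarrow> isCont (gp_tail l) t"
  by (rule DERIV_isCont[OF gp_tail_deriv])

text \<open>From the threshold on, \<open>tb\<close> is taken slightly beyond peak / \<alpha>:
  continuity keeps the strict inequality for \<kappa>, and t1 / tb < 1 supplies the margin
  \<open>\<eta>\<^sub>0\<close>.\<close>

lemma upper_parameters:
  fixes l \<alpha> \<Gamma> \<kappa> :: real
  assumes l: "0 \<le> l" "l \<le> 1" and \<alpha>: "0 < \<alpha>" "\<alpha> \<le> 1" and \<Gamma>: "0 < \<Gamma>" "\<Gamma> < 1"
    and \<kappa>: "0 < \<kappa>" "supply_threshold l \<le> \<alpha> \<Longrightarrow> \<alpha> * \<Gamma> * growth_factor l \<alpha> - 1 < \<kappa>"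
  obtains tb \<eta>\<^sub>0 where "0 < tb" "0 < \<eta>\<^sub>0" "\<alpha> * \<Gamma> < (1 + \<kappa>) * gp_tail l tb"
    "\<And>\<tau>. tb \<le> \<tau> \<Longrightarrow> \<tau> * gp_tail l \<tau> \<le> \<alpha> * (1 - \<eta>\<^sub>0) * tb"
proof (cases "supply_threshold l \<le> \<alpha>")
  case True
  define t1 where "t1 = gp_peak l / \<alpha>"
  have t1: "0 < t1" using \<alpha> l gp_peak_pos by (simp add: t1_def)
  have "\<alpha> * \<Gamma> / gp_tail l t1 < 1 + \<kappa>"
    using \<kappa>(2)[OF True] l \<alpha> by (simp add: growth_factor_eq t1_def)
  then have lt: "\<alpha> * \<Gamma> < (1 + \<kappa>) * gp_tail l t1"
    using gp_tail_pos[of l t1] l t1 by (simp add: pos_divide_less_eq)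
  have "((\<lambda>t. (1 + \<kappa>) * gp_tail l t) \<longlongrightarrow> (1 + \<kappa>) * gp_tail l t1) (at_right t1)"
    using isCont_gp_tail[of l t1] l t1
    by (intro tendsto_intros filterlim_at_split[THEN iffD1, THEN conjunct2]) (auto simp: isCont_def)
  then have "\<forall>\<^sub>F t in at_right t1. \<alpha> * \<Gamma> < (1 + \<kappa>) * gp_tail l t"
    using lt by (rule order_tendstoD)
  then have "\<forall>\<^sub>F t in at_right t1. \<alpha> * \<Gamma> < (1 + \<kappa>) * gp_tail l t \<and> t1 < t"
    by (intro eventually_conj eventually_at_right_less)
  then obtain tb where tb: "\<alpha> * \<Gamma> < (1 + \<kappa>) * gp_tail l tb" "t1 < tb"
    using eventually_happens[of _ "at_right t1"] by (auto simp: trivial_limit_at_right_real)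
  show ?thesis
  proof (rule that[of tb "1 - t1 / tb"])
    fix \<tau> assume "tb \<le> \<tau>"
    then have "\<tau> * gp_tail l \<tau> \<le> gp_peak l" using l t1 tb by (intro gp_revenue_le_peak) auto
    also have "\<dots> = \<alpha> * (1 - (1 - t1 / tb)) * tb" using \<alpha> t1 tb by (simp add: t1_def)
    finally show "\<tau> * gp_tail l \<tau> \<le> \<alpha> * (1 - (1 - t1 / tb)) * tb" .
  qed (use tb t1 in auto)
next
  case False
  \<comment> \<open>The tail at the peak is the threshold, which exceeds \<alpha> > p, so the
    quantile of p lies beyond the peak and no later price earns more. Since p > \<alpha> \<Gamma>,
    every positive \<kappa> suffices.\<close>
  define p where "p = \<alpha> * ((1 + \<Gamma>) / 2)"
  have p: "0 < p" "\<alpha> * \<Gamma> < p" "p < \<alpha>" using \<alpha> \<Gamma> by (auto simp: p_def)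
  have "l < 1" using False \<alpha> l by (cases "l = 1") (auto simp: supply_threshold_def)
  define tb where "tb = gp_quantile l p"
  have Gtb: "gp_tail l tb = p" using p l by (simp add: tb_def gp_tail_quantile)
  have tb0: "0 \<le> tb" using p \<alpha> l by (simp add: tb_def gp_quantile_nonneg)
  have "1 / (1 - l) \<le> tb"
  proof (rule ccontr)
    assume "\<not> 1 / (1 - l) \<le> tb"
    then have "gp_tail l (1 / (1 - l)) \<le> p"
      using l tb0 unfolding Gtb[symmetric] by (intro gp_tail_antimono) auto
    then show False using gp_tail_supply_threshold[of l] False p l \<open>l < 1\<close> by simp
  qed
  then have tb: "1 \<le> (1 - l) * tb" using \<open>l < 1\<close> by (simp add: pos_divide_le_eq mult.commute)
  show ?thesis
  proof (rule that[of tb "(1 - \<Gamma>) / 2"])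
    show "0 < tb" using tb0 tb by (cases "tb = 0") auto
    have "1 * p < (1 + \<kappa>) * p" using p \<kappa> by (intro mult_strict_right_mono) auto
    then show "\<alpha> * \<Gamma> < (1 + \<kappa>) * gp_tail l tb" unfolding Gtb using p(2) by linarith
    fix \<tau> assume "tb \<le> \<tau>"
    then have "\<tau> * gp_tail l \<tau> \<le> tb * gp_tail l tb" using l tb tb0 by (intro gp_revenue_antimono)
    also have "\<dots> = \<alpha> * (1 - (1 - \<Gamma>) / 2) * tb" unfolding Gtb by (simp add: p_def field_simps)
    finally show "\<tau> * gp_tail l \<tau> \<le> \<alpha> * (1 - (1 - \<Gamma>) / 2) * tb" .
  qed (use \<Gamma> in auto)
qed

section \<open>Extremal distributions\<close>

lemma valuation_distribution_point_mass: "valuation_distribution (return borel (1::real))"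
  and supp_point_mass: "supp (return borel (1::real)) = {1}"
  and monopoly_reserve_point_mass: "is_monopoly_reserve (return borel (1::real)) r \<longleftrightarrow> r = 1"
  and nonatoms_point_mass: "nonatoms (return borel (1::real)) = {}"
proof -
  let ?D = "return borel (1::real)"
  interpret prob_space ?D by (rule prob_space_return) simp
  have meas: "measure ?D A = indicator A 1" if "A \<in> sets borel" for A
    using that by (simp add: measure_def emeasure_return indicator_def)
  have "x \<in> supp ?D \<longleftrightarrow> x = 1" for x
  proof
    assume x: "x \<in> supp ?D"
    show "x = 1"
    proof (rule ccontr)
      assume "x \<noteq> 1"
      then have "0 < measure ?D (ball x (dist x 1))" using x by (auto simp: supp_def)
      then show False by (simp add: meas)
    qed
  qed (simp add: supp_def meas)
  then show supp: "supp ?D = {1}" by auto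
  then show nonatoms: "nonatoms ?D = {}" by (auto simp: nonatoms_def meas)
  have "p * (1 - strict_cdf ?D p) \<le> 1 * (1 - strict_cdf ?D 1)" for p
    by (auto simp: strict_cdf_def meas indicator_def)
  then show reserve: "is_monopoly_reserve ?D r \<longleftrightarrow> r = 1" for r
    by (auto simp: is_monopoly_reserve_def supp)
  have "is_density_of (\<lambda>_. 0) ?D"
    by (auto simp: is_density_of_def nonatoms)
  then show "valuation_distribution ?D"
    using prob_space_axioms
    by (auto simp: valuation_distribution_def supp meas reserve indicator_def is_interval_1 split: if_splits)
qed

text \<open>The only support point is an atom, so monotonicity on \<open>nonatoms\<close> is vacuous
  and the zero function is a density.\<close>

lemma point_mass_lambda_regular: "return borel 1 \<in> lambda_regular l"
proof -
  have "is_density_of (\<lambda>_. 0) (return borel (1::real))"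
    by (auto simp: is_density_of_def nonatoms_point_mass)
  then show ?thesis
    using valuation_distribution_point_mass
    by (auto simp: lambda_regular_def nonatoms_point_mass mono_on_def)
qed

lemma bin_tail_1: "k \<le> n \<Longrightarrow> bin_tail n k 1 = 1"
proof -
  assume "k \<le> n"
  have "bin_tail n k 1 = (\<Sum>j\<in>{n}. Bernstein n j 1)"
    unfolding bin_tail_def
    by (rule sum.mono_neutral_right) (use \<open>k \<le> n\<close> in \<open>auto simp: Bernstein_def\<close>)
  then show ?thesis by (simp add: Bernstein_def)
qed

text \<open>All buyers have value 1: the optimal mechanism earns at least m, whereas s units earn at
  most s, however many buyers there are.\<close>

lemma point_mass_beats_small_supply:
  assumes "m \<le> n" "real s < \<Gamma> * real m"
  shows "\<not> ennreal \<Gamma> * rev_opt m n (return borel 1) \<le> rev_vcg s N (return borel 1)"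
proof -
  let ?D = "return borel (1::real)"
  interpret real_prob ?D
    by (intro real_prob.intro real_prob_axioms.intro prob_space_return) simp_all
  have \<Gamma>: "0 \<le> \<Gamma>" using assms(2) by (metis mult_nonpos_nonneg not_le of_nat_0_le_iff order_less_imp_le order_less_le_trans)
  have meas: "prob {t..} = indicator {..1} t" for t
    by (simp add: measure_def emeasure_return indicator_def)
  have "(SOME r. is_monopoly_reserve ?D r) = 1"
    by (simp add: monopoly_reserve_point_mass)
  then have "rev_opt m n ?D = (\<integral>\<^sup>+ v. ennreal (reserve_payment 1 m n v) \<partial>sample n)"
    by (simp add: rev_opt_def)
  moreover have "ennreal (1 * (\<Sum>k=1..m. bin_tail n k (prob {1..}))) \<le> \<dots>"
    by (subst nn_integral_reserve_payment) (use assms in auto)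
  moreover have "(\<Sum>k=1..m. bin_tail n k (prob {1..})) = (\<Sum>k=1..m. 1)"
    using assms by (intro sum.cong) (auto simp: meas bin_tail_1)
  ultimately have "ennreal (real m) \<le> rev_opt m n ?D" by simp
  then have opt: "ennreal (\<Gamma> * real m) \<le> ennreal \<Gamma> * rev_opt m n ?D"
    unfolding ennreal_mult'[OF \<Gamma>] by (intro mult_left_mono) auto
  have "rev_vcg s N ?D \<le> of_nat s * (\<integral>\<^sup>+ t. indicator {0<..1} t \<partial>(lborel :: real measure))"
    unfolding rev_vcg_eq
  proof (intro mult_left_mono nn_integral_mono)
    fix t :: real
    show "ennreal (bin_tail N (Suc s) (prob {t..})) * indicator {0<..} t \<le> indicator {0<..1} t"
      by (cases "t \<le> 1")
        (auto simp: meas indicator_def bin_tail_le_1, simp add: bin_tail_def Bernstein_def)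
  qed simp
  also have "\<dots> = ennreal (real s)" by (simp add: ennreal_of_nat_eq_real_of_nat[symmetric])
  finally have "rev_vcg s N ?D \<le> ennreal (real s)" .
  moreover have "ennreal (real s) < ennreal (\<Gamma> * real m)"
    using assms by (intro ennreal_lessI) auto
  ultimately show ?thesis using opt by (meson leD order_less_le_trans order_le_less_trans)
qed

text \<open>The second condition on \<open>b\<close> places it at or before the peak of the revenue
  curve, so that truncation there makes \<open>b\<close> the monopoly reserve.\<close>

locale gp_params =
  fixes l b :: real
  assumes l: "0 \<le> l" "l \<le> 1" and b: "0 < b" "(1 - l) * b \<le> 1"
begin

definition base :: "real measure" where
  "base = density lborel (\<lambda>x. ennreal (gp_density l x * indicator {0..} x))"

text \<open>Mass beyond \<open>b\<close> is moved into an atom at \<open>b\<close>, the one place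
  where an atom is allowed; the tail on [0, b] and the virtual value below \<open>b\<close> stay the
  same.\<close>

definition trunc :: "real measure" where
  "trunc = distr base borel (min b)"

lemma gp_density_measurable [measurable]: "gp_density l \<in> borel_measurable borel"
  unfolding gp_density_def[abs_def] by measurable

lemma sets_base [simp]: "sets base = sets borel" "space base = UNIV"
  by (simp_all add: base_def)

lemma gp_tail_lim: "(gp_tail l \<longlongrightarrow> 0) at_top"
proof (cases "l = 0")
  case True
  have "((\<lambda>t::real. exp (- t)) \<longlongrightarrow> 0) at_top" by real_asymp
  then show ?thesis using True by (simp add: gp_tail_def[abs_def])
next
  case False
  then have "0 < l" using l by simp
  then have "((\<lambda>t. (1 + l * t) powr (- 1 / l)) \<longlongrightarrow> 0) at_top" by real_asymp
  then show ?thesis using False by (simp add: gp_tail_def[abs_def])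
qed

lemma emeasure_base_atLeast:
  assumes "0 \<le> t"
  shows "emeasure base {t..} = ennreal (gp_tail l t)"
proof -
  have "emeasure base {t..} = (\<integral>\<^sup>+ x. ennreal (gp_density l x) * indicator {t..} x \<partial>lborel)"
    unfolding base_def using assms
    by (subst emeasure_density) (auto intro!: nn_integral_cong simp: indicator_def)
  also have "\<dots> = ennreal (0 - (- gp_tail l t))"
  proof (rule nn_integral_FTC_atLeast)
    show "((\<lambda>t. - gp_tail l t) has_real_derivative gp_density l x) (at x)" if "t \<le> x" for x
      using DERIV_minus[OF gp_tail_deriv[of l x]] that assms l by simp
    show "((\<lambda>t. - gp_tail l t) \<longlongrightarrow> 0) at_top" using tendsto_minus[OF gp_tail_lim] by simp
  qed (use assms l in \<open>auto intro: less_imp_le[OF gp_density_pos]\<close>)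
  finally show ?thesis by simp
qed

lemma emeasure_base_UNIV: "emeasure base UNIV = 1"
proof -
  have "emeasure base UNIV = emeasure base {0..}"
    unfolding base_def by (subst (1 2) emeasure_density) (auto intro!: nn_integral_cong simp: indicator_def)
  then show ?thesis using emeasure_base_atLeast[of 0] by simp
qed

lemma emeasure_trunc: "A \<in> sets borel \<Longrightarrow> emeasure trunc A = emeasure base (min b -` A)"
  unfolding trunc_def by (subst emeasure_distr) (auto simp: measurable_cong_sets[OF sets_base(1) refl])

lemma prob_space_trunc: "prob_space trunc"
  using emeasure_trunc[of UNIV] emeasure_base_UNIV by (intro prob_spaceI) (simp add: trunc_def)

sublocale real_prob trunc
  by (intro real_prob.intro real_prob_axioms.intro prob_space_trunc) (simp add: trunc_def)

lemma prob_trunc_atLeast: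
  assumes "0 \<le> t"
  shows "prob {t..} = (if t \<le> b then gp_tail l t else 0)"
proof (cases "t \<le> b")
  case True
  then have "min b -` {t..} = {t..}" by auto
  then show ?thesis
    using True emeasure_trunc[of "{t..}"] emeasure_base_atLeast[OF assms] gp_tail_pos[of l t] l assms
    by (simp add: measure_def)
next
  case False
  then have "min b -` {t..} = {}" by auto
  then show ?thesis using False emeasure_trunc[of "{t..}"] by (simp add: measure_def)
qed

lemma prob_trunc_nonneg: "prob {..<0} = 0"
  using one_minus_strict_cdf[of 0] prob_trunc_atLeast[of 0] b by (simp add: strict_cdf_def)

lemma supp_trunc: "supp trunc = {0..b}"
proof (intro set_eqI iffI)
  fix x assume x: "x \<in> {0..b}"
  have "0 < prob (ball x e)" if e: "0 < e" for e
  proof -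
    have "prob {x + e..} < prob {x..}"
      using x e l gp_tail_strict_antimono[of l x "x + e"] gp_tail_pos[of l x]
      by (auto simp: prob_trunc_atLeast)
    then have "0 < prob {x..<x + e}" using prob_atLeast_diff[of x "x + e"] e by simp
    also have "\<dots> \<le> prob (ball x e)" by (intro finite_measure_mono) (auto simp: sets_D dist_real_def)
    finally show ?thesis .
  qed
  then show "x \<in> supp trunc" by (simp add: supp_def)
next
  fix x assume x: "x \<in> supp trunc"
  have "0 \<le> x"
  proof (rule ccontr)
    assume neg: "\<not> 0 \<le> x"
    then have "prob (ball x (- x)) \<le> prob {..<0}"
      by (intro finite_measure_mono) (auto simp: sets_D dist_real_def)
    moreover have "0 < prob (ball x (- x))" using x neg by (simp add: supp_def)
    ultimately show False using prob_trunc_nonneg by simp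
  qed
  moreover have "x \<le> b"
  proof (rule ccontr)
    assume gt: "\<not> x \<le> b"
    then have "min b -` ball x (x - b) = {}" by (auto simp: dist_real_def)
    then have "prob (ball x (x - b)) = 0" by (simp add: measure_def emeasure_trunc)
    moreover have "0 < prob (ball x (x - b))" using x gt by (simp add: supp_def)
    ultimately show False by simp
  qed
  ultimately show "x \<in> {0..b}" by simp
qed

lemma prob_trunc_singleton:
  assumes "v < b"
  shows "prob {v} = 0"
proof -
  have "min b -` {v} = {v}" using assms by auto
  moreover have "emeasure base {v} = 0"
    unfolding base_def by (subst emeasure_density) (auto simp: nn_integral_0_iff_AE AE_lborel_singleton)
  ultimately show ?thesis by (simp add: measure_def emeasure_trunc)
qed

lemma prob_trunc_atom: "prob {b} = gp_tail l b"
proof -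
  have "min b -` {b} = {b..}" by auto
  then show ?thesis
    using emeasure_base_atLeast[of b] b l gp_tail_pos[of l b] by (simp add: measure_def emeasure_trunc)
qed

lemma nonatoms_trunc: "nonatoms trunc = {0..<b}"
  using prob_trunc_atom gp_tail_pos[of l b] l b prob_trunc_singleton
  by (auto simp: nonatoms_def supp_trunc less_le)

lemma trunc_density: "is_density_of (\<lambda>x. gp_density l x * indicator {0..} x) trunc"
  unfolding is_density_of_def
proof (intro conjI allI ballI impI)
  fix A :: "real set" assume A: "A \<in> sets borel" "A \<subseteq> nonatoms trunc"
  then have "A \<subseteq> {..<b}" by (auto simp: nonatoms_trunc)
  then have "min b -` A = A" by (force simp: min_def split: if_splits)
  then show "emeasure trunc A = (\<integral>\<^sup>+ x\<in>A. ennreal (gp_density l x * indicator {0..} x) \<partial>lborel)"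
    using A by (simp add: emeasure_trunc) (simp add: base_def emeasure_density)
next
  fix x :: real
  show "0 \<le> gp_density l x * indicator {0..} x"
    using gp_density_pos[of l x] l by (auto simp: indicator_def intro: less_imp_le)
qed measurable

text \<open>The revenue curve increases strictly up to \<open>b\<close> and vanishes beyond, so the
  choice of a reserve in \<open>rev_opt\<close> is determined.\<close>

lemma monopoly_reserve_trunc: "is_monopoly_reserve trunc r \<longleftrightarrow> r = b"
proof
  assume r: "is_monopoly_reserve trunc r"
  then have "0 \<le> r" "r \<le> b" by (auto simp: is_monopoly_reserve_def supp_trunc)
  moreover have "b * prob {b..} \<le> r * prob {r..}"
    using r b by (auto simp: is_monopoly_reserve_def one_minus_strict_cdf)
  ultimately show "r = b"
    using gp_revenue_strict_mono[of l r b] l b by (cases "r = b") (auto simp: prob_trunc_atLeast)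
next
  assume r: "r = b"
  have "p * prob {p..} \<le> b * prob {b..}" if "0 \<le> p" for p
    using that gp_revenue_strict_mono[of l p b] l b gp_tail_pos[of l b]
    by (cases p b rule: linorder_cases) (auto simp: prob_trunc_atLeast)
  then show "is_monopoly_reserve trunc r"
    using b r by (auto simp: is_monopoly_reserve_def one_minus_strict_cdf supp_trunc)
qed

lemma trunc_lambda_regular: "trunc \<in> lambda_regular l"
proof -
  have "valuation_distribution trunc"
    unfolding valuation_distribution_def
  proof (intro conjI allI impI ballI)
    show "\<exists>f. is_density_of f trunc" using trunc_density by blast
    show "\<exists>r. is_monopoly_reserve trunc r" by (simp add: monopoly_reserve_trunc)
    show "is_interval (supp trunc)" by (simp add: supp_trunc)
    fix v w assume "0 < prob {v}" "w \<in> supp trunc"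
    then show "w \<le> v" using prob_trunc_singleton[of v] by (force simp: supp_trunc)
  qed (simp_all add: prob_space_axioms sets_D prob_trunc_nonneg)
  moreover have "lambda_virtual_value l trunc (\<lambda>x. gp_density l x * indicator {0..} x) v = ereal (- 1)"
    if "v \<in> nonatoms trunc" for v
  proof -
    have v: "0 \<le> v" "v < b" using that by (auto simp: nonatoms_trunc)
    then have "gp_tail l v / gp_density l v = 1 + l * v"
      using gp_tail_eq_density[of l v] gp_density_pos[of l v] l by simp
    then show ?thesis using v gp_density_pos[of l v] l
      by (simp add: lambda_virtual_value_def one_minus_strict_cdf prob_trunc_atLeast)
  qed
  ultimately show ?thesis
    using trunc_density by (auto simp: lambda_regular_def mono_on_def)
qed

text \<open>Only the payments at the reserve are kept; the mean number of sales is at least n q - n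
  P(X > m), where X counts the buyers at \<open>b\<close> and q is their probability.\<close>

lemma rev_opt_trunc_ge:
  assumes "m \<le> n"
  shows "ennreal (real n * b * (gp_tail l b - bin_tail n (Suc m) (gp_tail l b))) \<le> rev_opt m n trunc"
proof -
  let ?q = "gp_tail l b"
  have q: "0 \<le> ?q" "?q \<le> 1" using gp_tail_pos[of l b] gp_tail_le_1[of l b] l b by auto
  have "b * (real n * ?q - real n * bin_tail n (Suc m) ?q) \<le> b * (\<Sum>k=1..m. bin_tail n k ?q)"
    using b q assms by (intro mult_left_mono sum_bin_tail_ge) auto
  then have "ennreal (real n * b * (?q - bin_tail n (Suc m) ?q)) \<le> ennreal (b * (\<Sum>k=1..m. bin_tail n k (prob {b..})))"
    using b by (intro ennreal_leI) (simp add: prob_trunc_atLeast algebra_simps)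
  also have "\<dots> \<le> (\<integral>\<^sup>+ v. ennreal (reserve_payment b m n v) \<partial>sample n)"
    by (subst nn_integral_reserve_payment) (use b assms in auto)
  also have "\<dots> = rev_opt m n trunc"
    using some_equality[of "is_monopoly_reserve trunc" b] by (simp add: rev_opt_def monopoly_reserve_trunc)
  finally show ?thesis .
qed

text \<open>In the layer cake integral, prices up to \<open>t1\<close> are estimated by probability
  1 and those between \<open>t1\<close> and the cap \<open>b\<close> by the tail at
  \<open>t1\<close>.\<close>

lemma rev_vcg_trunc_le:
  assumes "0 \<le> t1"
  shows "rev_vcg s N trunc \<le> ennreal (real s * (t1 + b * bin_tail N (Suc s) (gp_tail l t1)))"
proof -
  let ?p = "gp_tail l t1"
  have p: "0 \<le> ?p" "?p \<le> 1" using gp_tail_pos[of l t1] gp_tail_le_1[of l t1] l assms by auto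
  have "(\<integral>\<^sup>+ t\<in>{0<..}. ennreal (bin_tail N (Suc s) (prob {t..})) \<partial>lborel)
      \<le> (\<integral>\<^sup>+ t. indicator {0<..t1} t + ennreal (bin_tail N (Suc s) ?p) * indicator {0<..b} t \<partial>lborel)"
  proof (intro nn_integral_mono)
    fix t :: real
    show "ennreal (bin_tail N (Suc s) (prob {t..})) * indicator {0<..} t
        \<le> indicator {0<..t1} t + ennreal (bin_tail N (Suc s) ?p) * indicator {0<..b} t"
    proof (cases "0 < t")
      case t: True
      consider "t \<le> t1" | "t1 < t" "t \<le> b" | "t1 < t" "b < t" by linarith
      then show ?thesis
      proof cases
        case 1
        have "ennreal (bin_tail N (Suc s) (prob {t..})) \<le> 1" by (simp add: bin_tail_le_1)
        then show ?thesis using 1 t by (auto simp: indicator_def intro: add_increasing2)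
      next
        case 2
        have "prob {t..} \<le> ?p" using 2 t l assms by (simp add: prob_trunc_atLeast gp_tail_antimono)
        then show ?thesis using 2 t p
          by (auto simp: indicator_def intro!: ennreal_leI bin_tail_mono_prob)
      next
        case 3
        then have "prob {t..} = 0" using t by (simp add: prob_trunc_atLeast)
        then show ?thesis by (simp add: bin_tail_def Bernstein_def)
      qed
    qed simp
  qed
  also have "\<dots> = (\<integral>\<^sup>+ t. indicator {0<..t1} t \<partial>lborel)
      + (\<integral>\<^sup>+ t. ennreal (bin_tail N (Suc s) ?p) * indicator {0<..b} t \<partial>lborel)"
    by (intro nn_integral_add) measurable
  also have "\<dots> = ennreal t1 + ennreal (bin_tail N (Suc s) ?p) * ennreal b"
    using assms b by (simp add: nn_integral_cmult_indicator)
  also have "\<dots> = ennreal (t1 + b * bin_tail N (Suc s) ?p)"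
    using assms b p by (simp add: ennreal_plus ennreal_mult' mult.commute bin_tail_nonneg)
  finally show ?thesis unfolding rev_vcg_eq ennreal_real_mult by (intro mult_left_mono) auto
qed

end

section \<open>Asymptotics\<close>

text \<open>The counterpart of \<open>upper_parameters\<close>: \<open>t2\<close> lies slightly
  before peak / \<alpha>, and \<open>b\<close> at the peak of the revenue curve.\<close>

lemma lower_parameters:
  fixes l \<alpha> \<Gamma> \<kappa> :: real
  assumes l: "0 \<le> l" "l \<le> 1" and \<alpha>: "0 < \<alpha>" "\<alpha> \<le> 1" and \<Gamma>: "0 < \<Gamma>" "\<Gamma> < 1"
    and thr: "supply_threshold l \<le> \<alpha>"
    and \<kappa>: "0 \<le> \<kappa>" "\<kappa> < \<alpha> * \<Gamma> * growth_factor l \<alpha> - 1"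
  obtains b t2 where "gp_params l b" "gp_tail l b < \<alpha>" "0 < t2" "(1 - l) * t2 \<le> 1"
    "(1 + \<kappa>) * gp_tail l t2 < \<alpha> * \<Gamma>" "\<alpha> * t2 < b * gp_tail l b"
proof -
  define t1 where "t1 = gp_peak l / \<alpha>"
  have t1: "0 < t1" using \<alpha> l gp_peak_pos by (simp add: t1_def)
  have G1: "0 < gp_tail l t1" using l t1 by (simp add: gp_tail_pos)
  have "1 + \<kappa> < \<alpha> * \<Gamma> / gp_tail l t1"
    using \<kappa>(2) l \<alpha> by (simp add: growth_factor_eq t1_def)
  then have lt: "(1 + \<kappa>) * gp_tail l t1 < \<alpha> * \<Gamma>"
    using G1 by (simp add: pos_less_divide_eq)
  have "((\<lambda>t. (1 + \<kappa>) * gp_tail l t) \<longlongrightarrow> (1 + \<kappa>) * gp_tail l t1) (at_left t1)"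
    using isCont_gp_tail[of l t1] l t1
    by (intro tendsto_intros filterlim_at_split[THEN iffD1, THEN conjunct1]) (auto simp: isCont_def)
  then have "\<forall>\<^sub>F t in at_left t1. (1 + \<kappa>) * gp_tail l t < \<alpha> * \<Gamma>"
    using lt by (rule order_tendstoD)
  moreover have "\<forall>\<^sub>F t in at_left t1. t \<in> {0<..<t1}" using t1 by (rule eventually_at_leftI[rotated]) auto
  ultimately have "\<forall>\<^sub>F t in at_left t1. (1 + \<kappa>) * gp_tail l t < \<alpha> * \<Gamma> \<and> t \<in> {0<..<t1}"
    by (rule eventually_conj)
  then obtain t2 where t2: "(1 + \<kappa>) * gp_tail l t2 < \<alpha> * \<Gamma>" "0 < t2" "t2 < t1"
    using eventually_happens[of _ "at_left t1"] by (auto simp: trivial_limit_at_left_real)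
  have at2: "\<alpha> * t2 < gp_peak l" using t2 \<alpha> by (simp add: t1_def pos_less_divide_eq mult.commute)
  show ?thesis
  proof (cases "l = 1")
    case True
    \<comment> \<open>For l = 1 the peak is at infinity, so \<open>b\<close> is merely taken large
      enough for the two strict inequalities.\<close>
    have "((\<lambda>b::real. b / (1 + b)) \<longlongrightarrow> 1) at_top" "((\<lambda>b::real. 1 / (1 + b)) \<longlongrightarrow> 0) at_top"
      by real_asymp+
    then have "\<forall>\<^sub>F b in at_top. \<alpha> * t2 < b / (1 + b)" "\<forall>\<^sub>F b in at_top. 1 / (1 + b) < \<alpha>"
      using at2 \<alpha> True by (auto intro: order_tendstoD simp: gp_peak_def)
    then have "\<forall>\<^sub>F b in at_top. \<alpha> * t2 < b / (1 + b) \<and> 1 / (1 + b) < \<alpha> \<and> 0 < b"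
      using eventually_gt_at_top[of "0::real"] by eventually_elim auto
    then obtain b where b: "\<alpha> * t2 < b / (1 + b)" "1 / (1 + b) < \<alpha>" "0 < b"
      using eventually_happens[of _ "at_top :: real filter"] by auto
    have "gp_tail l b = 1 / (1 + b)" using b True by (simp add: gp_tail_def powr_minus_divide)
    then show ?thesis using that[of b t2] b t2 True by (simp add: gp_params_def)
  next
    case False
    then have l1: "l < 1" using l by simp
    define b where "b = 1 / (1 - l)"
    have b: "0 < b" "(1 - l) * b = 1" using l1 by (auto simp: b_def)
    have G: "gp_tail l b = supply_threshold l" using l l1 by (simp add: b_def gp_tail_supply_threshold)
    have peak: "gp_peak l = b * gp_tail l b" using l l1 by (simp add: G gp_peak_eq) (simp add: b_def)
    \<comment> \<open>At equality \<open>t1\<close> coincides with \<open>b\<close>, the growth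
      factor is 1 / \<alpha> and the formula gives \<Gamma> - 1 < 0, contradicting \<kappa> \<ge>
      0.\<close>
    have "gp_tail l b \<noteq> \<alpha>"
    proof
      assume eq: "gp_tail l b = \<alpha>"
      then have "t1 = b" using peak \<alpha> by (simp add: t1_def)
      then have "\<alpha> \<le> (1 + \<kappa>) * gp_tail l t1" using eq \<kappa>(1) \<alpha> by (simp add: mult_le_cancel_right1)
      moreover have "\<alpha> * \<Gamma> < \<alpha>" using \<alpha> \<Gamma> by simp
      ultimately show False using lt by linarith
    qed
    then have "gp_tail l b < \<alpha>" using thr G by simp
    moreover have "(1 - l) * t2 \<le> 1"
    proof -
      have "b * gp_tail l b < b * \<alpha>" using \<open>gp_tail l b < \<alpha>\<close> b by (intro mult_strict_left_mono)
      then have "\<alpha> * t2 < b * \<alpha>" using at2 peak by simp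
      then have "t2 < b" using \<alpha> by (simp add: mult.commute)
      then show ?thesis using b l1 mult_left_mono[of t2 b "1 - l"] by simp
    qed
    ultimately show ?thesis using that[of b t2] b t2 l at2 peak by (simp add: gp_params_def)
  qed
qed

text \<open>For supplies of at least \<Gamma> m the VCG price stays below \<open>t2\<close> up to
  small probability, hence before the peak, where a higher price earns more. Larger supplies only
  lower the price, so one truncated distribution defeats them all.\<close>

lemma eventually_supply_insufficient:
  fixes l \<alpha> \<Gamma> \<kappa> :: real
  assumes l: "0 \<le> l" "l \<le> 1" and \<alpha>: "0 < \<alpha>" "\<alpha> \<le> 1" and \<Gamma>: "0 < \<Gamma>" "\<Gamma> < 1"
    and thr: "supply_threshold l \<le> \<alpha>"
    and \<kappa>: "0 \<le> \<kappa>" "\<kappa> < \<alpha> * \<Gamma> * growth_factor l \<alpha> - 1"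
  shows "\<forall>\<^sub>F n in sequentially. \<forall>k s. real k \<le> \<kappa> * real n \<longrightarrow> s \<in> {1..nat \<lceil>\<alpha> * real n\<rceil>} \<longrightarrow>
    (\<exists>D\<in>lambda_regular l. \<not> ennreal \<Gamma> * rev_opt (nat \<lceil>\<alpha> * real n\<rceil>) n D \<le> rev_vcg s (n + k) D)"
proof -
  obtain b t2 where "gp_params l b" and q\<alpha>: "gp_tail l b < \<alpha>" and t2: "0 < t2" "(1 - l) * t2 \<le> 1"
    "(1 + \<kappa>) * gp_tail l t2 < \<alpha> * \<Gamma>" "\<alpha> * t2 < b * gp_tail l b"
    using lower_parameters[OF assms] .
  then interpret gp_params l b by simp
  define q where "q = gp_tail l b"
  \<comment> \<open>\<open>x0\<close> bounds s / N from below for the supplies considered, and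
    \<open>x2\<close> < \<open>x0\<close> is the tail at \<open>t2\<close>. \<open>\<delta>\<close>
    is their relative gap, \<open>\<gamma>\<close> the gap in revenue per original buyer before the
    factor \<Gamma>.\<close>
  define x2 where "x2 = gp_tail l t2"
  define x0 where "x0 = \<alpha> * \<Gamma> / (1 + \<kappa>)"
  define \<delta> where "\<delta> = 1 - x2 / x0"
  define \<gamma> where "\<gamma> = b * q - \<alpha> * t2"
  have x2: "0 < x2" using l t2 by (simp add: x2_def gp_tail_pos)
  have x0: "0 < x0" "x2 < x0" "x0 * (1 + \<kappa>) = \<alpha> * \<Gamma>"
    using \<alpha> \<Gamma> \<kappa> t2 by (auto simp: x0_def x2_def pos_less_divide_eq mult.commute add_pos_nonneg)
  have \<delta>: "0 < \<delta>" "\<delta> < 1" using x0 x2 by (auto simp: \<delta>_def)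
  have \<gamma>: "0 < \<gamma>" using t2 by (simp add: \<gamma>_def q_def)
  have q: "0 \<le> q" "q \<le> 1" using gp_tail_pos[of l b] gp_tail_le_1[of l b] l b by (auto simp: q_def)
  define d where "d = \<delta> * (\<Gamma> * \<alpha>)"
  have d: "0 < d" using \<delta> \<Gamma> \<alpha> by (simp add: d_def)
  define e where "e = \<alpha> - q"
  have e: "0 < e" using q\<alpha> by (simp add: e_def q_def)
  have "(\<lambda>n. (1 + \<kappa>) * real n / (d * real n)\<^sup>2) \<longlonglongrightarrow> 0" "(\<lambda>n. real n / (e * real n)\<^sup>2) \<longlonglongrightarrow> 0"
    using d e by real_asymp+
  \<comment> \<open>Each of the two revenue estimates may use up a third of the gap
    \<open>\<gamma>\<close>; the last third keeps the comparison strict.\<close>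
  then have "\<forall>\<^sub>F n in sequentially. (1 + \<kappa>) * real n / (d * real n)\<^sup>2 < \<Gamma> * \<gamma> / (3 * b)"
    and "\<forall>\<^sub>F n in sequentially. real n / (e * real n)\<^sup>2 < \<gamma> / (3 * b)"
    using \<Gamma> \<gamma> b by (auto intro: order_tendstoD)
  then show ?thesis
  proof eventually_elim
    case (elim n)
    define m where "m = nat \<lceil>\<alpha> * real n\<rceil>"
    have m: "\<alpha> * real n \<le> real m" using \<alpha> unfolding m_def by (intro nat_ceiling_bounds) simp
    have mn: "m \<le> n"
      using \<alpha> mult_right_mono[of \<alpha> 1 "real n"] unfolding m_def by (simp add: nat_le_iff ceiling_le_iff)
    show ?case
      unfolding m_def[symmetric]
    proof (intro allI impI)
      fix k s assume k: "real k \<le> \<kappa> * real n" and s: "s \<in> {1..m}"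
      show "\<exists>D\<in>lambda_regular l. \<not> ennreal \<Gamma> * rev_opt m n D \<le> rev_vcg s (n + k) D"
      proof (cases "real s < \<Gamma> * real m")
        case True
        then show ?thesis
          using point_mass_lambda_regular point_mass_beats_small_supply[OF mn] by blast
      next
        case False
        define N where "N = n + k"
        have n0: "0 < real n" using s mn by simp
        have N: "real N \<le> (1 + \<kappa>) * real n" "real n \<le> real N" "0 < real N"
          using k n0 by (simp_all add: N_def algebra_simps)
        have sN: "real s \<le> real n" "real s \<le> real N" "0 < real s" using s mn by (auto simp: N_def)
        have "\<Gamma> * (\<alpha> * real n) \<le> \<Gamma> * real m" using m \<Gamma> by (intro mult_left_mono) auto
        then have s_ge: "\<Gamma> * \<alpha> * real n \<le> real s" using False by simp
        have x0_le: "x0 * real N \<le> real s"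
        proof -
          have "x0 * real N \<le> x0 * ((1 + \<kappa>) * real n)" using N x0 by (intro mult_left_mono) auto
          also have "\<dots> = \<Gamma> * \<alpha> * real n" by (simp only: mult.assoc[symmetric] x0(3) mult.commute[of \<Gamma> \<alpha>])
          finally show ?thesis using s_ge by simp
        qed
        \<comment> \<open>Scaled so that N x1 = (1 - \<delta>) s: demand at this level falls short
          of the supply by a fixed fraction, as Chebyshev requires, while x1 \<ge> x2 keeps
          \<open>t1\<close> at most \<open>t2\<close>.\<close>
        define x1 where "x1 = (x2 / x0) * (real s / real N)"
        have "x0 \<le> real s / real N" using x0_le N by (simp add: pos_le_divide_eq)
        then have "(x2 / x0) * x0 \<le> x1" unfolding x1_def using x2 x0 by (intro mult_left_mono) auto
        then have x1_ge: "x2 \<le> x1" using x0 by simp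
        have "x1 \<le> 1 * 1" unfolding x1_def using x2 x0 sN N by (intro mult_mono) auto
        then have x1: "0 < x1" "x1 \<le> 1" using x1_ge x2 by simp_all
        define t1 where "t1 = gp_quantile l x1"
        have Gt1: "gp_tail l t1 = x1" using x1 l by (simp add: t1_def gp_tail_quantile)
        have t1: "0 \<le> t1" using x1 l by (simp add: t1_def gp_quantile_nonneg)
        have "t1 \<le> t2"
        proof (rule ccontr)
          assume "\<not> t1 \<le> t2"
          then have "gp_tail l t1 < gp_tail l t2" using l t2 by (intro gp_tail_strict_antimono) auto
          then show False using x1_ge by (simp add: Gt1 x2_def)
        qed
        \<comment> \<open>The revenue curve increases up to \<open>t2\<close> since (1 - l) t2 \<le>
          1; this makes the bound uniform in s.\<close>
        then have rev: "t1 * x1 \<le> t2 * x2"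
          unfolding Gt1[symmetric] x2_def
          using gp_revenue_strict_mono[of l t1 t2] l t1 t2 by (cases "t1 = t2") auto
        have "real s * t1 = real N * (x0 / x2) * (t1 * x1)"
          unfolding x1_def using x0 x2 N by simp
        also have "\<dots> \<le> real N * (x0 / x2) * (t2 * x2)" using rev x0 x2 by (intro mult_left_mono) auto
        also have "\<dots> = (x0 * t2) * real N" using x2 by simp
        also have "\<dots> \<le> (x0 * t2) * ((1 + \<kappa>) * real n)" using N x0 t2 by (intro mult_left_mono) auto
        also have "\<dots> = (x0 * (1 + \<kappa>)) * (t2 * real n)" by (simp add: mult_ac)
        also have "\<dots> = real n * \<Gamma> * (\<alpha> * t2)" unfolding x0(3) by (simp add: mult_ac)
        finally have st1: "real s * t1 \<le> real n * \<Gamma> * (\<alpha> * t2)" .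
        let ?\<tau>1 = "bin_tail N (Suc s) x1" and ?\<tau>2 = "bin_tail n (Suc m) q"
        have "real N * x1 + \<delta> * real s = real s"
          unfolding x1_def \<delta>_def using N by (simp add: algebra_simps)
        then have "?\<tau>1 \<le> real N / (\<delta> * real s)\<^sup>2"
          using x1 \<delta> sN by (intro bin_tail_le_chebyshev) auto
        also have "\<dots> \<le> (1 + \<kappa>) * real n / (d * real n)\<^sup>2"
        proof (intro frac_le power_mono)
          show "d * real n \<le> \<delta> * real s"
            using s_ge \<delta> mult_left_mono[of "\<Gamma> * \<alpha> * real n" "real s" \<delta>] by (simp add: d_def mult.assoc)
        qed (use N d n0 \<kappa> in auto)
        also have "\<dots> < \<Gamma> * \<gamma> / (3 * b)" by (rule elim(1))
        finally have "b * ?\<tau>1 < \<Gamma> * \<gamma> / 3" using b by (simp add: pos_less_divide_eq mult.commute field_simps)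
        moreover have "0 \<le> b * ?\<tau>1" using b x1 by (simp add: bin_tail_nonneg)
        ultimately have "real s * (b * ?\<tau>1) \<le> real n * (\<Gamma> * \<gamma> / 3)"
          using sN by (intro mult_mono) auto
        with st1 have vcg: "real s * (t1 + b * ?\<tau>1) \<le> real n * \<Gamma> * (\<alpha> * t2 + \<gamma> / 3)"
          by (simp add: distrib_left mult.assoc)
        have "real n * q + e * real n = \<alpha> * real n" by (simp add: e_def algebra_simps)
        then have "?\<tau>2 \<le> real n / (e * real n)\<^sup>2"
          using q e n0 m by (intro bin_tail_le_chebyshev) auto
        also have "\<dots> < \<gamma> / (3 * b)" by (rule elim(2))
        finally have "b * ?\<tau>2 < \<gamma> / 3" using b by (simp add: pos_less_divide_eq field_simps)
        moreover have "b * (q - ?\<tau>2) = \<alpha> * t2 + \<gamma> - b * ?\<tau>2"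
          by (simp add: \<gamma>_def right_diff_distrib)
        ultimately have "\<alpha> * t2 + \<gamma> / 3 < b * (q - ?\<tau>2)" using \<gamma> by linarith
        then have "real n * \<Gamma> * (\<alpha> * t2 + \<gamma> / 3) < real n * \<Gamma> * (b * (q - ?\<tau>2))"
          using n0 \<Gamma> by (intro mult_strict_left_mono) auto
        with vcg have less: "real s * (t1 + b * ?\<tau>1) < \<Gamma> * (real n * b * (q - ?\<tau>2))"
          by (simp add: mult_ac)
        have pos: "0 \<le> real s * (t1 + b * ?\<tau>1)"
          using t1 b x1 by (simp add: bin_tail_nonneg)
        have "rev_vcg s N trunc \<le> ennreal (real s * (t1 + b * ?\<tau>1))"
          using rev_vcg_trunc_le[OF t1, of s N] by (simp add: Gt1)
        also have "\<dots> < ennreal (\<Gamma> * (real n * b * (q - ?\<tau>2)))"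
          using less pos by (intro ennreal_lessI) auto
        also have "\<dots> \<le> ennreal \<Gamma> * rev_opt m n trunc"
          unfolding ennreal_mult'[OF less_imp_le[OF \<Gamma>(1)]] q_def
          by (intro mult_left_mono rev_opt_trunc_ge mn) simp
        finally show ?thesis using trunc_lambda_regular unfolding N_def by (auto simp: not_le)
      qed
    qed
  qed
qed

text \<open>The lower hypothesis excludes numbers k one by one, so that it also covers c n =
  \<infinity>.\<close>

lemma enat_ratio_tendsto:
  fixes c :: "nat \<Rightarrow> enat" and V :: real
  assumes V: "0 \<le> V"
    and upper: "\<And>\<kappa>. V < \<kappa> \<Longrightarrow> \<forall>\<^sub>F n in sequentially. c n \<le> enat (nat \<lceil>\<kappa> * real n\<rceil>)"
    and lower: "\<And>\<kappa>. 0 \<le> \<kappa> \<Longrightarrow> \<kappa> < V \<Longrightarrow>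
      \<forall>\<^sub>F n in sequentially. \<forall>k. real k \<le> \<kappa> * real n \<longrightarrow> \<not> c n \<le> enat k"
  shows "(\<lambda>n. ereal_of_enat (c n) / ereal (real n)) \<longlonglongrightarrow> ereal V"
proof (rule order_tendstoI)
  fix a assume a: "a < ereal V"
  show "\<forall>\<^sub>F n in sequentially. a < ereal_of_enat (c n) / ereal (real n)"
  proof (cases "a < 0")
    case True
    show ?thesis
      using eventually_gt_at_top[of 0]
    proof eventually_elim
      case (elim n)
      then have "0 \<le> ereal_of_enat (c n) / ereal (real n)" by (cases "c n") auto
      with True show ?case by (rule less_le_trans)
    qed
  next
    case False
    then obtain a' where a': "a = ereal a'" "0 \<le> a'" "a' < V" using a by (cases a) auto
    then have "\<forall>\<^sub>F n in sequentially. \<forall>k. real k \<le> (a' + V) / 2 * real n \<longrightarrow> \<not> c n \<le> enat k"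
      by (intro lower) auto
    then show ?thesis
      using eventually_gt_at_top[of 0]
    proof eventually_elim
      case (elim n)
      show ?case
      proof (cases "c n")
        case (enat k)
        then have "(a' + V) / 2 * real n < real k" using elim(1) by (auto simp: not_le[symmetric])
        moreover have "a' * real n < (a' + V) / 2 * real n" using a' elim(2) by (intro mult_strict_right_mono) auto
        ultimately have "a' * real n < real k" by linarith
        then have "a' < real k / real n" using elim(2) by (simp add: pos_less_divide_eq)
        then show ?thesis using enat a' elim(2) by simp
      next
        case infinity
        then show ?thesis using elim(2) a' by simp
      qed
    qed
  qed
next
  fix a assume a: "ereal V < a"
  then obtain a' where a': "V < a'" "ereal a' \<le> a" by (metis ereal_dense2 ereal_less_eq(3) less_ereal.simps(1) less_imp_le)
  have "\<forall>\<^sub>F n in sequentially. c n \<le> enat (nat \<lceil>(V + a') / 2 * real n\<rceil>)"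
    using a' by (intro upper) auto
  \<comment> \<open>The gap between the midpoint and a' absorbs the rounding in the ceiling.\<close>
  moreover have "\<forall>\<^sub>F n in sequentially. 2 \<le> (a' - V) / 2 * real n"
    using a' by (intro eventually_mult_real_ge) auto
  ultimately show "\<forall>\<^sub>F n in sequentially. ereal_of_enat (c n) / ereal (real n) < a"
    using eventually_gt_at_top[of 0]
  proof eventually_elim
    case (elim n)
    obtain k where k: "c n = enat k" "k \<le> nat \<lceil>(V + a') / 2 * real n\<rceil>"
      using elim(1) by (cases "c n") auto
    have "0 \<le> (V + a') / 2 * real n" using V a' by (intro mult_nonneg_nonneg) auto
    then have "real k \<le> (V + a') / 2 * real n + 1"
      using k(2) nat_ceiling_bounds(2) by (meson of_nat_le_iff order_trans)
    also have "\<dots> < a' * real n" using elim(2) by (simp add: field_simps)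
    finally have "real k / real n < a'" using elim(3) by (simp add: pos_divide_less_eq)
    then have "ereal_of_enat (c n) / ereal (real n) < ereal a'" using k elim(3) by simp
    with a' show ?case by (simp add: less_le_trans)
  qed
qed

text \<open>Sufficiency is known for the one supply s and insufficiency for all supplies in {1..m},
  so the fixed and the optimally chosen supply share the same limit.\<close>

lemma CC_SL_asymptotics:
  fixes l \<alpha> \<Gamma> :: real
  assumes l: "0 \<le> l" "l \<le> 1" and \<alpha>: "0 < \<alpha>" "\<alpha> \<le> 1" and \<Gamma>: "0 < \<Gamma>" "\<Gamma> < 1"
  defines "m \<equiv> \<lambda>n. nat \<lceil>\<alpha> * real n\<rceil>"
    and "V \<equiv> max (\<alpha> * \<Gamma> * growth_factor l \<alpha> - 1) 0 * of_bool (\<alpha> \<ge> supply_threshold l)"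
  shows "(\<lambda>n. ereal_of_enat (CC_SL (m n) n (lambda_regular l) \<Gamma>) / ereal (real n)) \<longlonglongrightarrow> ereal V"
    and "(\<lambda>n. ereal_of_enat (CC_SL_fixed (nat \<lceil>\<Gamma> * real (m n)\<rceil>) (m n) n (lambda_regular l) \<Gamma>) / ereal (real n))
      \<longlonglongrightarrow> ereal V"
proof -
  define s where "s n = nat \<lceil>\<Gamma> * real (m n)\<rceil>" for n
  have s: "\<forall>\<^sub>F n in sequentially. s n \<in> {1..m n}"
    using eventually_gt_at_top[of 0]
  proof eventually_elim
    case (elim n)
    then have "0 < \<lceil>\<alpha> * real n\<rceil>" using \<alpha> by simp
    then have "0 < m n" by (simp add: m_def)
    then have "0 < \<lceil>\<Gamma> * real (m n)\<rceil>" using \<Gamma> by simp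
    then have "0 < s n" unfolding s_def by (simp only: zero_less_nat_eq)
    moreover have "s n \<le> m n"
      using \<Gamma> mult_right_mono[of \<Gamma> 1 "real (m n)"] unfolding s_def by (simp add: nat_le_iff ceiling_le_iff)
    ultimately show ?case by simp
  qed
  have V: "0 \<le> V" by (simp add: V_def)
  have up: "\<forall>\<^sub>F n in sequentially. \<forall>D\<in>lambda_regular l.
      ennreal \<Gamma> * rev_opt (m n) n D \<le> rev_vcg (s n) (n + nat \<lceil>\<kappa> * real n\<rceil>) D" if "V < \<kappa>" for \<kappa>
  proof -
    have "0 < \<kappa>" using that V by simp
    moreover have "\<alpha> * \<Gamma> * growth_factor l \<alpha> - 1 < \<kappa>" if "supply_threshold l \<le> \<alpha>"
      using that \<open>V < \<kappa>\<close> by (simp add: V_def)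
    ultimately obtain tb \<eta>\<^sub>0 where *: "0 < tb" "0 < \<eta>\<^sub>0" "\<alpha> * \<Gamma> < (1 + \<kappa>) * gp_tail l tb"
        "\<And>\<tau>. tb \<le> \<tau> \<Longrightarrow> \<tau> * gp_tail l \<tau> \<le> \<alpha> * (1 - \<eta>\<^sub>0) * tb"
      using upper_parameters[OF l \<alpha> \<Gamma>] by metis
    from eventually_rev_opt_le[OF l \<alpha> \<Gamma> \<open>0 < \<kappa>\<close> *] show ?thesis unfolding m_def s_def .
  qed
  have low: "\<forall>\<^sub>F n in sequentially. \<forall>k t. real k \<le> \<kappa> * real n \<longrightarrow> t \<in> {1..m n} \<longrightarrow>
      \<not> (\<forall>D\<in>lambda_regular l. ennreal \<Gamma> * rev_opt (m n) n D \<le> rev_vcg t (n + k) D)"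
    if "0 \<le> \<kappa>" "\<kappa> < V" for \<kappa>
  proof -
    have "supply_threshold l \<le> \<alpha>" "\<kappa> < \<alpha> * \<Gamma> * growth_factor l \<alpha> - 1"
      using that by (cases "supply_threshold l \<le> \<alpha>"; auto simp: V_def max_def split: if_splits)+
    from eventually_supply_insufficient[OF l \<alpha> \<Gamma> this(1) that(1) this(2)]
    show ?thesis unfolding m_def by eventually_elim blast
  qed
  show "(\<lambda>n. ereal_of_enat (CC_SL (m n) n (lambda_regular l) \<Gamma>) / ereal (real n)) \<longlonglongrightarrow> ereal V"
  proof (rule enat_ratio_tendsto[OF V])
    fix \<kappa> assume "V < \<kappa>"
    from up[OF this] s show "\<forall>\<^sub>F n in sequentially. CC_SL (m n) n (lambda_regular l) \<Gamma> \<le> enat (nat \<lceil>\<kappa> * real n\<rceil>)"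
      by eventually_elim (auto simp: CC_SL_def intro!: Inf_lower imageI)
  next
    fix \<kappa> assume "0 \<le> \<kappa>" "\<kappa> < V"
    from low[OF this] show "\<forall>\<^sub>F n in sequentially. \<forall>k. real k \<le> \<kappa> * real n \<longrightarrow>
        \<not> CC_SL (m n) n (lambda_regular l) \<Gamma> \<le> enat k"
    proof eventually_elim
      case (elim n)
      show ?case
      proof (intro allI impI)
        fix k assume k: "real k \<le> \<kappa> * real n"
        \<comment> \<open>Bounding the infimum from below by \<open>Suc k\<close> also covers the
          empty set, whose infimum is \<infinity>.\<close>
        have "enat (Suc k) \<le> CC_SL (m n) n (lambda_regular l) \<Gamma>"
          unfolding CC_SL_def
        proof (rule Inf_greatest)
          fix x assume "x \<in> enat ` {k. \<exists>s\<in>{1..m n}. \<forall>D\<in>lambda_regular l. ennreal \<Gamma> * rev_opt (m n) n D \<le> rev_vcg s (n + k) D}"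
          then obtain j t where j: "x = enat j" "t \<in> {1..m n}"
            "\<forall>D\<in>lambda_regular l. ennreal \<Gamma> * rev_opt (m n) n D \<le> rev_vcg t (n + j) D" by blast
          then have "\<not> real j \<le> \<kappa> * real n" using elim by blast
          then have "k < j" using k by linarith
          then show "enat (Suc k) \<le> x" using j by simp
        qed
        then show "\<not> CC_SL (m n) n (lambda_regular l) \<Gamma> \<le> enat k"
          by (metis Suc_n_not_le_n enat_ord_simps(1) order_trans)
      qed
    qed
  qed
  have "(\<lambda>n. ereal_of_enat (CC_SL_fixed (s n) (m n) n (lambda_regular l) \<Gamma>) / ereal (real n)) \<longlonglongrightarrow> ereal V"
  proof (rule enat_ratio_tendsto[OF V])
    fix \<kappa> assume "V < \<kappa>"
    from up[OF this] show "\<forall>\<^sub>F n in sequentially. CC_SL_fixed (s n) (m n) n (lambda_regular l) \<Gamma> \<le> enat (nat \<lceil>\<kappa> * real n\<rceil>)"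
      by eventually_elim (auto simp: CC_SL_fixed_def intro!: Inf_lower imageI)
  next
    fix \<kappa> assume "0 \<le> \<kappa>" "\<kappa> < V"
    from low[OF this] s show "\<forall>\<^sub>F n in sequentially. \<forall>k. real k \<le> \<kappa> * real n \<longrightarrow>
        \<not> CC_SL_fixed (s n) (m n) n (lambda_regular l) \<Gamma> \<le> enat k"
    proof eventually_elim
      case (elim n)
      show ?case
      proof (intro allI impI)
        fix k assume k: "real k \<le> \<kappa> * real n"
        have "enat (Suc k) \<le> CC_SL_fixed (s n) (m n) n (lambda_regular l) \<Gamma>"
          unfolding CC_SL_fixed_def
        proof (rule Inf_greatest)
          fix x assume "x \<in> enat ` {k. \<forall>D\<in>lambda_regular l. ennreal \<Gamma> * rev_opt (m n) n D \<le> rev_vcg (s n) (n + k) D}"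
          then obtain j where j: "x = enat j"
            "\<forall>D\<in>lambda_regular l. ennreal \<Gamma> * rev_opt (m n) n D \<le> rev_vcg (s n) (n + j) D" by blast
          then have "\<not> real j \<le> \<kappa> * real n" using elim by blast
          then have "k < j" using k by linarith
          then show "enat (Suc k) \<le> x" using j by simp
        qed
        then show "\<not> CC_SL_fixed (s n) (m n) n (lambda_regular l) \<Gamma> \<le> enat k"
          by (metis Suc_n_not_le_n enat_ord_simps(1) order_trans)
      qed
    qed
  qed
  then show "(\<lambda>n. ereal_of_enat (CC_SL_fixed (nat \<lceil>\<Gamma> * real (m n)\<rceil>) (m n) n (lambda_regular l) \<Gamma>) / ereal (real n))
      \<longlonglongrightarrow> ereal V" by (simp add: s_def)
qed

theorem theorem5p2:
  fixes lam \<alpha> \<Gamma> :: real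
  assumes "0 \<le> lam" "lam \<le> 1" "0 < \<alpha>" "\<alpha> \<le> 1" "0 < \<Gamma>" "\<Gamma> < 1"
  shows
    "(\<lambda>n. ereal_of_enat (CC_SL (nat \<lceil>\<alpha> * real n\<rceil>) n (lambda_regular lam) \<Gamma>) / ereal (real n))
       \<longlonglongrightarrow> ereal (max (\<alpha> * \<Gamma> * growth_factor lam \<alpha> - 1) 0 * of_bool (\<alpha> \<ge> supply_threshold lam))
     \<and>
     (\<lambda>n. ereal_of_enat (CC_SL_fixed (nat \<lceil>\<Gamma> * real (nat \<lceil>\<alpha> * real n\<rceil>)\<rceil>)
               (nat \<lceil>\<alpha> * real n\<rceil>) n (lambda_regular lam) \<Gamma>) / ereal (real n))
       \<longlonglongrightarrow> ereal (max (\<alpha> * \<Gamma> * growth_factor lam \<alpha> - 1) 0 * of_bool (\<alpha> \<ge> supply_threshold lam))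
     \<and>
     (\<lambda>n. ereal_of_enat (CC_SL (nat \<lceil>\<alpha> * real n\<rceil>) n mhr \<Gamma>) / ereal (real n))
       \<longlonglongrightarrow> ereal (max (\<alpha> * \<Gamma> * exp (1 / (exp 1 * \<alpha>)) - 1) 0 * of_bool (\<alpha> \<ge> 1 / exp 1))
     \<and>
     (\<lambda>n. ereal_of_enat (CC_SL (nat \<lceil>\<alpha> * real n\<rceil>) n regular \<Gamma>) / ereal (real n))
       \<longlonglongrightarrow> ereal (max (\<alpha> * \<Gamma> + \<Gamma> - 1) 0)"
proof (intro conjI)
  show "(\<lambda>n. ereal_of_enat (CC_SL (nat \<lceil>\<alpha> * real n\<rceil>) n mhr \<Gamma>) / ereal (real n))
       \<longlonglongrightarrow> ereal (max (\<alpha> * \<Gamma> * exp (1 / (exp 1 * \<alpha>)) - 1) 0 * of_bool (\<alpha> \<ge> 1 / exp 1))"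
    using CC_SL_asymptotics(1)[of 0 \<alpha> \<Gamma>] assms
    by (simp add: growth_factor_def supply_threshold_def)
  have "\<alpha> * \<Gamma> * growth_factor 1 \<alpha> - 1 = \<alpha> * \<Gamma> + \<Gamma> - 1" "supply_threshold 1 \<le> \<alpha>"
    using assms by (simp_all add: growth_factor_def supply_threshold_def field_simps)
  then show "(\<lambda>n. ereal_of_enat (CC_SL (nat \<lceil>\<alpha> * real n\<rceil>) n regular \<Gamma>) / ereal (real n))
       \<longlonglongrightarrow> ereal (max (\<alpha> * \<Gamma> + \<Gamma> - 1) 0)"
    using CC_SL_asymptotics(1)[of 1 \<alpha> \<Gamma>] assms by simp
qed (rule CC_SL_asymptotics[OF assms])+

end
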